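(* Assume $\gamma>0$ and $\int^\infty\frac{\mathrm{d}x}{x\Psi(1/x)R(x)}<\infty$. Let $\varphi(b)=\frac1\gamma\int_b^\infty\frac{\mathrm{d}x}{R(x)}$ and $V(z,\rho)=\sup_{x\ge z}\left(\frac{R(x)}{R(x+\rho z)}-1\right)_+$. If (H1) $\limsup_{h\to1+}\liminf_{x\to\infty}\frac{\varphi(hx)}{\varphi(x)}=1$ and (H3) $\limsup_{\rho\to0+}\lim_{z\to\infty}V(z,\rho)=0$ hold, then $\frac{T_b}{\mathbb{E}_\infty[T_b]}\to1$ in $\mathbb{P}_\infty$-probability as $b\to\infty$.
   Context: Let $\Psi(\lambda)=\gamma\lambda+\frac{\sigma^2}{2}\lambda^2+\int_0^\infty(e^{-\lambda z}-1+\lambda z)\,\pi(\mathrm{d}z)$ for $\lambda\ge0$, with $\sigma\ge0$, $\pi$ a measure on $(0,\infty)$ with $\int_0^\infty(z\wedge z^2)\pi(\mathrm{d}z)<\infty$. $Z$ is a spectrally positive Lévy process with $\mathbb{E}[e^{-\lambda Z_1}\mid Z_0=x]=e^{-\lambda x+\Psi(\lambda)}$. $R$ is continuous on $[0,\infty)$, strictly positive on $(0,\infty)$. With $\tau_0^-=\inf\{t:Z_t<0\}$, $\eta(s)=\int_0^{s\wedge\tau_0^-}\frac{\mathrm{d}r}{R(Z_r)}$, $\eta^{-1}(t)=\inf\{s:\eta(s)>t\}$, set $X_t=Z_{\eta^{-1}(t)\wedge\tau_0^-}$ and $T_b=\inf\{t\ge0:X_t<b\}$. Under the integral condition, $\infty$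 is an instantaneous entrance boundary for $X$ ($X$ does not explode and $\lim_{b\to\infty}\liminf_{x\to\infty}\mathbb{P}_x(T_b\le t)=1$ for all $t>0$), and $\mathbb{P}_\infty,\mathbb{E}_\infty$ refer to the càdlàg strong Markov process started at $\infty$, leaving it instantaneously, evolving from finite states as $X$. $(y)_+=\max(y,0)$. *)

theory Defs
  imports "HOL-Probability.Probability"
begin

definition Psi :: "real \<Rightarrow> real \<Rightarrow> real measure \<Rightarrow> real \<Rightarrow> real" where
  "Psi \<gamma> \<sigma> \<pi> lam = \<gamma> * lam + \<sigma>\<^sup>2 / 2 * lam\<^sup>2
     + (\<integral>z. exp (- lam * z) - 1 + lam * z \<partial>\<pi>)"

definition levy_measure_ok :: "real measure \<Rightarrow> bool" where
  "levy_measure_ok \<pi> \<longleftrightarrow> sets \<pi> = sets borel \<and> emeasure \<pi> {..0} = 0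
     \<and> (\<integral>\<^sup>+ z. ennreal (min z (z\<^sup>2)) \<partial>\<pi>) < \<infinity>"

definition cadlag_path :: "(real \<Rightarrow> real) \<Rightarrow> bool" where
  "cadlag_path f \<longleftrightarrow> (\<forall>t\<ge>0. (f \<longlongrightarrow> f t) (at_right t))
     \<and> (\<forall>t>0. \<exists>l. (f \<longlongrightarrow> l) (at_left t))"

text \<open>L is a Levy process started at 0 on the probability space M (cadlag paths,
  independent and stationary increments) with Laplace exponent Psi:
  E[exp(-lambda L_1)] = exp(Psi(lambda)) for lambda >= 0.  Then Z = x + L has
  E[exp(-lambda Z_1) | Z_0 = x] = exp(-lambda x + Psi(lambda)).\<close>
definition levy_process_with_exponent ::
    "'a measure \<Rightarrow> (real \<Rightarrow> 'a \<Rightarrow> real) \<Rightarrow> (real \<Rightarrow> real) \<Rightarrow> bool" where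
  "levy_process_with_exponent M L \<Psi> \<longleftrightarrow>
     prob_space M
   \<and> (\<forall>t. L t \<in> borel_measurable M)
   \<and> (\<forall>\<omega>\<in>space M. L 0 \<omega> = 0 \<and> cadlag_path (\<lambda>t. L t \<omega>))
   \<and> (\<forall>(n::nat) (ts::nat \<Rightarrow> real). 0 \<le> ts 0 \<and> (\<forall>i<n. ts i \<le> ts (Suc i)) \<longrightarrow>
        prob_space.indep_vars M (\<lambda>_. borel) (\<lambda>i \<omega>. L (ts (Suc i)) \<omega> - L (ts i) \<omega>) {..<n})
   \<and> (\<forall>s t. 0 \<le> s \<longrightarrow> 0 \<le> t \<longrightarrow>
        distr M borel (\<lambda>\<omega>. L (s + t) \<omega> - L s \<omega>) = distr M borel (L t))
   \<and> (\<forall>lam\<ge>0. integrable M (\<lambda>\<omega>. exp (- lam * L 1 \<omega>))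
        \<and> (\<integral>\<omega>. exp (- lam * L 1 \<omega>) \<partial>M) = exp (\<Psi> lam))"

definition tau0 :: "(real \<Rightarrow> real) \<Rightarrow> ereal" where
  "tau0 z = Inf {ereal s | s. 0 \<le> s \<and> z s < 0}"

definition eta :: "(real \<Rightarrow> real) \<Rightarrow> (real \<Rightarrow> real) \<Rightarrow> real \<Rightarrow> ennreal" where
  "eta R z s = (\<integral>\<^sup>+ r. indicator {0..s} r * indicator {r. ereal r < tau0 z} r
                        * inverse (ennreal (R (z r))) \<partial>lborel)"

definition eta_inv :: "(real \<Rightarrow> real) \<Rightarrow> (real \<Rightarrow> real) \<Rightarrow> real \<Rightarrow> ereal" where
  "eta_inv R z t = Inf {ereal s | s. 0 \<le> s \<and> eta R z s > ennreal t}"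

text \<open>X_t = Z_(eta^{-1}(t) min tau_0^-).  (On the null event where this time is
  infinite the value is an arbitrary convention.)\<close>
definition Xpath :: "(real \<Rightarrow> real) \<Rightarrow> (real \<Rightarrow> real) \<Rightarrow> real \<Rightarrow> real" where
  "Xpath R z t = z (real_of_ereal (min (eta_inv R z t) (tau0 z)))"

text \<open>T_b = inf{t : p_t < b} for a path defined on (0,infty) (the value at time 0 is
  infinity for the process started at infinity, hence never below b).\<close>
definition hit_below :: "(real \<Rightarrow> real) \<Rightarrow> real \<Rightarrow> real" where
  "hit_below p b = Inf {t. 0 < t \<and> p t < b}"

definition nat_filtration :: "'b measure \<Rightarrow> (real \<Rightarrow> 'b \<Rightarrow> real) \<Rightarrow> real \<Rightarrow> 'b measure" where
  "nat_filtration N Y s = sigma (space N)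
     {Y u -` B \<inter> space N | u B. 0 < u \<and> u \<le> s \<and> B \<in> sets borel}"

text \<open>(N, Y) is a cadlag process on (0,infty) started at infinity (Y_t tends to infinity
  as t tends to 0+), which is strong Markov with respect to its natural filtration and
  evolves from finite states as X, i.e. after any strictly positive finite stopping time
  T the shifted process (Y_(T+t))_t has, conditionally on F_T, the law of X under
  P_(Y_T), where X under P_y is built from Z = y + L.\<close>
definition entrance_from_infinity ::
    "'a measure \<Rightarrow> (real \<Rightarrow> 'a \<Rightarrow> real) \<Rightarrow> (real \<Rightarrow> real)
      \<Rightarrow> 'b measure \<Rightarrow> (real \<Rightarrow> 'b \<Rightarrow> real) \<Rightarrow> bool" where
  "entrance_from_infinity M L R N Y \<longleftrightarrow>
     prob_space N
   \<and> (\<forall>t>0. Y t \<in> borel_measurable N)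
   \<and> (\<forall>\<omega>\<in>space N.
        (\<forall>t>0. ((\<lambda>s. Y s \<omega>) \<longlongrightarrow> Y t \<omega>) (at_right t) \<and> (\<exists>l. ((\<lambda>s. Y s \<omega>) \<longlongrightarrow> l) (at_left t)))
      \<and> filterlim (\<lambda>s. Y s \<omega>) at_top (at_right 0))
   \<and> (\<forall>T. stopping_time (nat_filtration N Y) T \<and> (\<forall>\<omega>\<in>space N. 0 < T \<omega>) \<longrightarrow>
      (\<forall>A. A \<subseteq> space N \<and> (\<forall>t. {\<omega>\<in>A. T \<omega> \<le> t} \<in> sets (nat_filtration N Y t)) \<longrightarrow>
      (\<forall>(n::nat) (ts::nat \<Rightarrow> real) (f::(nat \<Rightarrow> real) \<Rightarrow> real).
         (\<forall>i<n. 0 \<le> ts i) \<and> f \<in> borel_measurable (PiM {..<n} (\<lambda>_. borel)) \<and> bounded (range f)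
         \<longrightarrow>
         (\<integral>\<omega>. indicator A \<omega> * f (\<lambda>i\<in>{..<n}. Y (T \<omega> + ts i) \<omega>) \<partial>N)
         = (\<integral>\<omega>. indicator A \<omega> *
              (\<integral>\<omega>'. f (\<lambda>i\<in>{..<n}. Xpath R (\<lambda>s. Y (T \<omega>) \<omega> + L s \<omega>') (ts i)) \<partial>M) \<partial>N))))"

definition phi :: "real \<Rightarrow> (real \<Rightarrow> real) \<Rightarrow> real \<Rightarrow> real" where
  "phi \<gamma> R b = (1 / \<gamma>) * (LBINT x:{b..}. 1 / R x)"

definition Vfun :: "(real \<Rightarrow> real) \<Rightarrow> real \<Rightarrow> real \<Rightarrow> ereal" where
  "Vfun R z \<rho> = (SUP x\<in>{z..}. ereal (max (R x / R (x + \<rho> * z) - 1) 0))"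

end

theory Submission
  imports Defs
begin

text \<open>
  Put \<open>g = 1 / R\<close>. By the time change, the passage time of \<open>X\<close> below \<open>b\<close> from \<open>x\<close> is the clock
  \<open>A = \<integral> g (Z\<^sub>r) dr\<close>, integrated up to the passage time of \<open>Z\<close> below \<open>b\<close>. As \<open>\<Psi>\<close> grows at most
  quadratically, \<open>Z\<close> has no negative jumps and so passes each level continuously. The strong Markov
  property at passage times then shows that the potential measure of \<open>Z\<close> has the constant density \<open>1 / \<gamma>\<close>
  below the starting point, and above it a density at most \<open>1 / \<gamma>\<close> that vanishes at infinity.

  Hence the mean of \<open>A\<close> is at least \<open>\<phi> b - \<phi> x - G b\<close>, where \<open>G b\<close> is the mean clock accumulated above
  \<open>b\<close> after passage, and H1 gives \<open>G b = o (\<phi> b)\<close>. The second moment of \<open>A\<close> is at most twice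
  \<open>\<integral> (g v / \<gamma>) (\<phi> b - \<phi> v + G v) dv = (1 / 2 + o 1) (\<phi> b)\<^sup>2\<close>, so the mean square of \<open>A - \<phi> b\<close> is
  \<open>o ((\<phi> b)\<^sup>2)\<close>. The Markov property at a small fixed time and Fatou's lemma transfer this bound to the
  process started from infinity, and Chebyshev's inequality concludes.
\<close>

subsection \<open>The Laplace exponent\<close>

text \<open>The Levy hypothesis supplies the law of the increments and a one-sided transform at time
  1, so the absence of negative jumps has to be extracted from the growth of \<Psi>. The density
  \<open>1 / \<gamma>\<close> is the mean passage time per unit of level, because \<Psi> has slope
  \<gamma> at 0. It is found with a discount \<open>q > 0\<close>: undiscounted, the potential of
  the whole line is infinite, and identities obtained by splitting at a passage time could not be
  subtracted. The factor 1/2 in the second moment is the area of a triangle: a path at level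
  \<open>v\<close> has only the levels below \<open>v\<close> left to cross, up to a small error. An
  upper bound on the second moment and a lower bound on the first are enough, since the mean of
  \<open>(A - F)^2\<close> is that of \<open>A^2\<close> minus \<open>2 * F\<close> times that of
  \<open>A\<close>, plus \<open>F^2\<close>. For the process from infinity the Markov property
  speaks of bounded functions of finitely many coordinates; hence passage times become infima over
  rational times, truncated at a constant that is removed at the end.\<close>

lemma exp_minus_remainder_nonneg: "0 \<le> exp (- u) - 1 + (u::real)"
  using exp_ge_add_one_self[of "- u"] by linarith

lemma exp_minus_remainder_le:
  fixes u :: real assumes "0 \<le> u"
  shows "exp (- u) - 1 + u \<le> min u (u\<^sup>2)"
proof -
  have "exp (- u) - 1 + u \<le> u" using assms by simp
  moreover have "exp (- u) - 1 + u \<le> u\<^sup>2"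
  proof -
    have "exp (- u) \<le> 1 / (1 + u)"
      using exp_ge_add_one_self[of u] assms by (simp add: exp_minus field_simps)
    also have "\<dots> \<le> 1 - u + u\<^sup>2"
    proof -
      have "1 \<le> (1 - u + u\<^sup>2) * (1 + u)"
        using assms by (simp add: algebra_simps power2_eq_square)
      then show ?thesis using assms by (simp add: field_simps)
    qed
    finally show ?thesis by simp
  qed
  ultimately show ?thesis by simp
qed

text \<open>The summand \<open>lam\<close> serves where \<open>z\<close> is the smaller of
  \<open>z\<close> and \<open>z\<^sup>2\<close>, the summand \<open>lam\<^sup>2\<close> where
  \<open>z\<^sup>2\<close> is. This separates \<open>lam\<close> from the function of
  \<open>z\<close> that the Levy measure integrates.\<close>

lemma exp_minus_remainder_scaled_le:
  fixes z lam :: real assumes "0 \<le> lam" "0 < z"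
  shows "exp (- lam * z) - 1 + lam * z \<le> (lam + lam\<^sup>2) * min z (z\<^sup>2)"
proof -
  have *: "exp (- lam * z) - 1 + lam * z \<le> lam * z" "exp (- lam * z) - 1 + lam * z \<le> lam\<^sup>2 * z\<^sup>2"
    using exp_minus_remainder_le[of "lam * z"] assms by (simp_all add: power_mult_distrib)
  show ?thesis
  proof (cases "z \<le> z\<^sup>2")
    case True
    have "0 \<le> lam\<^sup>2 * z" using assms by simp
    then have "lam * z \<le> (lam + lam\<^sup>2) * z" by (simp add: distrib_right)
    then show ?thesis using order_trans[OF *(1)] True by (simp add: min_def)
  next
    case False
    have "0 \<le> lam * z\<^sup>2" using assms by simp
    then have "lam\<^sup>2 * z\<^sup>2 \<le> (lam + lam\<^sup>2) * z\<^sup>2" by (simp add: distrib_right)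
    then show ?thesis using order_trans[OF *(2)] False by (simp add: min_def)
  qed
qed

lemma AE_levy_measure_pos:
  assumes "levy_measure_ok \<pi>" shows "AE z in \<pi>. 0 < z"
proof (rule AE_I)
  show "{z \<in> space \<pi>. \<not> 0 < z} \<subseteq> {..0}" by auto
qed (use assms in \<open>auto simp: levy_measure_ok_def\<close>)

lemma integrable_min_levy_measure:
  assumes "levy_measure_ok \<pi>" shows "integrable \<pi> (\<lambda>z. min z (z\<^sup>2))"
proof (rule integrableI_nonneg)
  have [measurable_cong]: "sets \<pi> = sets borel" using assms by (auto simp: levy_measure_ok_def)
  show "(\<lambda>z. min z (z\<^sup>2)) \<in> borel_measurable \<pi>" by measurable
  show "AE z in \<pi>. 0 \<le> min z (z\<^sup>2)" using AE_levy_measure_pos[OF assms] by eventually_elim auto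
qed (use assms in \<open>auto simp: levy_measure_ok_def\<close>)

lemma Psi_ge_linear:
  assumes "0 \<le> lam" shows "\<gamma> * lam \<le> Psi \<gamma> \<sigma> \<pi> lam"
proof -
  have "0 \<le> (\<integral>z. exp (- lam * z) - 1 + lam * z \<partial>\<pi>)"
    using exp_minus_remainder_nonneg[of "lam * z" for z] by (intro Bochner_Integration.integral_nonneg) simp
  then show ?thesis by (simp add: Psi_def)
qed

text \<open>Quadratic growth is what later rules out negative jumps: a Chernoff bound over a time
  step of order \<open>1 / lam\<^sup>2\<close> then stays bounded before the exponential gain is
  counted.\<close>

lemma Psi_le_quadratic:
  assumes "levy_measure_ok \<pi>"
  shows "\<exists>C. \<forall>lam\<ge>0. Psi \<gamma> \<sigma> \<pi> lam \<le> C * (lam + lam\<^sup>2)"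
proof -
  define J where "J = (\<integral>z. min z (z\<^sup>2) \<partial>\<pi>)"
  have "Psi \<gamma> \<sigma> \<pi> lam \<le> (\<bar>\<gamma>\<bar> + \<sigma>\<^sup>2 / 2 + J) * (lam + lam\<^sup>2)" if "0 \<le> lam" for lam
  proof -
    have "(\<integral>z. exp (- lam * z) - 1 + lam * z \<partial>\<pi>) \<le> (\<integral>z. (lam + lam\<^sup>2) * min z (z\<^sup>2) \<partial>\<pi>)"
    proof (rule integral_mono_AE')
      show "integrable \<pi> (\<lambda>z. (lam + lam\<^sup>2) * min z (z\<^sup>2))"
        using integrable_min_levy_measure[OF assms] by simp
      show "AE z in \<pi>. exp (- lam * z) - 1 + lam * z \<le> (lam + lam\<^sup>2) * min z (z\<^sup>2)"
        using AE_levy_measure_pos[OF assms]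
        by eventually_elim (rule exp_minus_remainder_scaled_le[OF that])
      show "AE z in \<pi>. 0 \<le> (lam + lam\<^sup>2) * min z (z\<^sup>2)"
        using AE_levy_measure_pos[OF assms] by eventually_elim (use that in simp)
    qed
    then have "(\<integral>z. exp (- lam * z) - 1 + lam * z \<partial>\<pi>) \<le> J * (lam + lam\<^sup>2)"
      by (simp add: J_def mult.commute)
    moreover have "\<gamma> * lam \<le> \<bar>\<gamma>\<bar> * (lam + lam\<^sup>2)"
      using that by (intro mult_mono) auto
    moreover have "\<sigma>\<^sup>2 / 2 * lam\<^sup>2 \<le> \<sigma>\<^sup>2 / 2 * (lam + lam\<^sup>2)"
      using that by (intro mult_left_mono) auto
    ultimately show ?thesis by (simp add: Psi_def distrib_right)
  qed
  then show ?thesis by blast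
qed

text \<open>After division by \<open>lam = 1 / Suc n\<close> the jump integrand is dominated by
  \<open>2 * min z (z\<^sup>2)\<close> and is at most \<open>z\<^sup>2 / Suc n\<close>, so dominated
  convergence removes it; the Gaussian term is of order \<open>lam\<close>. What remains is the
  drift.\<close>

lemma Psi_slope_at_0:
  assumes "levy_measure_ok \<pi>"
  shows "(\<lambda>n. Psi \<gamma> \<sigma> \<pi> (1 / Suc n) * Suc n) \<longlonglongrightarrow> \<gamma>"
proof -
  define f where "f n z = (exp (- (1 / Suc n) * z) - 1 + (1 / Suc n) * z) * Suc n" for n :: nat and z :: real
  have [measurable_cong]: "sets \<pi> = sets borel" using assms by (auto simp: levy_measure_ok_def)
  have "(\<lambda>n. \<integral>z. f n z \<partial>\<pi>) \<longlonglongrightarrow> (\<integral>z. 0 \<partial>\<pi>)"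
  proof (rule integral_dominated_convergence)
    show "integrable \<pi> (\<lambda>z. 2 * min z (z\<^sup>2))" using integrable_min_levy_measure[OF assms] by simp
    show "f n \<in> borel_measurable \<pi>" for n unfolding f_def by measurable
    show "AE z in \<pi>. norm (f n z) \<le> 2 * min z (z\<^sup>2)" for n
      using AE_levy_measure_pos[OF assms]
    proof eventually_elim
      case (elim z)
      have "f n z \<le> ((1 / Suc n + (1 / Suc n)\<^sup>2) * min z (z\<^sup>2)) * Suc n"
        unfolding f_def using elim by (intro mult_right_mono exp_minus_remainder_scaled_le) auto
      also have "\<dots> = (1 + 1 / Suc n) * min z (z\<^sup>2)"
        by (simp add: field_simps power2_eq_square del: of_nat_Suc)
      also have "\<dots> \<le> 2 * min z (z\<^sup>2)" using elim by (intro mult_right_mono) auto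
      finally show ?case
        using exp_minus_remainder_nonneg[of "1 / Suc n * z"] by (simp add: f_def)
    qed
    show "AE z in \<pi>. (\<lambda>n. f n z) \<longlonglongrightarrow> 0" using AE_levy_measure_pos[OF assms]
    proof eventually_elim
      case (elim z)
      have "(\<lambda>n. z\<^sup>2 * inverse (real (Suc n))) \<longlonglongrightarrow> z\<^sup>2 * 0"
        by (intro tendsto_intros LIMSEQ_inverse_real_of_nat)
      moreover have "f n z \<le> z\<^sup>2 * inverse (real (Suc n))" for n
      proof -
        have "f n z \<le> (1 / Suc n * z)\<^sup>2 * Suc n"
          unfolding f_def using exp_minus_remainder_le[of "1 / Suc n * z"] elim
          by (intro mult_right_mono) auto
        also have "\<dots> = z\<^sup>2 * inverse (real (Suc n))"
          by (simp add: field_simps power2_eq_square del: of_nat_Suc)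
        finally show ?thesis .
      qed
      moreover have "0 \<le> f n z" for n
        using exp_minus_remainder_nonneg[of "1 / Suc n * z"] by (simp add: f_def)
      ultimately show ?case by (intro tendsto_sandwich[of "\<lambda>_. 0" "\<lambda>n. f n z"]) auto
    qed
  qed simp
  moreover have "(\<lambda>n. \<sigma>\<^sup>2 / 2 * inverse (real (Suc n))) \<longlonglongrightarrow> \<sigma>\<^sup>2 / 2 * 0"
    by (intro tendsto_intros LIMSEQ_inverse_real_of_nat)
  ultimately have "(\<lambda>n. \<gamma> + \<sigma>\<^sup>2 / 2 * inverse (real (Suc n)) + (\<integral>z. f n z \<partial>\<pi>)) \<longlonglongrightarrow> \<gamma> + 0 + 0"
    by (intro tendsto_add) auto
  moreover have "Psi \<gamma> \<sigma> \<pi> (1 / Suc n) * Suc n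
      = \<gamma> + \<sigma>\<^sup>2 / 2 * inverse (real (Suc n)) + (\<integral>z. f n z \<partial>\<pi>)" for n
  proof -
    have "(\<gamma> * (1 / r) + \<sigma>\<^sup>2 / 2 * (1 / r)\<^sup>2 + I) * r = \<gamma> + \<sigma>\<^sup>2 / 2 * inverse r + I * r"
      if "0 < r" for r I :: real
      using that by (simp add: field_simps power2_eq_square)
    from this[of "real (Suc n)"] show ?thesis by (simp add: Psi_def f_def del: of_nat_Suc)
  qed
  ultimately show ?thesis by simp
qed

subsection \<open>Levy processes with negative drift\<close>

text \<open>The least multiple of \<open>1 / Suc n\<close> strictly above \<open>t\<close>.
  Strictness places the approximations in the punctured filter \<open>at_right t\<close>, where
  right-continuity applies directly.\<close>

definition grid_above :: "nat \<Rightarrow> real \<Rightarrow> real" where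
  "grid_above n t = (of_int \<lfloor>t * real (Suc n)\<rfloor> + 1) / real (Suc n)"

lemma grid_above: "t < grid_above n t" "grid_above n t \<le> t + 1 / real (Suc n)"
  unfolding grid_above_def
  by (simp_all add: field_simps del: of_nat_Suc) linarith+

lemma filterlim_grid_above: "filterlim (\<lambda>n. grid_above n t) (at_right t) sequentially"
proof (rule tendsto_imp_filterlim_at_right)
  show "(\<lambda>n. grid_above n t) \<longlonglongrightarrow> t"
  proof (rule tendsto_sandwich[of "\<lambda>_. t" _ _ "\<lambda>n. t + inverse (real (Suc n))"])
    show "(\<lambda>n. t + inverse (real (Suc n))) \<longlonglongrightarrow> t"
      using tendsto_add[OF tendsto_const LIMSEQ_inverse_real_of_nat, of t] by simp
  qed (use grid_above[where t = t] in \<open>auto intro!: always_eventually less_imp_le simp: inverse_eq_divide\<close>)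
  show "\<forall>\<^sub>F n in sequentially. t < grid_above n t" using grid_above by auto
qed

text \<open>Replacing the time by the next grid point gives a process that depends on time through
  an integer only, hence is jointly measurable; right-continuity makes the original process the
  pointwise limit.\<close>

lemma measurable_right_continuous_process:
  fixes X :: "real \<Rightarrow> 'a \<Rightarrow> real"
  assumes [measurable]: "\<And>t. X t \<in> borel_measurable M"
    and rc: "\<And>\<omega> t. \<omega> \<in> space M \<Longrightarrow> ((\<lambda>s. X s \<omega>) \<longlongrightarrow> X t \<omega>) (at_right t)"
  shows "(\<lambda>(t, \<omega>). X t \<omega>) \<in> borel_measurable (borel \<Otimes>\<^sub>M M)"
proof -
  have *: "(\<lambda>(t, \<omega>). X (grid_above n t) \<omega>) \<in> borel_measurable (borel \<Otimes>\<^sub>M M)" for n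
  proof -
    have "(\<lambda>p. (\<lambda>i p. X ((of_int i + 1) / real (Suc n)) (snd p)) \<lfloor>fst p * real (Suc n)\<rfloor> p)
        \<in> borel_measurable (borel \<Otimes>\<^sub>M M)"
      by (rule measurable_compose_countable[where g = "\<lambda>p. \<lfloor>fst p * real (Suc n)\<rfloor>"]) measurable
    then show ?thesis by (simp add: grid_above_def split_beta')
  qed
  show ?thesis
  proof (rule borel_measurable_LIMSEQ_real[OF _ *])
    fix p :: "real \<times> 'a" assume p: "p \<in> space (borel \<Otimes>\<^sub>M M)"
    obtain t \<omega> where [simp]: "p = (t, \<omega>)" by fastforce
    have "\<omega> \<in> space M" using p by (auto simp: space_pair_measure)
    then show "(\<lambda>n. case p of (t, \<omega>) \<Rightarrow> X (grid_above n t) \<omega>) \<longlonglongrightarrow> (case p of (t, \<omega>) \<Rightarrow> X t \<omega>)"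
      using filterlim_compose[OF rc filterlim_grid_above, of \<omega> t] by simp
  qed
qed

section \<open>Auxiliary facts on roots, series and integrals\<close>

lemma ennreal_power_eq_exp:
  assumes "(x :: ennreal) ^ Suc n = ennreal (exp a)" shows "x = ennreal (exp (a / Suc n))"
proof (cases x)
  case (real r)
  then have "r ^ Suc n = exp a"
    using assms by (simp add: ennreal_power del: power_Suc)
  also have "exp a = exp (a / Suc n) ^ Suc n" by (simp add: exp_of_nat_mult[symmetric] del: of_nat_Suc power_Suc)
  finally have "r = exp (a / Suc n)" by (rule power_inject_base) (use real in auto)
  then show ?thesis using real by simp
next
  case top
  then show ?thesis using assms by (simp add: ennreal_mult_top)
qed

text \<open>This is the Borel-Cantelli series: a bounded time interval has of the order of
  \<open>4 ^ n\<close> mesh steps, each with failure probability of order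
  \<open>exp (- e * 2 ^ n)\<close>. The cubic lower bound on \<open>exp\<close> suffices, leaving
  \<open>4 ^ n / 8 ^ n\<close>.\<close>

lemma summable_four_power_exp:
  assumes "0 < e" shows "summable (\<lambda>n. 4 ^ n * exp (- (e::real) * 2 ^ n))"
proof (rule summable_comparison_test')
  show "summable (\<lambda>n. 27 / e ^ 3 * (1 / 2) ^ n :: real)" by (intro summable_mult summable_geometric) simp
  fix n :: nat assume "0 \<le> n"
  define x where "x = e * 2 ^ n"
  have x: "0 < x" using assms by (simp add: x_def)
  have "(x / 3) ^ 3 \<le> (1 + x / 3) ^ 3" using x by (intro power_mono) auto
  also have "\<dots> \<le> exp x"
    using exp_ge_one_plus_x_over_n_power_n[of 3 x] x by simp
  finally have "exp (- x) \<le> 27 / x ^ 3"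
    using x by (simp add: exp_minus field_simps power_divide)
  then have "4 ^ n * exp (- x) \<le> 4 ^ n * (27 / x ^ 3)" by (intro mult_left_mono) auto
  also have "\<dots> = 27 / e ^ 3 * (4 ^ n / (2 ^ n) ^ 3)" by (simp add: x_def power_mult_distrib)
  also have "4 ^ n / (2 ^ n) ^ 3 = (1 / 2 :: real) ^ n"
  proof -
    have "(2 ^ n) ^ 3 = (8 :: real) ^ n" by (simp add: power_mult[symmetric] mult.commute[of n] power_mult)
    moreover have "(8 :: real) ^ n = 4 ^ n * 2 ^ n" by (simp add: power_mult_distrib[symmetric])
    ultimately show ?thesis by (simp add: power_one_over)
  qed
  finally show "norm (4 ^ n * exp (- e * 2 ^ n)) \<le> 27 / e ^ 3 * (1 / 2) ^ n"
    by (simp add: x_def)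
qed

lemma nn_integral_exp_atLeast:
  assumes "0 < a"
  shows "(\<integral>\<^sup>+t. indicator {0..} t * ennreal (exp (- a * t)) \<partial>lborel) = ennreal (1 / a)"
proof -
  have "(\<integral>\<^sup>+t. ennreal (exp (- a * t)) * indicator {0..} t \<partial>lborel) = ennreal (0 - (- exp (- a * 0) / a))"
  proof (rule nn_integral_FTC_atLeast)
    show "((\<lambda>t. - exp (- a * t) / a) has_real_derivative exp (- a * t)) (at t)" for t
      using assms by (auto intro!: derivative_eq_intros)
    have "((\<lambda>t. exp (- (a * t))) \<longlongrightarrow> 0) at_top"
      using assms
      by (intro filterlim_compose[OF exp_at_bot] filterlim_uminus_at_bot_at_top
            filterlim_tendsto_pos_mult_at_top[OF tendsto_const] filterlim_ident
            filterlim_compose[OF filterlim_uminus_at_bot_at_top])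
    then show "((\<lambda>t. - exp (- a * t) / a) \<longlongrightarrow> 0) at_top"
      using tendsto_divide[OF tendsto_minus tendsto_const[of a]] assms by fastforce
  qed auto
  then show ?thesis by (simp add: mult.commute)
qed

lemma nn_integral_lborel_shift:
  fixes f :: "real \<Rightarrow> ennreal"
  assumes [measurable]: "f \<in> borel_measurable borel"
  shows "(\<integral>\<^sup>+y. f (x + y) \<partial>lborel) = (\<integral>\<^sup>+v. f v \<partial>lborel)"
  by (subst nn_integral_real_affine[where c = 1 and t = x and f = f]) auto

text \<open>The triangles \<open>w < v\<close> and \<open>v < w\<close> carry the same integral by
  Fubini and symmetry, and they are disjoint parts of the square.\<close>

lemma nn_integral_triangle_le:
  fixes g :: "real \<Rightarrow> ennreal"
  assumes [measurable]: "g \<in> borel_measurable borel"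
  shows "2 * (\<integral>\<^sup>+v. g v * (\<integral>\<^sup>+w. indicator {..<v} w * g w \<partial>lborel) \<partial>lborel) \<le> (\<integral>\<^sup>+v. g v \<partial>lborel)\<^sup>2"
proof -
  have [measurable]: "(\<lambda>(v, w). indicator {..<v} w :: ennreal) \<in> borel_measurable (borel \<Otimes>\<^sub>M (borel :: real measure))"
    "(\<lambda>(v, w). indicator {v<..} w :: ennreal) \<in> borel_measurable (borel \<Otimes>\<^sub>M (borel :: real measure))"
    unfolding indicator_def lessThan_iff greaterThan_iff by measurable
  let ?D = "\<integral>\<^sup>+v. \<integral>\<^sup>+w. indicator {..<v} w * (g v * g w) \<partial>lborel \<partial>lborel"
  have D: "(\<integral>\<^sup>+v. g v * (\<integral>\<^sup>+w. indicator {..<v} w * g w \<partial>lborel) \<partial>lborel) = ?D"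
    by (simp add: nn_integral_cmult[symmetric] mult_ac)
  have "?D = (\<integral>\<^sup>+v. \<integral>\<^sup>+w. indicator {v<..} w * (g v * g w) \<partial>lborel \<partial>lborel)"
    by (subst lborel_pair.Fubini') (auto simp: indicator_def mult_ac intro!: nn_integral_cong)
  then have "?D + ?D = (\<integral>\<^sup>+v. \<integral>\<^sup>+w. indicator {..<v} w * (g v * g w) + indicator {v<..} w * (g v * g w) \<partial>lborel \<partial>lborel)"
    by (simp add: nn_integral_add)
  also have "\<dots> \<le> (\<integral>\<^sup>+v. \<integral>\<^sup>+w. g v * g w \<partial>lborel \<partial>lborel)"
    by (intro nn_integral_mono) (auto simp: indicator_def)
  also have "\<dots> = (\<integral>\<^sup>+v. g v \<partial>lborel)\<^sup>2"
    by (simp add: nn_integral_cmult nn_integral_multc power2_eq_square)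
  finally have "?D + ?D \<le> (\<integral>\<^sup>+v. g v \<partial>lborel)\<^sup>2" .
  then show ?thesis unfolding D mult_2 .
qed

text \<open>The exponent enters through three properties. The linear lower bound gives positivity
  and the upper bound on the potential of intervals, the quadratic upper bound excludes negative
  jumps, and the slope at 0 gives the matching lower bound on the mean passage time.\<close>

locale levy_negative_drift = prob_space M for M :: "'a measure" +
  fixes L :: "real \<Rightarrow> 'a \<Rightarrow> real" and \<Psi> :: "real \<Rightarrow> real" and \<gamma> C :: real
  assumes Levy: "levy_process_with_exponent M L \<Psi>"
    and gamma_pos: "0 < \<gamma>"
    and exponent_ge: "0 \<le> \<theta> \<Longrightarrow> \<gamma> * \<theta> \<le> \<Psi> \<theta>"
    and exponent_le: "0 \<le> \<theta> \<Longrightarrow> \<Psi> \<theta> \<le> C * (\<theta> + \<theta>\<^sup>2)"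
    and exponent_slope: "(\<lambda>n. \<Psi> (1 / Suc n) * Suc n) \<longlonglongrightarrow> \<gamma>"
begin

lemma measurable_L[measurable]: "L t \<in> borel_measurable M"
  using Levy by (simp add: levy_process_with_exponent_def)

lemma L_0: "\<omega> \<in> space M \<Longrightarrow> L 0 \<omega> = 0"
  using Levy by (simp add: levy_process_with_exponent_def)

lemma L_right_continuous: "\<omega> \<in> space M \<Longrightarrow> 0 \<le> t \<Longrightarrow> ((\<lambda>s. L s \<omega>) \<longlongrightarrow> L t \<omega>) (at_right t)"
  using Levy by (simp add: levy_process_with_exponent_def cadlag_path_def)

lemma distr_increment:
  "0 \<le> s \<Longrightarrow> 0 \<le> t \<Longrightarrow> distr M borel (\<lambda>\<omega>. L (s + t) \<omega> - L s \<omega>) = distr M borel (L t)"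
  using Levy by (simp add: levy_process_with_exponent_def)

text \<open>Freezing the path before time 0 makes it right-continuous on the whole line.\<close>
definition Z :: "real \<Rightarrow> 'a \<Rightarrow> real" where "Z t = L (max 0 t)"

lemma Z_eq_L: "0 \<le> t \<Longrightarrow> Z t = L t"
  by (simp add: Z_def)

lemma Z_0: "\<omega> \<in> space M \<Longrightarrow> Z 0 \<omega> = 0"
  by (simp add: Z_def L_0)

lemma Z_right_continuous: "\<omega> \<in> space M \<Longrightarrow> ((\<lambda>s. Z s \<omega>) \<longlongrightarrow> Z t \<omega>) (at_right t)"
proof (cases "0 \<le> t")
  case True
  assume "\<omega> \<in> space M"
  from L_right_continuous[OF this True] show ?thesis
    unfolding Z_eq_L[OF True]
    by (rule Lim_transform_eventually)
       (use True in \<open>auto simp: eventually_at_filter Z_def intro!: always_eventually\<close>)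
next
  case False
  then have "\<forall>\<^sub>F s in at_right t. Z t \<omega> = Z s \<omega>"
    using eventually_at_right_less[of t] eventually_at_right[of t 0]
    by (auto simp: Z_def eventually_at_right intro!: exI[of _ 0])
  then show ?thesis by (rule Lim_transform_eventually[OF tendsto_const])
qed

lemma measurable_Z_joint: "(\<lambda>(t, \<omega>). Z t \<omega>) \<in> borel_measurable (borel \<Otimes>\<^sub>M M)"
  by (rule measurable_right_continuous_process) (use Z_right_continuous in \<open>auto simp: Z_def\<close>)

lemma measurable_Z[measurable (raw)]:
  assumes [measurable]: "f \<in> borel_measurable N" "g \<in> measurable N M"
  shows "(\<lambda>x. Z (f x) (g x)) \<in> borel_measurable N"
  using measurable_compose[OF measurable_Pair[OF assms] measurable_Z_joint] by simp

lemma distr_Z_increment: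
  "0 \<le> s \<Longrightarrow> 0 \<le> t \<Longrightarrow> distr M borel (\<lambda>\<omega>. Z (s + t) \<omega> - Z s \<omega>) = distr M borel (Z t)"
  by (simp add: Z_eq_L distr_increment)

text \<open>The time points are prolonged by one more, \<open>ts k + s\<close>, and the independent
  increments are grouped into the blocks \<open>{..<k}\<close> and \<open>{k}\<close>. The last
  increment stays wrapped as a family over \<open>{k}\<close>, the form in which blocks of
  independent variables arise.\<close>

lemma indep_past_increment:
  fixes ts :: "nat \<Rightarrow> real"
  assumes ts: "0 \<le> ts 0" "\<And>i. i < k \<Longrightarrow> ts i \<le> ts (Suc i)" and s: "0 \<le> s"
  shows "indep_var (PiM {..<k} (\<lambda>_. borel)) (\<lambda>\<omega>. \<lambda>i\<in>{..<k}. Z (ts (Suc i)) \<omega> - Z (ts i) \<omega>)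
           (PiM {k} (\<lambda>_. borel)) (\<lambda>\<omega>. \<lambda>i\<in>{k}. Z (ts k + s) \<omega> - Z (ts k) \<omega>)"
proof -
  define ts' where "ts' i = (if i \<le> k then ts i else ts k + s)" for i
  have nonneg: "0 \<le> ts i" if "i \<le> k" for i
    using that
  proof (induction i)
    case (Suc i)
    then show ?case using ts(2)[of i] by simp
  qed (rule ts(1))
  have mono: "ts' i \<le> ts' (Suc i)" if "i < Suc k" for i
    using that ts s by (cases "i = k") (auto simp: ts'_def)
  have "indep_vars (\<lambda>_. borel) (\<lambda>i \<omega>. L (ts' (Suc i)) \<omega> - L (ts' i) \<omega>) {..<Suc k}"
  proof -
    have "0 \<le> ts' 0" using ts(1) by (simp add: ts'_def)
    with Levy mono show ?thesis unfolding levy_process_with_exponent_def by blast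
  qed
  from indep_var_restrict[OF this, of "{..<k}" "{k}"]
  have "indep_var (PiM {..<k} (\<lambda>_. borel)) (\<lambda>\<omega>. \<lambda>i\<in>{..<k}. L (ts' (Suc i)) \<omega> - L (ts' i) \<omega>)
          (PiM {k} (\<lambda>_. borel)) (\<lambda>\<omega>. \<lambda>i\<in>{k}. L (ts' (Suc i)) \<omega> - L (ts' i) \<omega>)"
    by auto
  moreover have "(\<lambda>\<omega>. \<lambda>i\<in>{..<k}. L (ts' (Suc i)) \<omega> - L (ts' i) \<omega>)
      = (\<lambda>\<omega>. \<lambda>i\<in>{..<k}. Z (ts (Suc i)) \<omega> - Z (ts i) \<omega>)"
    using nonneg by (auto simp: fun_eq_iff ts'_def Z_eq_L restrict_def)
  moreover have "(\<lambda>\<omega>. \<lambda>i\<in>{k}. L (ts' (Suc i)) \<omega> - L (ts' i) \<omega>) = (\<lambda>\<omega>. \<lambda>i\<in>{k}. Z (ts k + s) \<omega> - Z (ts k) \<omega>)"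
    using nonneg[of k] s by (auto simp: fun_eq_iff ts'_def Z_eq_L restrict_def)
  ultimately show ?thesis by simp
qed

text \<open>Independence turns the joint law into a product, Fubini separates the two variables, and
  stationarity lets an independent copy of \<open>Z s\<close> stand for the last increment.\<close>

lemma nn_integral_past_increment:
  fixes ts :: "nat \<Rightarrow> real" and F :: "(nat \<Rightarrow> real) \<times> real \<Rightarrow> ennreal"
  assumes ts: "0 \<le> ts 0" "\<And>i. i < k \<Longrightarrow> ts i \<le> ts (Suc i)" and s: "0 \<le> s"
    and F[measurable]: "F \<in> borel_measurable (PiM {..<k} (\<lambda>_. borel) \<Otimes>\<^sub>M borel)"
  shows "(\<integral>\<^sup>+\<omega>. F (\<lambda>i\<in>{..<k}. Z (ts (Suc i)) \<omega> - Z (ts i) \<omega>, Z (ts k + s) \<omega> - Z (ts k) \<omega>) \<partial>M)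
       = (\<integral>\<^sup>+\<omega>. \<integral>\<^sup>+\<omega>'. F (\<lambda>i\<in>{..<k}. Z (ts (Suc i)) \<omega> - Z (ts i) \<omega>, Z s \<omega>') \<partial>M \<partial>M)"
proof -
  let ?S = "PiM {..<k} (\<lambda>_. borel :: real measure)"
  let ?X = "\<lambda>\<omega>. \<lambda>i\<in>{..<k}. Z (ts (Suc i)) \<omega> - Z (ts i) \<omega>"
  let ?D = "\<lambda>\<omega>. Z (ts k + s) \<omega> - Z (ts k) \<omega>"
  have tsk: "0 \<le> ts i" if "i \<le> k" for i
    using that
  proof (induction i)
    case (Suc i)
    then show ?case using ts(2)[of i] by simp
  qed (rule ts(1))
  have [measurable]: "?X \<in> measurable M ?S" by measurable
  let ?T = "PiM {k} (\<lambda>_. borel :: real measure)"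
  let ?D' = "\<lambda>\<omega>. \<lambda>i\<in>{k}. ?D \<omega>"
  have [measurable]: "?D' \<in> measurable M ?T" by measurable
  interpret D: prob_space "distr M ?T ?D'" by (rule prob_space_distr) measurable
  have eq: "distr M ?S ?X \<Otimes>\<^sub>M distr M ?T ?D' = distr M (?S \<Otimes>\<^sub>M ?T) (\<lambda>\<omega>. (?X \<omega>, ?D' \<omega>))"
    using indep_past_increment[OF ts s] by (simp add: indep_var_distribution_eq)
  have k[measurable]: "(\<lambda>y. y k) \<in> measurable ?T borel" by measurable
  have "(\<integral>\<^sup>+\<omega>. F (?X \<omega>, ?D \<omega>) \<partial>M) = (\<integral>\<^sup>+p. F (fst p, snd p k) \<partial>(distr M ?S ?X \<Otimes>\<^sub>M distr M ?T ?D'))"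
    unfolding eq by (subst nn_integral_distr) auto
  also have "\<dots> = (\<integral>\<^sup>+x. \<integral>\<^sup>+y. F (x, y k) \<partial>distr M ?T ?D' \<partial>distr M ?S ?X)"
    by (subst D.nn_integral_fst[symmetric]) auto
  also have "\<dots> = (\<integral>\<^sup>+x. \<integral>\<^sup>+\<omega>'. F (x, ?D \<omega>') \<partial>M \<partial>distr M ?S ?X)"
    by (intro nn_integral_cong) (subst nn_integral_distr, auto)
  also have "\<dots> = (\<integral>\<^sup>+x. \<integral>\<^sup>+y. F (x, y) \<partial>distr M borel ?D \<partial>distr M ?S ?X)"
    by (intro nn_integral_cong nn_integral_distr[symmetric]) auto
  also have "\<dots> = (\<integral>\<^sup>+x. \<integral>\<^sup>+y. F (x, y) \<partial>distr M borel (Z s) \<partial>distr M ?S ?X)"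
    using distr_Z_increment[OF tsk[of k] s] by simp
  also have "\<dots> = (\<integral>\<^sup>+x. \<integral>\<^sup>+\<omega>'. F (x, Z s \<omega>') \<partial>M \<partial>distr M ?S ?X)"
    by (intro nn_integral_cong nn_integral_distr) auto
  also have "\<dots> = (\<integral>\<^sup>+\<omega>. \<integral>\<^sup>+\<omega>'. F (?X \<omega>, Z s \<omega>') \<partial>M \<partial>M)"
    by (rule nn_integral_distr) measurable
  finally show ?thesis .
qed

lemma nn_integral_Markov:
  fixes F :: "real \<times> real \<Rightarrow> ennreal"
  assumes rs: "0 \<le> r" "0 \<le> s" and [measurable]: "F \<in> borel_measurable (borel \<Otimes>\<^sub>M borel)"
  shows "(\<integral>\<^sup>+\<omega>. F (Z r \<omega>, Z (r + s) \<omega> - Z r \<omega>) \<partial>M) = (\<integral>\<^sup>+\<omega>. \<integral>\<^sup>+\<omega>'. F (Z r \<omega>, Z s \<omega>') \<partial>M \<partial>M)"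
proof -
  define ts where "ts i = (if i = 0 then 0 else r)" for i :: nat
  have "(\<integral>\<^sup>+\<omega>. F (Z r \<omega>, Z (r + s) \<omega> - Z r \<omega>) \<partial>M)
      = (\<integral>\<^sup>+\<omega>. (\<lambda>(x, y). F (x 0, y)) (\<lambda>i\<in>{..<1}. Z (ts (Suc i)) \<omega> - Z (ts i) \<omega>, Z (ts 1 + s) \<omega> - Z (ts 1) \<omega>) \<partial>M)"
    by (intro nn_integral_cong) (simp add: ts_def Z_0)
  also have "\<dots> = (\<integral>\<^sup>+\<omega>. \<integral>\<^sup>+\<omega>'. (\<lambda>(x, y). F (x 0, y)) (\<lambda>i\<in>{..<1}. Z (ts (Suc i)) \<omega> - Z (ts i) \<omega>, Z s \<omega>') \<partial>M \<partial>M)"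
    by (rule nn_integral_past_increment) (use rs in \<open>auto simp: ts_def\<close>)
  also have "\<dots> = (\<integral>\<^sup>+\<omega>. \<integral>\<^sup>+\<omega>'. F (Z r \<omega>, Z s \<omega>') \<partial>M \<partial>M)"
    by (intro nn_integral_cong) (simp add: ts_def Z_0)
  finally show ?thesis .
qed

lemma Z_grid_sum:
  assumes "\<omega> \<in> space M"
  shows "Z (real j * d) \<omega> = (\<Sum>i<j. Z (real (Suc i) * d) \<omega> - Z (real i * d) \<omega>)"
  using Z_0[OF assms] by (subst sum_lessThan_telescope) simp

text \<open>The event that \<open>k\<close> is the first grid index below \<open>- c\<close> is a
  function of the first \<open>k\<close> increments, so the increment after it is independent of
  it.\<close>

lemma nn_integral_grid_Markov:
  assumes ds: "0 \<le> d" "0 \<le> s" and [measurable]: "f \<in> borel_measurable borel"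
  shows "(\<integral>\<^sup>+\<omega>. indicator {\<omega> \<in> space M. Z (real k * d) \<omega> < - c \<and> (\<forall>j<k. - c \<le> Z (real j * d) \<omega>)} \<omega>
             * f (Z (real k * d + s) \<omega> - Z (real k * d) \<omega>) \<partial>M)
       = emeasure M {\<omega> \<in> space M. Z (real k * d) \<omega> < - c \<and> (\<forall>j<k. - c \<le> Z (real j * d) \<omega>)}
             * (\<integral>\<^sup>+\<omega>. f (Z s \<omega>) \<partial>M)"
    (is "(\<integral>\<^sup>+\<omega>. indicator ?E \<omega> * _ \<partial>M) = _")
proof -
  let ?X = "\<lambda>\<omega>. \<lambda>i\<in>{..<k}. Z (real (Suc i) * d) \<omega> - Z (real i * d) \<omega>"
  \<comment> \<open>Positions on the grid are the partial sums of the increments, because the path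
    starts at 0; this expresses the event in the coordinates of the product space.\<close>
  define A :: "(nat \<Rightarrow> real) set" where "A = {x \<in> space (PiM {..<k} (\<lambda>_. borel)). (\<Sum>i<k. x i) < - c \<and> (\<forall>j<k. - c \<le> (\<Sum>i<j. x i))}"
  have A[measurable]: "A \<in> sets (PiM {..<k} (\<lambda>_. borel))" unfolding A_def by measurable
  have ind: "indicator A (?X \<omega>) = (indicator ?E \<omega> :: ennreal)" if "\<omega> \<in> space M" for \<omega>
  proof -
    have "(\<Sum>i<j. ?X \<omega> i) = Z (real j * d) \<omega>" if "j \<le> k" for j
      using that by (subst Z_grid_sum[OF \<open>\<omega> \<in> space M\<close>]) (auto intro!: sum.cong)
    moreover have "?X \<omega> \<in> space (PiM {..<k} (\<lambda>_. borel))" by (auto simp: space_PiM)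
    ultimately show ?thesis using that by (auto simp: A_def indicator_def)
  qed
  have "(\<integral>\<^sup>+\<omega>. indicator ?E \<omega> * f (Z (real k * d + s) \<omega> - Z (real k * d) \<omega>) \<partial>M)
      = (\<integral>\<^sup>+\<omega>. (\<lambda>(x, y). indicator A x * f y) (?X \<omega>, Z (real k * d + s) \<omega> - Z (real k * d) \<omega>) \<partial>M)"
    by (intro nn_integral_cong) (simp add: ind del: of_nat_Suc)
  also have "\<dots> = (\<integral>\<^sup>+\<omega>. \<integral>\<^sup>+\<omega>'. (\<lambda>(x, y). indicator A x * f y) (?X \<omega>, Z s \<omega>') \<partial>M \<partial>M)"
    by (rule nn_integral_past_increment[where ts = "\<lambda>i. real i * d"])
       (use ds in \<open>auto intro!: mult_right_mono\<close>)
  also have "\<dots> = (\<integral>\<^sup>+\<omega>. indicator ?E \<omega> * (\<integral>\<^sup>+\<omega>'. f (Z s \<omega>') \<partial>M) \<partial>M)"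
    by (intro nn_integral_cong) (simp add: ind nn_integral_cmult del: of_nat_Suc)
  also have "\<dots> = emeasure M ?E * (\<integral>\<^sup>+\<omega>. f (Z s \<omega>) \<partial>M)"
    by (subst nn_integral_multc) (auto simp: nn_integral_indicator)
  finally show ?thesis .
qed

section \<open>The Laplace transform at arbitrary times\<close>

definition mgf :: "real \<Rightarrow> real \<Rightarrow> ennreal" where
  "mgf \<theta> t = (\<integral>\<^sup>+\<omega>. ennreal (exp (- \<theta> * Z t \<omega>)) \<partial>M)"

lemma mgf_add:
  assumes "0 \<le> s" "0 \<le> t" shows "mgf \<theta> (s + t) = mgf \<theta> s * mgf \<theta> t"
proof -
  have "mgf \<theta> (s + t) = (\<integral>\<^sup>+\<omega>. (\<lambda>(x, y). ennreal (exp (- \<theta> * x)) * ennreal (exp (- \<theta> * y)))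
      (Z s \<omega>, Z (s + t) \<omega> - Z s \<omega>) \<partial>M)"
    unfolding mgf_def by (intro nn_integral_cong) (simp add: ennreal_mult[symmetric] exp_add[symmetric] algebra_simps)
  also have "\<dots> = (\<integral>\<^sup>+\<omega>. \<integral>\<^sup>+\<omega>'. (\<lambda>(x, y). ennreal (exp (- \<theta> * x)) * ennreal (exp (- \<theta> * y)))
      (Z s \<omega>, Z t \<omega>') \<partial>M \<partial>M)"
    by (rule nn_integral_Markov) (use assms in auto)
  also have "\<dots> = mgf \<theta> s * mgf \<theta> t"
    by (simp add: nn_integral_cmult nn_integral_multc mgf_def)
  finally show ?thesis .
qed

lemma mgf_1: "0 \<le> \<theta> \<Longrightarrow> mgf \<theta> 1 = ennreal (exp (\<Psi> \<theta>))"
  using Levy unfolding mgf_def levy_process_with_exponent_def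
  by (subst nn_integral_eq_integral) (auto simp: Z_eq_L)

lemma mgf_0: "mgf \<theta> 0 = 1"
  by (simp add: mgf_def Z_0 emeasure_space_1 cong: nn_integral_cong)

lemma mgf_of_nat_mult: "0 \<le> t \<Longrightarrow> mgf \<theta> (real n * t) = mgf \<theta> t ^ n"
proof (induction n)
  case (Suc n)
  have "mgf \<theta> (real (Suc n) * t) = mgf \<theta> (t + real n * t)" by (simp add: algebra_simps)
  then show ?case using Suc by (simp add: mgf_add)
qed (simp add: mgf_0)

lemma mgf_rational:
  assumes "0 \<le> \<theta>" shows "mgf \<theta> (real k / real (Suc n)) = ennreal (exp (real k / real (Suc n) * \<Psi> \<theta>))"
proof -
  have "mgf \<theta> (1 / Suc n) ^ Suc n = ennreal (exp (\<Psi> \<theta>))"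
    using mgf_of_nat_mult[of "1 / Suc n" \<theta> "Suc n"] mgf_1[OF assms] by (simp del: of_nat_Suc power_Suc)
  from ennreal_power_eq_exp[OF this] have "mgf \<theta> (1 / Suc n) = ennreal (exp (\<Psi> \<theta> / Suc n))" .
  with mgf_of_nat_mult[of "1 / Suc n" \<theta> k] show ?thesis
    by (simp add: ennreal_power exp_of_nat_mult[symmetric] del: of_nat_Suc)
qed

text \<open>The value is known at rational times. These approach \<open>t\<close> from the right,
  where the paths converge, and Fatou's lemma needs no domination.\<close>

lemma mgf_le:
  assumes "0 \<le> \<theta>" "0 \<le> t" shows "mgf \<theta> t \<le> ennreal (exp (t * \<Psi> \<theta>))"
proof -
  have gr: "mgf \<theta> (grid_above n t) = ennreal (exp (grid_above n t * \<Psi> \<theta>))" for n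
  proof -
    have "0 \<le> \<lfloor>t * real (Suc n)\<rfloor>" using assms by simp
    then have "grid_above n t = real (nat (\<lfloor>t * real (Suc n)\<rfloor> + 1)) / real (Suc n)"
      unfolding grid_above_def by simp
    then show ?thesis using mgf_rational[OF assms(1)] by metis
  qed
  have lim: "(\<lambda>n. ennreal (exp (grid_above n t * \<Psi> \<theta>))) \<longlonglongrightarrow> ennreal (exp (t * \<Psi> \<theta>))"
    by (intro tendsto_intros filterlim_mono[OF filterlim_grid_above _ order_refl]) (simp add: at_within_le_nhds)
  have "mgf \<theta> t = (\<integral>\<^sup>+\<omega>. liminf (\<lambda>n. ennreal (exp (- \<theta> * Z (grid_above n t) \<omega>))) \<partial>M)"
    unfolding mgf_def
  proof (intro nn_integral_cong)
    fix \<omega> assume "\<omega> \<in> space M"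
    have "(\<lambda>n. ennreal (exp (- \<theta> * Z (grid_above n t) \<omega>))) \<longlonglongrightarrow> ennreal (exp (- \<theta> * Z t \<omega>))"
      by (intro tendsto_intros filterlim_compose[OF Z_right_continuous[OF \<open>\<omega> \<in> space M\<close>] filterlim_grid_above])
    then show "ennreal (exp (- \<theta> * Z t \<omega>)) = liminf (\<lambda>n. ennreal (exp (- \<theta> * Z (grid_above n t) \<omega>)))"
      by (rule lim_imp_Liminf[symmetric, rotated]) simp
  qed
  also have "\<dots> \<le> liminf (\<lambda>n. mgf \<theta> (grid_above n t))"
    unfolding mgf_def by (rule nn_integral_liminf) measurable
  also have "\<dots> = ennreal (exp (t * \<Psi> \<theta>))"
    unfolding gr by (rule lim_imp_Liminf[OF _ lim]) simp
  finally show ?thesis .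
qed

text \<open>Fatou's lemma only bounds the transform from above; the reverse bound comes from
  multiplicativity between \<open>t\<close> and the next integer.\<close>
lemma mgf_eq:
  assumes "0 \<le> \<theta>" "0 \<le> t" shows "mgf \<theta> t = ennreal (exp (t * \<Psi> \<theta>))"
proof (rule antisym[OF mgf_le[OF assms]])
  define n where "n = nat \<lceil>t\<rceil>"
  have n: "t \<le> real n" using assms by (simp add: n_def)
  have "ennreal (exp (real n * \<Psi> \<theta>)) = mgf \<theta> t * mgf \<theta> (real n - t)"
    using mgf_add[of t "real n - t" \<theta>] mgf_rational[OF assms(1), of n 0] n assms by simp
  also have "\<dots> \<le> mgf \<theta> t * ennreal (exp ((real n - t) * \<Psi> \<theta>))"
    using n assms by (intro mult_left_mono mgf_le) auto
  finally have "ennreal (exp (real n * \<Psi> \<theta>)) * ennreal (exp (- ((real n - t) * \<Psi> \<theta>)))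
      \<le> (mgf \<theta> t * ennreal (exp ((real n - t) * \<Psi> \<theta>))) * ennreal (exp (- ((real n - t) * \<Psi> \<theta>)))"
    by (intro mult_right_mono) auto
  then show "ennreal (exp (t * \<Psi> \<theta>)) \<le> mgf \<theta> t"
    by (simp add: mult.assoc ennreal_mult[symmetric] exp_add[symmetric]) (simp add: algebra_simps)
qed

subsection \<open>Passage times and the absence of negative jumps\<close>

text \<open>The spacing is matched to the Chernoff parameter \<open>2 ^ n\<close>, whose square
  times the mesh is 1: the quadratic growth of \<Psi> is compensated exactly while the parameter
  tends to infinity.\<close>

definition mesh :: "nat \<Rightarrow> real" where "mesh n = 1 / 4 ^ n"

lemma mesh_pos: "0 < mesh n"
  by (simp add: mesh_def)

lemma mesh_tendsto_0: "mesh \<longlonglongrightarrow> 0"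
  unfolding mesh_def using LIMSEQ_realpow_zero[of "1 / 4 :: real"] by (simp add: power_one_over)

text \<open>Chernoff's bound with \<open>\<theta> = 2\<^sup>n\<close>: since \<open>\<Psi>\<close> grows at most quadratically, \<open>mesh n * \<Psi> (2\<^sup>n)\<close>
  stays bounded.\<close>
lemma prob_increment_below:
  assumes "0 \<le> r"
  shows "prob {\<omega> \<in> space M. Z (r + mesh n) \<omega> - Z r \<omega> < - e} \<le> exp (2 * \<bar>C\<bar> - e * 2 ^ n)"
proof -
  let ?D = "\<lambda>\<omega>. Z (r + mesh n) \<omega> - Z r \<omega>"
  define \<theta> :: real where "\<theta> = 2 ^ n"
  have \<theta>: "1 \<le> \<theta>" "\<theta>\<^sup>2 = 4 ^ n"
    by (simp_all add: \<theta>_def power2_eq_square power_mult_distrib[symmetric])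
  have "mesh n * \<Psi> \<theta> \<le> mesh n * (C * (\<theta> + \<theta>\<^sup>2))"
    using exponent_le[of \<theta>] \<theta>(1) by (intro mult_left_mono) (auto simp: mesh_def)
  also have "\<dots> \<le> mesh n * (\<bar>C\<bar> * (2 * \<theta>\<^sup>2))"
  proof -
    have "\<theta> \<le> \<theta>\<^sup>2" using \<theta>(1) by (simp add: power2_eq_square)
    then have "C * (\<theta> + \<theta>\<^sup>2) \<le> \<bar>C\<bar> * (2 * \<theta>\<^sup>2)"
      using \<theta>(1) by (intro mult_mono) auto
    then show ?thesis by (intro mult_left_mono) (auto simp: mesh_def)
  qed
  also have "\<dots> = 2 * \<bar>C\<bar>" by (simp add: \<theta>(2) mesh_def)
  finally have \<Psi>: "mesh n * \<Psi> \<theta> \<le> 2 * \<bar>C\<bar>" .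
  have "emeasure M {\<omega> \<in> space M. ?D \<omega> < - e}
      = (\<integral>\<^sup>+\<omega>. indicator {\<omega> \<in> space M. ?D \<omega> < - e} \<omega> \<partial>M)"
    by (simp add: nn_integral_indicator)
  also have "\<dots> \<le> (\<integral>\<^sup>+\<omega>. ennreal (exp (- \<theta> * e)) * ennreal (exp (- \<theta> * ?D \<omega>)) \<partial>M)"
  proof (intro nn_integral_mono)
    fix \<omega>
    have "1 \<le> exp (- \<theta> * e) * exp (- \<theta> * ?D \<omega>)" if "?D \<omega> < - e"
    proof -
      have "\<theta> * (e + ?D \<omega>) \<le> 0" using that \<theta>(1) by (intro mult_nonneg_nonpos) auto
      then have "0 \<le> - \<theta> * e + - \<theta> * ?D \<omega>" by (simp add: algebra_simps)
      then show ?thesis by (simp only: exp_add[symmetric] one_le_exp_iff)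
    qed
    then have "?D \<omega> < - e \<Longrightarrow> ennreal 1 \<le> ennreal (exp (- \<theta> * e)) * ennreal (exp (- \<theta> * ?D \<omega>))"
      unfolding ennreal_mult[OF exp_ge_zero exp_ge_zero, symmetric] by (rule ennreal_leI)
    then show "indicator {\<omega> \<in> space M. ?D \<omega> < - e} \<omega>
        \<le> ennreal (exp (- \<theta> * e)) * ennreal (exp (- \<theta> * ?D \<omega>))"
      by (cases "?D \<omega> < - e") (simp_all add: indicator_def)
  qed
  also have "\<dots> = ennreal (exp (- \<theta> * e)) * (\<integral>\<^sup>+x. ennreal (exp (- \<theta> * x)) \<partial>distr M borel ?D)"
    by (subst nn_integral_distr) (auto simp: nn_integral_cmult)
  also have "\<dots> = ennreal (exp (- \<theta> * e)) * mgf \<theta> (mesh n)"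
    using distr_Z_increment[OF assms less_imp_le[OF mesh_pos]]
    by (simp add: mgf_def nn_integral_distr)
  also have "\<dots> = ennreal (exp (mesh n * \<Psi> \<theta> - e * 2 ^ n))"
    using \<theta>(1) mesh_pos[of n]
    by (simp add: mgf_eq ennreal_mult[symmetric] exp_add[symmetric]) (simp add: \<theta>_def algebra_simps)
  also have "\<dots> \<le> ennreal (exp (2 * \<bar>C\<bar> - e * 2 ^ n))"
    using \<Psi> by (intro ennreal_leI) simp
  finally show ?thesis by (simp add: emeasure_eq_measure)
qed

text \<open>Borel-Cantelli over the \<open>m * 4 ^ n\<close> steps that cover the interval from 0 to
  \<open>m\<close>. Stating it for grid increments avoids speaking of the jumps of the path.\<close>

lemma AE_no_negative_jumps:
  assumes "0 < e"
  shows "AE \<omega> in M. \<forall>m::nat. \<forall>\<^sub>F n in sequentially.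
           \<forall>k < m * 4 ^ n. - e \<le> Z (real k * mesh n + mesh n) \<omega> - Z (real k * mesh n) \<omega>"
  unfolding AE_all_countable
proof
  fix m :: nat
  define B where "B n k = {\<omega> \<in> space M. Z (real k * mesh n + mesh n) \<omega> - Z (real k * mesh n) \<omega> < - e}" for n k
  have [measurable]: "B n k \<in> sets M" for n k unfolding B_def by measurable
  have "AE \<omega> in M. \<forall>\<^sub>F n in sequentially. \<omega> \<in> space M - (\<Union>k<m * 4 ^ n. B n k)"
  proof (rule borel_cantelli_AE1)
    have bound: "prob (\<Union>k<m * 4 ^ n. B n k) \<le> (real m * exp (2 * \<bar>C\<bar>)) * (4 ^ n * exp (- e * 2 ^ n))" for n
    proof -
      have "prob (\<Union>k<m * 4 ^ n. B n k) \<le> (\<Sum>k<m * 4 ^ n. prob (B n k))"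
        by (rule finite_measure_subadditive_finite) auto
      also have "\<dots> \<le> (\<Sum>k<m * 4 ^ n. exp (2 * \<bar>C\<bar> - e * 2 ^ n))"
        unfolding B_def using mesh_pos[of n] by (intro sum_mono prob_increment_below) simp
      also have "\<dots> = (real m * exp (2 * \<bar>C\<bar>)) * (4 ^ n * exp (- e * 2 ^ n))"
        by (simp add: exp_diff exp_minus field_simps)
      finally show ?thesis .
    qed
    show "summable (\<lambda>n. prob (\<Union>k<m * 4 ^ n. B n k))"
      by (rule summable_comparison_test'[OF summable_mult[OF summable_four_power_exp[OF assms]]])
         (use bound in simp)
  qed (auto simp: less_top[symmetric])
  then show "AE \<omega> in M. \<forall>\<^sub>F n in sequentially.
      \<forall>k < m * 4 ^ n. - e \<le> Z (real k * mesh n + mesh n) \<omega> - Z (real k * mesh n) \<omega>"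
    by eventually_elim (auto simp: B_def not_less elim!: eventually_mono)
qed

section \<open>Passage times and their measurability\<close>

definition hits :: "real \<Rightarrow> 'a set" where
  "hits c = {\<omega> \<in> space M. \<exists>t\<ge>0. Z t \<omega> < - c}"

text \<open>The value 0 on paths that never pass the level is a placeholder that keeps the time
  real-valued; later integrals over the passage test membership in \<open>hits c\<close> as
  well.\<close>

definition hit_time :: "real \<Rightarrow> 'a \<Rightarrow> real" where
  "hit_time c \<omega> = (if \<omega> \<in> hits c then Inf {t. 0 \<le> t \<and> Z t \<omega> < - c} else 0)"

lemma hits_subset: "hits c \<subseteq> space M"
  by (auto simp: hits_def)

lemma hit_time_nonneg: "0 \<le> hit_time c \<omega>"
  unfolding hit_time_def by (auto intro!: cInf_greatest simp: hits_def)

lemma hit_time_le: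
  assumes "\<omega> \<in> space M" "0 \<le> t" "Z t \<omega> < - c" shows "hit_time c \<omega> \<le> t"
  using assms unfolding hit_time_def by (auto intro!: cInf_lower bdd_belowI[of _ 0] simp: hits_def)

lemma Z_before_hit_time:
  assumes "\<omega> \<in> space M" "0 \<le> t" "t < hit_time c \<omega>" shows "- c \<le> Z t \<omega>"
  using hit_time_le[OF assms(1,2), of c] assms(3) by linarith

lemma Z_after_hit_time:
  assumes "\<omega> \<in> hits c" "0 < d"
  obtains t where "hit_time c \<omega> \<le> t" "t < hit_time c \<omega> + d" "Z t \<omega> < - c"
proof -
  have "Inf {t. 0 \<le> t \<and> Z t \<omega> < - c} < hit_time c \<omega> + d" using assms by (simp add: hit_time_def)
  then obtain t where t: "0 \<le> t" "Z t \<omega> < - c" "t < hit_time c \<omega> + d"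
    using assms(1) by (subst (asm) cInf_less_iff) (auto simp: hits_def intro: bdd_belowI[of _ 0])
  with hit_time_le[of \<omega> t c] assms hits_subset that show ?thesis by blast
qed

lemma Z_below_right_open:
  assumes "\<omega> \<in> space M" "Z t \<omega> < - c"
  obtains d where "0 < d" "\<And>s. t \<le> s \<Longrightarrow> s < t + d \<Longrightarrow> Z s \<omega> < - c"
proof -
  from order_tendstoD(2)[OF Z_right_continuous[OF assms(1)] assms(2)]
  obtain b where b: "t < b" "\<And>s. t < s \<Longrightarrow> s < b \<Longrightarrow> Z s \<omega> < - c"
    unfolding eventually_at_right_field by blast
  show ?thesis
    by (rule that[of "b - t"]) (use b assms(2) in \<open>auto simp: le_less\<close>)
qed

text \<open>A value strictly below the level persists on a short interval to the right, and that
  interval contains a rational time.\<close>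

lemma hits_eq_rational: "hits c = {\<omega> \<in> space M. \<exists>q::rat. 0 \<le> q \<and> Z (of_rat q) \<omega> < - c}"
proof (intro set_eqI iffI)
  fix \<omega> assume \<omega>: "\<omega> \<in> hits c"
  then obtain t where t: "\<omega> \<in> space M" "0 \<le> t" "Z t \<omega> < - c" by (auto simp: hits_def)
  obtain d where d: "0 < d" "\<And>s. t \<le> s \<Longrightarrow> s < t + d \<Longrightarrow> Z s \<omega> < - c"
    using Z_below_right_open[OF t(1,3)] by blast
  obtain q where "t < of_rat q" "of_rat q < t + d" using of_rat_dense[of t "t + d"] d(1) by auto
  with t have "0 \<le> (of_rat q :: real)" "Z (of_rat q) \<omega> < - c"
    using d(2)[of "of_rat q"] by linarith+
  then have "0 \<le> q \<and> Z (of_rat q) \<omega> < - c" by (simp add: zero_le_of_rat_iff)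
  with t show "\<omega> \<in> {\<omega> \<in> space M. \<exists>q::rat. 0 \<le> q \<and> Z (of_rat q) \<omega> < - c}" by blast
next
  fix \<omega> assume "\<omega> \<in> {\<omega> \<in> space M. \<exists>q::rat. 0 \<le> q \<and> Z (of_rat q) \<omega> < - c}"
  then obtain q :: rat where "\<omega> \<in> space M" "0 \<le> (of_rat q :: real)" "Z (of_rat q) \<omega> < - c"
    by (auto simp: zero_le_of_rat_iff)
  then show "\<omega> \<in> hits c" unfolding hits_def by blast
qed

lemma measurable_hits[measurable]: "hits c \<in> sets M"
  unfolding hits_eq_rational by measurable

lemma measurable_hit_time[measurable]: "hit_time c \<in> borel_measurable M"
proof (rule borel_measurableI_less)
  fix a :: real
  have "{\<omega> \<in> space M. hit_time c \<omega> < a}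
      = {\<omega> \<in> space M. (\<omega> \<in> hits c \<and> (\<exists>q::rat. 0 \<le> q \<and> of_rat q < a \<and> Z (of_rat q) \<omega> < - c)) \<or> (\<omega> \<notin> hits c \<and> 0 < a)}"
    (is "?A = ?B")
  proof (intro set_eqI iffI)
    fix \<omega> assume \<omega>: "\<omega> \<in> ?A"
    show "\<omega> \<in> ?B"
    proof (cases "\<omega> \<in> hits c")
      case True
      obtain t where t: "hit_time c \<omega> \<le> t" "t < a" "Z t \<omega> < - c"
        using Z_after_hit_time[OF True, of "a - hit_time c \<omega>"] \<omega> by auto
      obtain d where d: "0 < d" "\<And>s. t \<le> s \<Longrightarrow> s < t + d \<Longrightarrow> Z s \<omega> < - c"
        using Z_below_right_open[of \<omega> t c] t(3) \<omega> by blast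
      obtain q where q: "t < of_rat q" "of_rat q < min a (t + d)"
        using of_rat_dense[of t "min a (t + d)"] d(1) t(2) by auto
      have "0 \<le> (of_rat q :: real)" using q(1) t(1) hit_time_nonneg[of c \<omega>] by linarith
      then have "0 \<le> q" by (simp add: zero_le_of_rat_iff)
      with q d(2)[of "of_rat q"] True \<omega> show ?thesis by auto
    qed (use \<omega> in \<open>auto simp: hit_time_def\<close>)
  next
    fix \<omega> assume \<omega>: "\<omega> \<in> ?B"
    show "\<omega> \<in> ?A"
    proof (cases "\<omega> \<in> hits c")
      case True
      then obtain q :: rat where "0 \<le> q" "of_rat q < a" "Z (of_rat q) \<omega> < - c" using \<omega> by auto
      then show ?thesis using hit_time_le[of \<omega> "of_rat q" c] \<omega> by (auto simp: zero_le_of_rat_iff)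
    qed (use \<omega> in \<open>auto simp: hit_time_def\<close>)
  qed
  also have "\<dots> \<in> sets M" by measurable
  finally show "{\<omega> \<in> space M. hit_time c \<omega> < a} \<in> sets M" .
qed

section \<open>Approximation of the passage time on a grid\<close>

definition grid_hits :: "real \<Rightarrow> nat \<Rightarrow> 'a set" where
  "grid_hits c n = {\<omega> \<in> space M. \<exists>k::nat. Z (real k * mesh n) \<omega> < - c}"

definition grid_index :: "real \<Rightarrow> nat \<Rightarrow> 'a \<Rightarrow> nat" where
  "grid_index c n \<omega> = (LEAST k. Z (real k * mesh n) \<omega> < - c)"

text \<open>The default \<open>hit_time c \<omega>\<close>, used when no grid point detects the
  passage, preserves both the lower bound by the passage time and the convergence to it.\<close>

definition grid_time :: "real \<Rightarrow> nat \<Rightarrow> 'a \<Rightarrow> real" where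
  "grid_time c n \<omega> = (if \<omega> \<in> grid_hits c n then real (grid_index c n \<omega>) * mesh n else hit_time c \<omega>)"

lemma grid_hits_subset: "grid_hits c n \<subseteq> hits c"
proof
  fix \<omega> assume "\<omega> \<in> grid_hits c n"
  then obtain k :: nat where "\<omega> \<in> space M" "Z (real k * mesh n) \<omega> < - c" by (auto simp: grid_hits_def)
  moreover have "0 \<le> real k * mesh n" using mesh_pos[of n] by simp
  ultimately show "\<omega> \<in> hits c" unfolding hits_def by blast
qed

lemma measurable_grid[measurable]:
  "grid_hits c n \<in> sets M" "grid_index c n \<in> measurable M (count_space UNIV)"
  "grid_time c n \<in> borel_measurable M"
proof -
  show [measurable]: "grid_hits c n \<in> sets M" unfolding grid_hits_def by measurable
  show [measurable]: "grid_index c n \<in> measurable M (count_space UNIV)" unfolding grid_index_def by measurable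
  show "grid_time c n \<in> borel_measurable M" unfolding grid_time_def by measurable
qed

lemma Z_grid_index: "\<omega> \<in> grid_hits c n \<Longrightarrow> Z (real (grid_index c n \<omega>) * mesh n) \<omega> < - c"
  unfolding grid_index_def grid_hits_def by (auto intro: LeastI_ex)

lemma hit_time_le_grid_time: "hit_time c \<omega> \<le> grid_time c n \<omega>"
  using Z_grid_index[of \<omega> c n] subsetD[OF hits_subset subsetD[OF grid_hits_subset]] mesh_pos[of n]
  by (auto simp: grid_time_def intro!: hit_time_le)

text \<open>Shortly after the passage time the path is strictly below the level on a whole interval;
  a mesh finer than that interval places a grid point in it, and the first grid index can only be
  smaller.\<close>

lemma eventually_grid_time:
  assumes "\<omega> \<in> hits c" "0 < d"
  shows "\<forall>\<^sub>F n in sequentially. \<omega> \<in> grid_hits c n \<and> grid_time c n \<omega> < hit_time c \<omega> + d"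
proof -
  have sp: "\<omega> \<in> space M" using assms hits_subset by auto
  obtain t where t: "hit_time c \<omega> \<le> t" "t < hit_time c \<omega> + d" "Z t \<omega> < - c"
    using Z_after_hit_time[OF assms] .
  then obtain e where e: "0 < e" "\<And>s. t \<le> s \<Longrightarrow> s < t + e \<Longrightarrow> Z s \<omega> < - c"
    using Z_below_right_open[OF sp] by blast
  have t0: "0 \<le> t" using t(1) hit_time_nonneg[of c \<omega>] by linarith
  have "\<forall>\<^sub>F n in sequentially. mesh n < min e (hit_time c \<omega> + d - t)"
    using e t by (intro order_tendstoD(2)[OF mesh_tendsto_0]) auto
  then show ?thesis
  proof eventually_elim
    case (elim n)
    define k where "k = nat \<lceil>t / mesh n\<rceil>"
    have "t / mesh n \<le> real k" "real k < t / mesh n + 1"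
      using t0 mesh_pos[of n] unfolding k_def by (simp_all add: of_nat_nat) linarith
    then have k: "t \<le> real k * mesh n" "real k * mesh n < t + mesh n"
      using mesh_pos[of n] by (simp_all add: field_simps)
    then have Zk: "Z (real k * mesh n) \<omega> < - c" using e(2) elim by auto
    then have gh: "\<omega> \<in> grid_hits c n" using sp by (auto simp: grid_hits_def)
    have "grid_index c n \<omega> \<le> k" unfolding grid_index_def by (rule Least_le) (rule Zk)
    then have "real (grid_index c n \<omega>) * mesh n \<le> real k * mesh n"
      using mesh_pos[of n] by (intro mult_right_mono) auto
    also have "\<dots> < hit_time c \<omega> + d" using k elim by simp
    finally show ?case using gh by (simp add: grid_time_def)
  qed
qed

lemma grid_time_tendsto:
  assumes "\<omega> \<in> hits c" shows "(\<lambda>n. grid_time c n \<omega>) \<longlonglongrightarrow> hit_time c \<omega>"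
proof (rule order_tendstoI)
  fix a assume "a < hit_time c \<omega>"
  then show "\<forall>\<^sub>F n in sequentially. a < grid_time c n \<omega>"
    using hit_time_le_grid_time[of c \<omega>] by (auto intro!: always_eventually elim: less_le_trans)
next
  fix a assume "hit_time c \<omega> < a"
  then show "\<forall>\<^sub>F n in sequentially. grid_time c n \<omega> < a"
    using eventually_grid_time[OF assms, of "a - hit_time c \<omega>"] by (auto elim: eventually_mono)
qed

lemma Z_tendsto_from_right:
  assumes "\<omega> \<in> space M" "x \<longlonglongrightarrow> t" "\<And>n. t \<le> x n"
  shows "(\<lambda>n. Z (x n) \<omega>) \<longlonglongrightarrow> Z t \<omega>"
proof -
  have "continuous (at t within {t..}) (\<lambda>s. Z s \<omega>)"
    using Z_right_continuous[OF assms(1)] by (simp add: continuous_within at_within_Ici_at_right)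
  then show ?thesis
    using assms(2,3) unfolding continuous_within_sequentially by (auto simp: comp_def)
qed

text \<open>Values at the grid times lie below \<open>- c\<close>, which gives one inequality in the
  limit. For the other, the preceding grid point is still at least \<open>- c\<close>, and one mesh
  step cannot fall by more than \<open>1 / Suc j\<close> for large \<open>n\<close>; then
  \<open>j\<close> tends to infinity.\<close>

lemma AE_Z_hit_time:
  assumes "0 \<le> c" shows "AE \<omega> in M. \<omega> \<in> hits c \<longrightarrow> Z (hit_time c \<omega>) \<omega> = - c"
proof -
  have "AE \<omega> in M. \<forall>j m::nat. \<forall>\<^sub>F n in sequentially.
      \<forall>k < m * 4 ^ n. - (1 / Suc j) \<le> Z (real k * mesh n + mesh n) \<omega> - Z (real k * mesh n) \<omega>"
    unfolding AE_all_countable[of "\<lambda>j \<omega>. \<forall>m::nat. _ j m \<omega>"] by (intro allI AE_no_negative_jumps) simp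
  then show ?thesis
  proof (eventually_elim, intro impI antisym)
    fix \<omega> assume small: "\<forall>j m::nat. \<forall>\<^sub>F n in sequentially.
      \<forall>k < m * 4 ^ n. - (1 / Suc j) \<le> Z (real k * mesh n + mesh n) \<omega> - Z (real k * mesh n) \<omega>"
      and \<omega>: "\<omega> \<in> hits c"
    have sp: "\<omega> \<in> space M" using \<omega> hits_subset by auto
    have lim: "(\<lambda>n. Z (grid_time c n \<omega>) \<omega>) \<longlonglongrightarrow> Z (hit_time c \<omega>) \<omega>"
      by (intro Z_tendsto_from_right sp grid_time_tendsto \<omega> hit_time_le_grid_time)
    have ev: "\<forall>\<^sub>F n in sequentially. \<omega> \<in> grid_hits c n \<and> grid_time c n \<omega> < hit_time c \<omega> + 1"
      by (rule eventually_grid_time[OF \<omega>]) simp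
    show "Z (hit_time c \<omega>) \<omega> \<le> - c"
    proof (rule tendsto_upperbound[OF lim])
      show "\<forall>\<^sub>F n in sequentially. Z (grid_time c n \<omega>) \<omega> \<le> - c"
        using ev by eventually_elim (use Z_grid_index in \<open>auto simp: grid_time_def intro: less_imp_le\<close>)
    qed simp
    have "- c - 1 / Suc j \<le> Z (hit_time c \<omega>) \<omega>" for j
    proof (rule tendsto_lowerbound[OF lim])
      \<comment> \<open>The horizon \<open>m\<close> lies beyond the passage time by more than 1, so
        the grid step that ends at the first grid passage is among those controlled.\<close>
      obtain m :: nat where m: "hit_time c \<omega> + 1 < real m" using reals_Archimedean2 by blast
      from small have "\<forall>\<^sub>F n in sequentially.
        \<forall>k < m * 4 ^ n. - (1 / Suc j) \<le> Z (real k * mesh n + mesh n) \<omega> - Z (real k * mesh n) \<omega>" by blast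
      with ev show "\<forall>\<^sub>F n in sequentially. - c - 1 / Suc j \<le> Z (grid_time c n \<omega>) \<omega>"
      proof eventually_elim
        case (elim n)
        \<comment> \<open>Here \<open>0 \<le> c\<close> matters: the path starts at 0, not below
          \<open>- c\<close>, so the first grid index below the level has a predecessor.\<close>
        have "grid_index c n \<omega> \<noteq> 0"
        proof
          assume "grid_index c n \<omega> = 0"
          with Z_grid_index[of \<omega> c n] elim Z_0[OF sp] assms show False by simp
        qed
        then obtain k where k: "grid_index c n \<omega> = Suc k" by (cases "grid_index c n \<omega>") auto
        then have "\<not> Z (real k * mesh n) \<omega> < - c"
          unfolding grid_index_def using not_less_Least[of k "\<lambda>k. Z (real k * mesh n) \<omega> < - c"] by auto
        moreover have gt: "grid_time c n \<omega> = real k * mesh n + mesh n"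
          using elim k by (simp add: grid_time_def algebra_simps)
        moreover have "real k < real (m * 4 ^ n)"
        proof -
          have "real k * mesh n < real m" using elim gt m mesh_pos[of n] by linarith
          then show ?thesis by (simp add: mesh_def field_simps)
        qed
        then have "k < m * 4 ^ n" by (simp only: of_nat_less_iff)
        with elim have "- (1 / Suc j) \<le> Z (real k * mesh n + mesh n) \<omega> - Z (real k * mesh n) \<omega>" by blast
        ultimately show ?case by simp
      qed
    qed simp
    note lower = this
    have "(\<lambda>j. - c - inverse (real (Suc j))) \<longlonglongrightarrow> - c - 0"
      by (intro tendsto_intros LIMSEQ_inverse_real_of_nat)
    from LIMSEQ_le_const2[OF this, of "Z (hit_time c \<omega>) \<omega>"] lower
    show "- c \<le> Z (hit_time c \<omega>) \<omega>" by (simp add: inverse_eq_divide del: of_nat_Suc)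
  qed
qed

subsection \<open>The strong Markov property at passage times\<close>

lemma grid_hit_sum:
  fixes h :: "real \<Rightarrow> ennreal"
  assumes "\<omega> \<in> space M"
  shows "(\<Sum>k. indicator {\<omega> \<in> space M. Z (real k * mesh n) \<omega> < - c \<and> (\<forall>j<k. - c \<le> Z (real j * mesh n) \<omega>)} \<omega>
            * h (real k * mesh n))
       = indicator (grid_hits c n) \<omega> * h (grid_time c n \<omega>)"
    (is "(\<Sum>k. indicator (?E k) \<omega> * _) = _")
proof -
  have E: "\<omega> \<in> ?E k \<longleftrightarrow> \<omega> \<in> grid_hits c n \<and> k = grid_index c n \<omega>" for k
  proof
    assume k: "\<omega> \<in> ?E k"
    then have "grid_index c n \<omega> = k"
      unfolding grid_index_def by (intro Least_equality) (auto simp: not_less[symmetric])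
    then show "\<omega> \<in> grid_hits c n \<and> k = grid_index c n \<omega>" using k by (auto simp: grid_hits_def)
  next
    assume k: "\<omega> \<in> grid_hits c n \<and> k = grid_index c n \<omega>"
    then show "\<omega> \<in> ?E k"
      using Z_grid_index[of \<omega> c n] assms not_less_Least[of _ "\<lambda>k. Z (real k * mesh n) \<omega> < - c"]
      by (auto simp: grid_index_def not_less[symmetric])
  qed
  have ind: "indicator (?E k) \<omega> = (if \<omega> \<in> grid_hits c n \<and> k = grid_index c n \<omega> then 1 else 0 :: ennreal)" for k
    unfolding indicator_def E by simp
  show ?thesis
  proof (cases "\<omega> \<in> grid_hits c n")
    case True
    have "(\<Sum>k. indicator (?E k) \<omega> * h (real k * mesh n))
        = (\<Sum>k. if k = grid_index c n \<omega> then h (grid_time c n \<omega>) else 0)"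
    proof (rule suminf_cong)
      fix k
      show "indicator (?E k) \<omega> * h (real k * mesh n) = (if k = grid_index c n \<omega> then h (grid_time c n \<omega>) else 0)"
        by (subst ind) (use True in \<open>simp add: grid_time_def\<close>)
    qed
    also have "\<dots> = h (grid_time c n \<omega>)" by (rule sums_unique[OF sums_single, symmetric])
    finally show ?thesis using True by simp
  next
    case False
    have "(\<Sum>k. indicator (?E k) \<omega> * h (real k * mesh n)) = (\<Sum>k. 0)"
    proof (rule suminf_cong)
      fix k
      show "indicator (?E k) \<omega> * h (real k * mesh n) = 0"
        by (subst ind) (use False in simp)
    qed
    then show ?thesis using False by simp
  qed
qed

text \<open>Summing over the value of the first grid index reduces this to a deterministic time in
  each term. The future is measured from the position at the grid time, which may lie below
  \<open>- c\<close> by an unknown amount; that overshoot vanishes only in the limit.\<close>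

lemma strong_Markov_grid:
  assumes s: "0 \<le> s" and [measurable]: "f \<in> borel_measurable borel"
  shows "(\<integral>\<^sup>+\<omega>. indicator (grid_hits c n) \<omega> * (ennreal (exp (- q * grid_time c n \<omega>))
             * f (Z (grid_time c n \<omega> + s) \<omega> - Z (grid_time c n \<omega>) \<omega>)) \<partial>M)
       = (\<integral>\<^sup>+\<omega>. indicator (grid_hits c n) \<omega> * ennreal (exp (- q * grid_time c n \<omega>)) \<partial>M)
         * (\<integral>\<^sup>+\<omega>. f (Z s \<omega>) \<partial>M)"
proof -
  define E where "E k = {\<omega> \<in> space M. Z (real k * mesh n) \<omega> < - c \<and> (\<forall>j<k. - c \<le> Z (real j * mesh n) \<omega>)}" for k :: nat
  have [measurable]: "E k \<in> sets M" for k unfolding E_def by measurable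
  have "(\<integral>\<^sup>+\<omega>. indicator (grid_hits c n) \<omega> * (ennreal (exp (- q * grid_time c n \<omega>))
             * f (Z (grid_time c n \<omega> + s) \<omega> - Z (grid_time c n \<omega>) \<omega>)) \<partial>M)
      = (\<integral>\<^sup>+\<omega>. (\<Sum>k. indicator (E k) \<omega> * (ennreal (exp (- q * (real k * mesh n)))
             * f (Z (real k * mesh n + s) \<omega> - Z (real k * mesh n) \<omega>))) \<partial>M)"
    unfolding E_def
    by (intro nn_integral_cong grid_hit_sum[symmetric,
          where h = "\<lambda>t. ennreal (exp (- q * t)) * f (Z (t + s) _ - Z t _)"])
  also have "\<dots> = (\<Sum>k. \<integral>\<^sup>+\<omega>. ennreal (exp (- q * (real k * mesh n))) * (indicator (E k) \<omega>
             * f (Z (real k * mesh n + s) \<omega> - Z (real k * mesh n) \<omega>)) \<partial>M)"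
    by (subst nn_integral_suminf[symmetric]) (auto simp: mult_ac)
  also have "\<dots> = (\<Sum>k. (\<integral>\<^sup>+\<omega>. indicator (E k) \<omega> * ennreal (exp (- q * (real k * mesh n))) \<partial>M)
             * (\<integral>\<^sup>+\<omega>. f (Z s \<omega>) \<partial>M))"
  proof (intro suminf_cong)
    fix k
    let ?J = "\<integral>\<^sup>+\<omega>. f (Z s \<omega>) \<partial>M" and ?e = "ennreal (exp (- q * (real k * mesh n)))"
    have "(\<integral>\<^sup>+\<omega>. ?e * (indicator (E k) \<omega> * f (Z (real k * mesh n + s) \<omega> - Z (real k * mesh n) \<omega>)) \<partial>M)
        = ?e * (emeasure M (E k) * ?J)"
      using nn_integral_grid_Markov[OF less_imp_le[OF mesh_pos] s, of f k n c]
      by (subst nn_integral_cmult) (auto simp: E_def)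
    moreover have "(\<integral>\<^sup>+\<omega>. indicator (E k) \<omega> * ?e \<partial>M) = emeasure M (E k) * ?e"
      by (subst nn_integral_multc) auto
    ultimately show "(\<integral>\<^sup>+\<omega>. ?e * (indicator (E k) \<omega> * f (Z (real k * mesh n + s) \<omega> - Z (real k * mesh n) \<omega>)) \<partial>M)
        = (\<integral>\<^sup>+\<omega>. indicator (E k) \<omega> * ?e \<partial>M) * ?J"
      by (simp only: mult_ac)
  qed
  also have "\<dots> = (\<integral>\<^sup>+\<omega>. (\<Sum>k. indicator (E k) \<omega> * ennreal (exp (- q * (real k * mesh n)))) \<partial>M)
             * (\<integral>\<^sup>+\<omega>. f (Z s \<omega>) \<partial>M)"
    by (simp add: nn_integral_suminf)
  also have "(\<integral>\<^sup>+\<omega>. (\<Sum>k. indicator (E k) \<omega> * ennreal (exp (- q * (real k * mesh n)))) \<partial>M)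
      = (\<integral>\<^sup>+\<omega>. indicator (grid_hits c n) \<omega> * ennreal (exp (- q * grid_time c n \<omega>)) \<partial>M)"
    unfolding E_def
    by (intro nn_integral_cong grid_hit_sum[where h = "\<lambda>t. ennreal (exp (- q * t))"])
  finally show ?thesis .
qed

text \<open>The Laplace transform of the passage time on the event that it is finite; at
  \<open>q = 0\<close> it is the probability of passage.\<close>

definition hit_transform :: "real \<Rightarrow> real \<Rightarrow> ennreal" where
  "hit_transform q c = (\<integral>\<^sup>+\<omega>. indicator (hits c) \<omega> * ennreal (exp (- q * hit_time c \<omega>)) \<partial>M)"

lemma hit_transform_le_1: "0 \<le> q \<Longrightarrow> hit_transform q c \<le> 1"
proof -
  assume "0 \<le> q"
  then have "hit_transform q c \<le> (\<integral>\<^sup>+\<omega>. 1 \<partial>M)"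
    unfolding hit_transform_def using hit_time_nonneg
    by (intro nn_integral_mono) (auto simp: indicator_def)
  then show ?thesis by (simp add: emeasure_space_1)
qed

lemma eventually_indicator_grid_hits:
  assumes "\<omega> \<in> space M"
  shows "\<forall>\<^sub>F n in sequentially. indicator (grid_hits c n) \<omega> = (indicator (hits c) \<omega> :: ennreal)"
proof (cases "\<omega> \<in> hits c")
  case True
  from eventually_grid_time[OF this, of 1] show ?thesis
    using True by (auto elim: eventually_mono)
next
  case False
  then show ?thesis using grid_hits_subset[of c] by (auto simp: indicator_def intro!: always_eventually)
qed

lemma grid_time_tendsto':
  "\<omega> \<in> space M \<Longrightarrow> (\<lambda>n. grid_time c n \<omega>) \<longlonglongrightarrow> hit_time c \<omega>"
proof (cases "\<omega> \<in> hits c")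
  case False
  then have "grid_time c n \<omega> = hit_time c \<omega>" for n
    using grid_hits_subset[of c n] by (auto simp: grid_time_def)
  then show ?thesis by simp
qed (rule grid_time_tendsto)

text \<open>The grid identity passes to the limit by dominated convergence with bound 1.
  Right-continuity carries the positions along, and since the path almost surely sits at
  \<open>- c\<close> at passage, the increment becomes the later position plus
  \<open>c\<close>.\<close>

lemma strong_Markov_continuous:
  assumes c: "0 \<le> c" and s: "0 \<le> s" and q: "0 \<le> q"
    and f: "continuous_on UNIV f" "\<And>x. 0 \<le> f x" "\<And>x. f x \<le> 1"
  shows "(\<integral>\<^sup>+\<omega>. indicator (hits c) \<omega> * (ennreal (exp (- q * hit_time c \<omega>))
             * ennreal (f (Z (hit_time c \<omega> + s) \<omega> + c))) \<partial>M)
       = hit_transform q c * (\<integral>\<^sup>+\<omega>. ennreal (f (Z s \<omega>)) \<partial>M)"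
proof (rule LIMSEQ_unique)
  have [measurable]: "f \<in> borel_measurable borel" using f(1) by (rule borel_measurable_continuous_onI)
  have f_lim: "(\<lambda>n. f (x n)) \<longlonglongrightarrow> f y" if "x \<longlonglongrightarrow> y" for x y
    using continuous_on_tendsto_compose[OF f(1) that] by simp
  have exp_le: "ennreal (exp (- q * grid_time c n \<omega>)) \<le> 1" for n \<omega>
    using q order_trans[OF hit_time_nonneg hit_time_le_grid_time[where n = n], of c \<omega>] by simp
  let ?u = "\<lambda>n \<omega>. indicator (grid_hits c n) \<omega> * (ennreal (exp (- q * grid_time c n \<omega>))
             * ennreal (f (Z (grid_time c n \<omega> + s) \<omega> - Z (grid_time c n \<omega>) \<omega>)))"
  show "(\<lambda>n. \<integral>\<^sup>+\<omega>. ?u n \<omega> \<partial>M) \<longlonglongrightarrow> (\<integral>\<^sup>+\<omega>. indicator (hits c) \<omega> * (ennreal (exp (- q * hit_time c \<omega>))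
             * ennreal (f (Z (hit_time c \<omega> + s) \<omega> + c))) \<partial>M)"
  proof (rule nn_integral_dominated_convergence[where w = "\<lambda>_. 1"])
    show "AE \<omega> in M. (\<lambda>n. ?u n \<omega>) \<longlonglongrightarrow> indicator (hits c) \<omega> * (ennreal (exp (- q * hit_time c \<omega>))
             * ennreal (f (Z (hit_time c \<omega> + s) \<omega> + c)))"
      using AE_Z_hit_time[OF c] AE_space
    proof eventually_elim
      case (elim \<omega>)
      show ?case
      proof (cases "\<omega> \<in> hits c")
        case True
        have "(\<lambda>n. f (Z (grid_time c n \<omega> + s) \<omega> - Z (grid_time c n \<omega>) \<omega>))
            \<longlonglongrightarrow> f (Z (hit_time c \<omega> + s) \<omega> - Z (hit_time c \<omega>) \<omega>)"
          using elim True hit_time_le_grid_time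
          by (intro f_lim tendsto_diff Z_tendsto_from_right tendsto_add tendsto_const grid_time_tendsto) auto
        then have *: "(\<lambda>n. f (Z (grid_time c n \<omega> + s) \<omega> - Z (grid_time c n \<omega>) \<omega>))
            \<longlonglongrightarrow> f (Z (hit_time c \<omega> + s) \<omega> + c)" using elim True by simp
        have "(\<lambda>n. indicator (hits c) \<omega> * (ennreal (exp (- q * grid_time c n \<omega>))
             * ennreal (f (Z (grid_time c n \<omega> + s) \<omega> - Z (grid_time c n \<omega>) \<omega>))))
          \<longlonglongrightarrow> indicator (hits c) \<omega> * (ennreal (exp (- q * hit_time c \<omega>)) * ennreal (f (Z (hit_time c \<omega> + s) \<omega> + c)))"
          unfolding ennreal_mult[OF exp_ge_zero f(2), symmetric]
          by (intro ennreal_tendsto_cmult tendsto_ennrealI tendsto_mult * tendsto_exp tendsto_const grid_time_tendsto True)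
             (simp add: indicator_def)
        then show ?thesis
          by (rule Lim_transform_eventually)
             (use eventually_indicator_grid_hits[of \<omega> c] elim in \<open>auto elim!: eventually_mono\<close>)
      next
        case False
        then have "indicator (grid_hits c n) \<omega> = (0 :: ennreal)" for n
          using grid_hits_subset[of c n] by (auto simp: indicator_def)
        then show ?thesis using False by simp
      qed
    qed
    show "AE \<omega> in M. ?u n \<omega> \<le> 1" for n
    proof (intro always_eventually allI)
      fix \<omega>
      have "?u n \<omega> \<le> 1 * (1 * 1)"
        using exp_le f by (intro mult_mono) (auto simp: indicator_def ennreal_le_1)
      then show "?u n \<omega> \<le> 1" by simp
    qed
  qed (auto simp: emeasure_space_1)
  have "(\<lambda>n. (\<integral>\<^sup>+\<omega>. indicator (grid_hits c n) \<omega> * ennreal (exp (- q * grid_time c n \<omega>)) \<partial>M)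
         * (\<integral>\<^sup>+\<omega>. ennreal (f (Z s \<omega>)) \<partial>M)) \<longlonglongrightarrow> hit_transform q c * (\<integral>\<^sup>+\<omega>. ennreal (f (Z s \<omega>)) \<partial>M)"
  proof (rule tendsto_mult_ennreal[OF _ tendsto_const])
    show "(\<lambda>n. \<integral>\<^sup>+\<omega>. indicator (grid_hits c n) \<omega> * ennreal (exp (- q * grid_time c n \<omega>)) \<partial>M)
        \<longlonglongrightarrow> hit_transform q c"
      unfolding hit_transform_def
    proof (rule nn_integral_dominated_convergence[where w = "\<lambda>_. 1"])
      show "AE \<omega> in M. indicator (grid_hits c n) \<omega> * ennreal (exp (- q * grid_time c n \<omega>)) \<le> 1" for n
        using mult_mono[OF _ exp_le, of "indicator (grid_hits c n) \<omega>" 1 n \<omega> for \<omega>]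
        by (intro always_eventually) (auto simp: indicator_def exp_le)
      show "AE \<omega> in M. (\<lambda>n. indicator (grid_hits c n) \<omega> * ennreal (exp (- q * grid_time c n \<omega>)))
          \<longlonglongrightarrow> indicator (hits c) \<omega> * ennreal (exp (- q * hit_time c \<omega>))"
        using AE_space
      proof eventually_elim
        case (elim \<omega>)
        have "(\<lambda>n. indicator (hits c) \<omega> * ennreal (exp (- q * grid_time c n \<omega>)))
          \<longlonglongrightarrow> indicator (hits c) \<omega> * ennreal (exp (- q * hit_time c \<omega>))"
          by (intro ennreal_tendsto_cmult tendsto_intros grid_time_tendsto' elim) (simp add: indicator_def)
        then show ?case
          by (rule Lim_transform_eventually)
             (use eventually_indicator_grid_hits[OF elim, of c] in \<open>auto elim!: eventually_mono\<close>)
      qed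
    qed (auto simp: emeasure_space_1)
    have "(\<integral>\<^sup>+\<omega>. ennreal (f (Z s \<omega>)) \<partial>M) \<le> (\<integral>\<^sup>+\<omega>. 1 \<partial>M)"
      using f(3) by (intro nn_integral_mono) (simp add: ennreal_le_1)
    then show "\<not> (hit_transform q c = 0 \<and> (\<integral>\<^sup>+\<omega>. ennreal (f (Z s \<omega>)) \<partial>M) = \<infinity> \<or>
        hit_transform q c = \<infinity> \<and> (\<integral>\<^sup>+\<omega>. ennreal (f (Z s \<omega>)) \<partial>M) = 0)"
      using hit_transform_le_1[OF q, of c] by (auto simp: emeasure_space_1 top_unique)
  qed
  then show "(\<lambda>n. \<integral>\<^sup>+\<omega>. ?u n \<omega> \<partial>M) \<longlonglongrightarrow> hit_transform q c * (\<integral>\<^sup>+\<omega>. ennreal (f (Z s \<omega>)) \<partial>M)"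
    by (subst strong_Markov_grid[OF s]) auto
qed

text \<open>The discounted law of the position after passage and the multiple
  \<open>hit_transform q c\<close> of the law of \<open>Z s\<close> are finite measures on the line;
  it is enough that they agree on open half-lines, which continuous functions approximate.\<close>

lemma strong_Markov_hit:
  assumes c: "0 \<le> c" and s: "0 \<le> s" and q: "0 \<le> q" and f[measurable]: "f \<in> borel_measurable borel"
  shows "(\<integral>\<^sup>+\<omega>. indicator (hits c) \<omega> * (ennreal (exp (- q * hit_time c \<omega>)) * f (Z (hit_time c \<omega> + s) \<omega>)) \<partial>M)
       = hit_transform q c * (\<integral>\<^sup>+\<omega>. f (Z s \<omega> - c) \<partial>M)"
proof -
  define w where "w \<omega> = indicator (hits c) \<omega> * ennreal (exp (- q * hit_time c \<omega>))" for \<omega>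
  have [measurable]: "w \<in> borel_measurable M" unfolding w_def by measurable
  define \<mu> where "\<mu> = distr (density M w) borel (\<lambda>\<omega>. Z (hit_time c \<omega> + s) \<omega> + c)"
  define \<nu> where "\<nu> = scale_measure (hit_transform q c) (distr M borel (Z s))"
  have \<mu>: "(\<integral>\<^sup>+x. g x \<partial>\<mu>) = (\<integral>\<^sup>+\<omega>. w \<omega> * g (Z (hit_time c \<omega> + s) \<omega> + c) \<partial>M)"
    if [measurable]: "g \<in> borel_measurable borel" for g
    unfolding \<mu>_def by (simp add: nn_integral_distr nn_integral_density)
  have \<nu>: "(\<integral>\<^sup>+x. g x \<partial>\<nu>) = hit_transform q c * (\<integral>\<^sup>+\<omega>. g (Z s \<omega>) \<partial>M)"
    if [measurable]: "g \<in> borel_measurable borel" for g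
    unfolding \<nu>_def by (simp add: nn_integral_scale_measure nn_integral_distr)
  have "\<mu> = \<nu>"
  proof (rule measure_eqI_lessThan)
    show sets_\<mu>: "sets \<mu> = sets borel" and sets_\<nu>: "sets \<nu> = sets borel"
      by (auto simp: \<mu>_def \<nu>_def)
    fix x :: real
    \<comment> \<open>Ramps of slope \<open>n\<close> that start at \<open>x\<close> and are cut at
      1: continuous, increasing in \<open>n\<close>, with supremum the indicator of the
      half-line.\<close>
    define g where "g n y = min 1 (max 0 (real n * (y - x)))" for n y
    have cont: "continuous_on UNIV (g n)" for n unfolding g_def by (intro continuous_intros)
    then have [measurable]: "g n \<in> borel_measurable borel" for n by (rule borel_measurable_continuous_onI)
    have g_sup: "(SUP n. ennreal (g n y)) = indicator {x<..} y" for y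
    proof (cases "x < y")
      case True
      obtain n :: nat where "1 / (y - x) < real n" using reals_Archimedean2 by blast
      then have "g n y = 1" using True by (simp add: g_def field_simps min_def max_def)
      moreover have "g m y \<le> 1" for m by (simp add: g_def)
      ultimately show ?thesis using True
        by (intro antisym SUP_least SUP_upper2[of n]) (auto simp: ennreal_le_1)
    next
      case False
      then have "g n y = 0" for n by (simp add: g_def mult_nonneg_nonpos)
      then show ?thesis using False by simp
    qed
    have g_inc: "incseq (\<lambda>n y. ennreal (g n y))"
    proof (intro incseq_SucI le_funI ennreal_leI)
      fix n y
      show "g n y \<le> g (Suc n) y"
      proof (cases "x \<le> y")
        case True
        then have "real n * (y - x) \<le> real (Suc n) * (y - x)" by (intro mult_right_mono) auto
        then show ?thesis unfolding g_def by (intro min.mono max.mono order_refl)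
      qed (simp add: g_def mult_nonneg_nonpos del: of_nat_Suc)
    qed
    have em: "emeasure m {x<..} = (SUP n. \<integral>\<^sup>+y. ennreal (g n y) \<partial>m)" if m: "sets m = sets borel" for m
    proof -
      have [measurable_cong]: "sets m = sets borel" by (rule m)
      have "emeasure m {x<..} = (\<integral>\<^sup>+y. indicator {x<..} y \<partial>m)" by simp
      also have "\<dots> = (\<integral>\<^sup>+y. (SUP n. ennreal (g n y)) \<partial>m)" by (simp add: g_sup)
      also have "\<dots> = (SUP n. \<integral>\<^sup>+y. ennreal (g n y) \<partial>m)"
        by (rule nn_integral_monotone_convergence_SUP[OF g_inc]) measurable
      finally show ?thesis .
    qed
    have "(\<integral>\<^sup>+y. ennreal (g n y) \<partial>\<mu>) = (\<integral>\<^sup>+y. ennreal (g n y) \<partial>\<nu>)" for n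
      using strong_Markov_continuous[OF c s q cont, of n]
      by (simp add: \<mu> \<nu> w_def mult.assoc) (simp add: g_def)
    then show "emeasure \<mu> {x<..} = emeasure \<nu> {x<..}"
      by (simp add: em sets_\<mu> sets_\<nu>)
    have "emeasure \<mu> {x<..} \<le> emeasure \<mu> (space \<mu>)" by (rule emeasure_space)
    also have "\<dots> = (\<integral>\<^sup>+y. 1 \<partial>\<mu>)" by simp
    also have "\<dots> = hit_transform q c" by (simp only: \<mu> borel_measurable_const) (simp add: w_def hit_transform_def)
    also have "\<dots> < \<infinity>" using hit_transform_le_1[OF q, of c] by (auto simp: less_top[symmetric] top_unique)
    finally show "emeasure \<mu> {x<..} < \<infinity>" .
  qed
  then have "(\<integral>\<^sup>+x. f (x - c) \<partial>\<mu>) = (\<integral>\<^sup>+x. f (x - c) \<partial>\<nu>)" by simp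
  then show ?thesis by (simp add: \<mu> \<nu> w_def mult.assoc)
qed

definition potential :: "real \<Rightarrow> (real \<Rightarrow> ennreal) \<Rightarrow> ennreal" where
  "potential q f = (\<integral>\<^sup>+\<omega>. \<integral>\<^sup>+t. indicator {0..} t * (ennreal (exp (- q * t)) * f (Z t \<omega>)) \<partial>lborel \<partial>M)"

sublocale time: pair_sigma_finite M lborel ..

lemma potential_eq_time_integral:
  assumes [measurable]: "f \<in> borel_measurable borel"
  shows "potential q f = (\<integral>\<^sup>+t. indicator {0..} t * (ennreal (exp (- q * t)) * (\<integral>\<^sup>+\<omega>. f (Z t \<omega>) \<partial>M)) \<partial>lborel)"
  unfolding potential_def
  by (subst time.Fubini'[symmetric]) (auto simp: nn_integral_cmult split_beta' intro!: nn_integral_cong)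

text \<open>Moving the time origin to the passage time splits off the factor
  \<open>exp (- q * hit_time c \<omega>)\<close>; the strong Markov property is then used at each
  fixed delay \<open>s\<close> and integrated by Fubini.\<close>

lemma strong_Markov_potential:
  assumes c: "0 \<le> c" and q: "0 \<le> q" and f[measurable]: "f \<in> borel_measurable borel"
  shows "(\<integral>\<^sup>+\<omega>. indicator (hits c) \<omega> *
            (\<integral>\<^sup>+t. indicator {hit_time c \<omega>..} t * (ennreal (exp (- q * t)) * f (Z t \<omega>)) \<partial>lborel) \<partial>M)
       = hit_transform q c * potential q (\<lambda>y. f (y - c))"
proof -
  define h where "h s \<omega> = indicator (hits c) \<omega> *
      (ennreal (exp (- q * hit_time c \<omega>)) * f (Z (hit_time c \<omega> + s) \<omega>))" for s \<omega>
  have [measurable]: "(\<lambda>(s, \<omega>). h s \<omega>) \<in> borel_measurable (lborel \<Otimes>\<^sub>M M)"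
    "(\<lambda>(\<omega>, s). h s \<omega>) \<in> borel_measurable (M \<Otimes>\<^sub>M lborel)"
    unfolding h_def by measurable
  have "indicator (hits c) \<omega> *
            (\<integral>\<^sup>+t. indicator {hit_time c \<omega>..} t * (ennreal (exp (- q * t)) * f (Z t \<omega>)) \<partial>lborel)
      = (\<integral>\<^sup>+s. indicator {0..} s * (ennreal (exp (- q * s)) * h s \<omega>) \<partial>lborel)" if [measurable]: "\<omega> \<in> space M" for \<omega>
  proof -
    have [measurable]: "(\<lambda>t. Z t \<omega>) \<in> borel_measurable borel"
      using measurable_Z[of "\<lambda>t. t" borel "\<lambda>_. \<omega>"] that by simp
    have "(\<integral>\<^sup>+t. indicator {hit_time c \<omega>..} t * (ennreal (exp (- q * t)) * f (Z t \<omega>)) \<partial>lborel)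
        = (\<integral>\<^sup>+s. indicator {0..} s * (ennreal (exp (- q * s)) * (ennreal (exp (- q * hit_time c \<omega>)) * f (Z (hit_time c \<omega> + s) \<omega>))) \<partial>lborel)"
    proof (subst nn_integral_real_affine[where c = 1 and t = "hit_time c \<omega>"])
      have "ennreal (exp (- q * (hit_time c \<omega> + s))) = ennreal (exp (- q * s)) * ennreal (exp (- q * hit_time c \<omega>))" for s
        by (simp add: ennreal_mult[symmetric] exp_add[symmetric] algebra_simps)
      moreover have "indicator {hit_time c \<omega>..} (hit_time c \<omega> + s) = (indicator {0..} s :: ennreal)" for s
        by (simp add: indicator_def)
      ultimately show "ennreal \<bar>1\<bar> * (\<integral>\<^sup>+s. indicator {hit_time c \<omega>..} (hit_time c \<omega> + 1 * s) *
            (ennreal (exp (- q * (hit_time c \<omega> + 1 * s))) * f (Z (hit_time c \<omega> + 1 * s) \<omega>)) \<partial>lborel)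
        = (\<integral>\<^sup>+s. indicator {0..} s * (ennreal (exp (- q * s)) * (ennreal (exp (- q * hit_time c \<omega>)) * f (Z (hit_time c \<omega> + s) \<omega>))) \<partial>lborel)"
        by (simp add: mult.assoc)
    qed auto
    moreover have "h s \<omega> = ennreal (exp (- q * hit_time c \<omega>)) * f (Z (hit_time c \<omega> + s) \<omega>)"
      if "\<omega> \<in> hits c" for s using that by (simp add: h_def)
    moreover have "h s \<omega> = 0" if "\<omega> \<notin> hits c" for s using that by (simp add: h_def)
    ultimately show ?thesis by (cases "\<omega> \<in> hits c") simp_all
  qed
  then have "(\<integral>\<^sup>+\<omega>. indicator (hits c) \<omega> *
            (\<integral>\<^sup>+t. indicator {hit_time c \<omega>..} t * (ennreal (exp (- q * t)) * f (Z t \<omega>)) \<partial>lborel) \<partial>M)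
      = (\<integral>\<^sup>+\<omega>. \<integral>\<^sup>+s. indicator {0..} s * (ennreal (exp (- q * s)) * h s \<omega>) \<partial>lborel \<partial>M)"
    by (rule nn_integral_cong)
  also have "\<dots> = (\<integral>\<^sup>+s. \<integral>\<^sup>+\<omega>. indicator {0..} s * (ennreal (exp (- q * s)) * h s \<omega>) \<partial>M \<partial>lborel)"
    by (rule time.Fubini'[symmetric]) measurable
  also have "\<dots> = (\<integral>\<^sup>+s. hit_transform q c * (indicator {0..} s * (ennreal (exp (- q * s)) * (\<integral>\<^sup>+\<omega>. f (Z s \<omega> - c) \<partial>M))) \<partial>lborel)"
  proof (rule nn_integral_cong)
    fix s :: real
    have "(\<integral>\<^sup>+\<omega>. h s \<omega> \<partial>M) = hit_transform q c * (\<integral>\<^sup>+\<omega>. f (Z s \<omega> - c) \<partial>M)" if "0 \<le> s"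
      unfolding h_def by (rule strong_Markov_hit[OF c that q f])
    then show "(\<integral>\<^sup>+\<omega>. indicator {0..} s * (ennreal (exp (- q * s)) * h s \<omega>) \<partial>M)
        = hit_transform q c * (indicator {0..} s * (ennreal (exp (- q * s)) * (\<integral>\<^sup>+\<omega>. f (Z s \<omega> - c) \<partial>M)))"
      by (cases "0 \<le> s") (simp_all add: nn_integral_cmult, simp add: mult_ac)
  qed
  also have "\<dots> = hit_transform q c * potential q (\<lambda>y. f (y - c))"
    by (simp add: nn_integral_cmult potential_eq_time_integral)
  finally show ?thesis .
qed

subsection \<open>The potential measure\<close>

lemma measurable_Z_time: "\<omega> \<in> space M \<Longrightarrow> (\<lambda>t. Z t \<omega>) \<in> borel_measurable borel"
  using measurable_Z[of "\<lambda>t. t" borel "\<lambda>_. \<omega>"] by simp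

lemma exponent_pos: "0 < \<theta> \<Longrightarrow> 0 < \<Psi> \<theta>"
  using exponent_ge[of \<theta>] mult_pos_pos[OF gamma_pos, of \<theta>] by linarith

text \<open>The cut-off is a case distinction because \<open>hit_time\<close> is 0 on paths that
  never pass the level; on those the occupation runs over all times.\<close>

definition occupation_before :: "real \<Rightarrow> real \<Rightarrow> (real \<Rightarrow> ennreal) \<Rightarrow> ennreal" where
  "occupation_before q c f = (\<integral>\<^sup>+\<omega>. \<integral>\<^sup>+t. indicator {0..} t * (if \<omega> \<in> hits c \<and> hit_time c \<omega> \<le> t then 0
       else ennreal (exp (- q * t)) * f (Z t \<omega>)) \<partial>lborel \<partial>M)"

lemma potential_split:
  assumes "0 \<le> c" "0 \<le> q" and [measurable]: "f \<in> borel_measurable borel"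
  shows "potential q f = occupation_before q c f + hit_transform q c * potential q (\<lambda>y. f (y - c))"
proof -
  have "potential q f = (\<integral>\<^sup>+\<omega>. (\<integral>\<^sup>+t. indicator {0..} t * (if \<omega> \<in> hits c \<and> hit_time c \<omega> \<le> t then 0
       else ennreal (exp (- q * t)) * f (Z t \<omega>)) \<partial>lborel) + indicator (hits c) \<omega> *
            (\<integral>\<^sup>+t. indicator {hit_time c \<omega>..} t * (ennreal (exp (- q * t)) * f (Z t \<omega>)) \<partial>lborel) \<partial>M)"
    unfolding potential_def
  proof (rule nn_integral_cong)
    fix \<omega> assume \<omega>[measurable]: "\<omega> \<in> space M"
    note measurable_Z_time[OF \<omega>, measurable]
    have [measurable]: "Measurable.pred borel (\<lambda>t. \<omega> \<in> hits c \<and> hit_time c \<omega> \<le> t)" by measurable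
    have "(\<integral>\<^sup>+t. indicator {0..} t * (ennreal (exp (- q * t)) * f (Z t \<omega>)) \<partial>lborel)
        = (\<integral>\<^sup>+t. indicator {0..} t * (if \<omega> \<in> hits c \<and> hit_time c \<omega> \<le> t then 0
       else ennreal (exp (- q * t)) * f (Z t \<omega>)) + indicator (hits c) \<omega> * (indicator {hit_time c \<omega>..} t * (ennreal (exp (- q * t)) * f (Z t \<omega>))) \<partial>lborel)"
      using hit_time_nonneg[of c \<omega>] by (intro nn_integral_cong) (auto simp: indicator_def)
    also have "\<dots> = (\<integral>\<^sup>+t. indicator {0..} t * (if \<omega> \<in> hits c \<and> hit_time c \<omega> \<le> t then 0
       else ennreal (exp (- q * t)) * f (Z t \<omega>)) \<partial>lborel) + indicator (hits c) \<omega> *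
            (\<integral>\<^sup>+t. indicator {hit_time c \<omega>..} t * (ennreal (exp (- q * t)) * f (Z t \<omega>)) \<partial>lborel)"
      by (subst nn_integral_add) (auto simp: nn_integral_cmult)
    finally show "(\<integral>\<^sup>+t. indicator {0..} t * (ennreal (exp (- q * t)) * f (Z t \<omega>)) \<partial>lborel) = \<dots>" .
  qed
  also have "\<dots> = occupation_before q c f + hit_transform q c * potential q (\<lambda>y. f (y - c))"
    unfolding occupation_before_def strong_Markov_potential[OF assms, symmetric]
  proof (rule nn_integral_add)
    have [measurable]: "Measurable.pred (M \<Otimes>\<^sub>M lborel) (\<lambda>x. snd x \<ge> hit_time c (fst x))" by measurable
    show "(\<lambda>\<omega>. indicator (hits c) \<omega> * (\<integral>\<^sup>+t. indicator {hit_time c \<omega>..} t * (ennreal (exp (- q * t)) * f (Z t \<omega>)) \<partial>lborel))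
        \<in> borel_measurable M"
      unfolding indicator_def atLeast_iff by measurable
  qed measurable
  finally show ?thesis .
qed

lemma potential_add:
  assumes [measurable]: "f \<in> borel_measurable borel" "g \<in> borel_measurable borel"
  shows "potential q (\<lambda>y. f y + g y) = potential q f + potential q g"
  by (simp add: potential_eq_time_integral nn_integral_add distrib_left)

lemma potential_cmult:
  assumes [measurable]: "f \<in> borel_measurable borel"
  shows "potential q (\<lambda>y. a * f y) = a * potential q f"
proof -
  have "potential q (\<lambda>y. a * f y) = (\<integral>\<^sup>+t. a * (indicator {0..} t * (ennreal (exp (- q * t)) * (\<integral>\<^sup>+\<omega>. f (Z t \<omega>) \<partial>M))) \<partial>lborel)"
    by (simp add: potential_eq_time_integral nn_integral_cmult mult_ac)
  then show ?thesis by (simp add: potential_eq_time_integral nn_integral_cmult)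
qed

lemma potential_mono: "(\<And>y. f y \<le> g y) \<Longrightarrow> potential q f \<le> potential q g"
  unfolding potential_def by (intro nn_integral_mono mult_left_mono) auto

text \<open>Before passage the path stays at or above \<open>- c\<close>, so only the values of the
  functions there count.\<close>

lemma occupation_before_mono:
  assumes "\<And>y. - c \<le> y \<Longrightarrow> f y \<le> g y" "q' \<le> q"
  shows "occupation_before q c f \<le> occupation_before q' c g"
  unfolding occupation_before_def
proof (intro nn_integral_mono)
  fix \<omega> t assume \<omega>: "\<omega> \<in> space M"
  show "indicator {0..} t * (if \<omega> \<in> hits c \<and> hit_time c \<omega> \<le> t then 0 else ennreal (exp (- q * t)) * f (Z t \<omega>))
     \<le> indicator {0..} t * (if \<omega> \<in> hits c \<and> hit_time c \<omega> \<le> t then 0 else ennreal (exp (- q' * t)) * g (Z t \<omega>))"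
  proof (cases "0 \<le> t \<and> \<not> (\<omega> \<in> hits c \<and> hit_time c \<omega> \<le> t)")
    case True
    have "- c \<le> Z t \<omega>"
    proof (cases "\<omega> \<in> hits c")
      case h: True
      then show ?thesis using True \<omega> by (intro Z_before_hit_time) auto
    qed (use True \<omega> in \<open>auto simp: hits_def not_less\<close>)
    then show ?thesis using True assms
      by (auto intro!: mult_mono ennreal_leI mult_right_mono)
  qed (auto simp: indicator_def)
qed

lemma occupation_before_cong:
  assumes "\<And>y. - c \<le> y \<Longrightarrow> f y = g y"
  shows "occupation_before q c f = occupation_before q c g"
  using assms by (intro antisym occupation_before_mono) auto

lemma potential_exp:
  assumes "0 \<le> \<theta>" "\<Psi> \<theta> < q"
  shows "potential q (\<lambda>y. ennreal (exp (- \<theta> * y))) = ennreal (1 / (q - \<Psi> \<theta>))"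
proof -
  have "potential q (\<lambda>y. ennreal (exp (- \<theta> * y))) = (\<integral>\<^sup>+t. indicator {0..} t * (ennreal (exp (- q * t)) * mgf \<theta> t) \<partial>lborel)"
    by (simp add: potential_eq_time_integral mgf_def)
  also have "\<dots> = (\<integral>\<^sup>+t. indicator {0..} t * ennreal (exp (- (q - \<Psi> \<theta>) * t)) \<partial>lborel)"
  proof (rule nn_integral_cong)
    fix t :: real
    show "indicator {0..} t * (ennreal (exp (- q * t)) * mgf \<theta> t) = indicator {0..} t * ennreal (exp (- (q - \<Psi> \<theta>) * t))"
      using assms by (cases "0 \<le> t") (simp_all add: mgf_eq ennreal_mult[symmetric] exp_add[symmetric] algebra_simps)
  qed
  also have "\<dots> = ennreal (1 / (q - \<Psi> \<theta>))" using assms by (intro nn_integral_exp_atLeast) simp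
  finally show ?thesis .
qed

lemma potential_const:
  assumes "0 < q" shows "potential q (\<lambda>_. 1) = ennreal (1 / q)"
  using nn_integral_exp_atLeast[OF assms] by (simp add: potential_eq_time_integral emeasure_space_1)

text \<open>The bound remains finite as \<open>q\<close> decreases to
  \<open>\<Psi> \<theta>\<close>, in contrast to the full potential
  \<open>1 / (q - \<Psi> \<theta>)\<close>. This contrast determines the passage transform.\<close>

lemma occupation_before_le:
  assumes "0 < q" "0 \<le> \<theta>"
  shows "occupation_before q c (\<lambda>y. ennreal (exp (- \<theta> * y))) \<le> ennreal (exp (\<theta> * c) / q)"
proof -
  have "occupation_before q c (\<lambda>y. ennreal (exp (- \<theta> * y))) \<le> occupation_before q c (\<lambda>y. ennreal (exp (\<theta> * c)))"
  proof (rule occupation_before_mono)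
    fix y assume "- c \<le> y"
    then have "\<theta> * (- c) \<le> \<theta> * y" using assms by (intro mult_left_mono)
    then show "ennreal (exp (- \<theta> * y)) \<le> ennreal (exp (\<theta> * c))" by (intro ennreal_leI) simp
  qed simp
  also have "\<dots> \<le> potential q (\<lambda>y. ennreal (exp (\<theta> * c)) * 1)"
    unfolding occupation_before_def potential_def by (intro nn_integral_mono) (auto intro!: mult_left_mono)
  also have "\<dots> = ennreal (exp (\<theta> * c) / q)"
    using assms by (subst potential_cmult) (auto simp: potential_const ennreal_mult[symmetric])
  finally show ?thesis .
qed

section \<open>The transform and the mean of the passage time\<close>

lemma hit_transform_antimono: "q' \<le> q \<Longrightarrow> hit_transform q c \<le> hit_transform q' c"
  unfolding hit_transform_def using hit_time_nonneg
  by (intro nn_integral_mono mult_left_mono ennreal_leI) (auto intro!: mult_right_mono)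

definition hit_transform_real :: "real \<Rightarrow> real \<Rightarrow> real" where
  "hit_transform_real q c = enn2real (hit_transform q c)"

lemma hit_transform_real:
  assumes "0 \<le> q"
  shows "hit_transform q c = ennreal (hit_transform_real q c)" "0 \<le> hit_transform_real q c" "hit_transform_real q c \<le> 1"
proof -
  show "hit_transform q c = ennreal (hit_transform_real q c)"
    using le_less_trans[OF hit_transform_le_1[OF assms] ennreal_one_less_top, of c]
    by (simp add: hit_transform_real_def)
  show "0 \<le> hit_transform_real q c" by (simp add: hit_transform_real_def)
  show "hit_transform_real q c \<le> 1"
    using enn2real_mono[OF hit_transform_le_1[OF assms, of c]] by (simp add: hit_transform_real_def)
qed

text \<open>Split the \<open>q\<close>-potential of \<open>exp (- \<theta> * y)\<close>, which is \<open>1 / (q - \<Psi> \<theta>)\<close>, at the hitting time; the part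
  before it stays bounded as \<open>q\<close> decreases to \<open>\<Psi> \<theta>\<close>.\<close>
lemma hit_transform_bounds:
  assumes "0 \<le> c" "0 < \<theta>" "\<Psi> \<theta> < q"
  shows "hit_transform_real q c \<le> exp (- \<theta> * c)"
    and "exp (- \<theta> * c) \<le> hit_transform_real q c + (q - \<Psi> \<theta>) / q"
proof -
  have q: "0 < q" using assms exponent_pos[of \<theta>] by linarith
  let ?i = "hit_transform_real q c" and ?f = "\<lambda>y. ennreal (exp (- \<theta> * y))"
  have shift: "potential q (\<lambda>y. ?f (y - c)) = ennreal (exp (\<theta> * c) / (q - \<Psi> \<theta>))"
  proof -
    have "potential q (\<lambda>y. ?f (y - c)) = potential q (\<lambda>y. ennreal (exp (\<theta> * c)) * ?f y)"
      by (simp add: ennreal_mult[symmetric] exp_add[symmetric] algebra_simps)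
    also have "\<dots> = ennreal (exp (\<theta> * c)) * potential q ?f" by (rule potential_cmult) measurable
    also have "potential q ?f = ennreal (1 / (q - \<Psi> \<theta>))" using assms by (intro potential_exp) auto
    finally show ?thesis using assms by (simp add: ennreal_mult[symmetric])
  qed
  obtain b where b: "occupation_before q c ?f = ennreal b" "0 \<le> b" "b \<le> exp (\<theta> * c) / q"
    using occupation_before_le[OF q, of \<theta> c] assms q
    by (cases "occupation_before q c ?f") (auto simp: top_unique)
  have "ennreal (1 / (q - \<Psi> \<theta>)) = ennreal b + ennreal ?i * ennreal (exp (\<theta> * c) / (q - \<Psi> \<theta>))"
    using potential_split[OF assms(1), of q ?f] q assms
    by (simp add: shift[simplified] potential_exp[simplified] b(1)[simplified] hit_transform_real)
  also have "\<dots> = ennreal (b + ?i * (exp (\<theta> * c) / (q - \<Psi> \<theta>)))"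
    using b q assms hit_transform_real[of q c] by (simp add: ennreal_mult[symmetric] ennreal_plus[symmetric] del: ennreal_plus)
  finally have eq: "1 / (q - \<Psi> \<theta>) = b + ?i * (exp (\<theta> * c) / (q - \<Psi> \<theta>))"
    using b q assms hit_transform_real[of q c] by (subst (asm) ennreal_inj) auto
  \<comment> \<open>Multiplying by \<open>(q - \<Psi> \<theta>) * exp (- \<theta> * c)\<close>
    solves the balance for the transform and turns the bounded part into the error term.\<close>
  have "(1 / (q - \<Psi> \<theta>)) * ((q - \<Psi> \<theta>) * exp (- \<theta> * c))
      = (b + ?i * (exp (\<theta> * c) / (q - \<Psi> \<theta>))) * ((q - \<Psi> \<theta>) * exp (- \<theta> * c))"
    by (simp only: eq)
  also have "\<dots> = b * ((q - \<Psi> \<theta>) * exp (- \<theta> * c)) + ?i * (exp (\<theta> * c) * exp (- \<theta> * c))"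
    using assms by (simp add: field_simps)
  finally have eq': "exp (- \<theta> * c) = b * ((q - \<Psi> \<theta>) * exp (- \<theta> * c)) + ?i"
    using assms by (simp add: exp_add[symmetric])
  have "0 \<le> b * ((q - \<Psi> \<theta>) * exp (- \<theta> * c))" using b assms by simp
  then show "?i \<le> exp (- \<theta> * c)" using eq' by linarith
  have "b * ((q - \<Psi> \<theta>) * exp (- \<theta> * c)) \<le> exp (\<theta> * c) / q * ((q - \<Psi> \<theta>) * exp (- \<theta> * c))"
    using b assms by (intro mult_right_mono) auto
  also have "\<dots> = (q - \<Psi> \<theta>) / q * (exp (\<theta> * c) * exp (- \<theta> * c))" by simp
  also have "\<dots> = (q - \<Psi> \<theta>) / q" by (simp add: exp_add[symmetric])
  finally show "exp (- \<theta> * c) \<le> ?i + (q - \<Psi> \<theta>) / q" using eq' by linarith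
qed

text \<open>The value at the exponent itself follows by monotonicity from discounts slightly larger.
  The choice \<open>q = (1 + e) * \<Psi> \<theta>\<close> keeps the relative error at most
  \<open>e\<close>.\<close>

lemma hit_transform_exponent_ge:
  assumes "0 \<le> c" "0 < \<theta>"
  shows "exp (- \<theta> * c) \<le> hit_transform_real (\<Psi> \<theta>) c"
proof (rule field_le_epsilon)
  fix e :: real assume "0 < e"
  have p: "0 < \<Psi> \<theta>" by (rule exponent_pos[OF assms(2)])
  define q where "q = \<Psi> \<theta> + e * \<Psi> \<theta>"
  have q: "\<Psi> \<theta> < q" using p \<open>0 < e\<close> by (simp add: q_def)
  have "exp (- \<theta> * c) \<le> hit_transform_real q c + (q - \<Psi> \<theta>) / q"
    using assms q by (intro hit_transform_bounds)
  also have "(q - \<Psi> \<theta>) / q \<le> (q - \<Psi> \<theta>) / \<Psi> \<theta>" using p q by (intro divide_left_mono) auto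
  also have "\<dots> = e" using p by (simp add: q_def)
  also have "hit_transform_real q c \<le> hit_transform_real (\<Psi> \<theta>) c"
    using hit_transform_antimono[of "\<Psi> \<theta>" q c] hit_transform_real[of q c] hit_transform_real[of "\<Psi> \<theta>" c] p q
    by (simp add: ennreal_le_iff)
  finally show "exp (- \<theta> * c) \<le> hit_transform_real (\<Psi> \<theta>) c + e" by simp
qed

text \<open>For small \<theta> the transform at \<open>\<Psi> \<theta>\<close> is at least
  \<open>exp (- \<theta> * c)\<close>, and it increases as the discount falls to 0. Hence passage
  below every level is almost sure.\<close>

lemma hit_transform_0:
  assumes "0 \<le> c" shows "hit_transform 0 c = 1"
proof (rule antisym[OF hit_transform_le_1])
  have "exp (- c * inverse (real (Suc n))) \<le> hit_transform_real 0 c" for n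
  proof -
    let ?t = "inverse (real (Suc n))"
    have "exp (- ?t * c) \<le> hit_transform_real (\<Psi> ?t) c" using assms by (intro hit_transform_exponent_ge) auto
    also have "\<dots> \<le> hit_transform_real 0 c"
      using hit_transform_antimono[of 0 "\<Psi> ?t" c] hit_transform_real[of "\<Psi> ?t" c] hit_transform_real[of 0 c] exponent_pos[of ?t]
      by (simp add: ennreal_le_iff)
    finally show ?thesis by (simp add: mult.commute)
  qed
  moreover have "(\<lambda>n. exp (- c * inverse (real (Suc n)))) \<longlonglongrightarrow> exp (- c * 0)"
    by (intro tendsto_intros LIMSEQ_inverse_real_of_nat)
  ultimately have "exp (- c * 0) \<le> hit_transform_real 0 c" by (intro LIMSEQ_le_const2) auto
  then show "1 \<le> hit_transform 0 c" using hit_transform_real[of 0 c] by (simp add: ennreal_1[symmetric] del: ennreal_1)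
qed simp

lemma AE_hits:
  assumes "0 \<le> c" shows "AE \<omega> in M. \<omega> \<in> hits c"
proof -
  have "emeasure M (hits c) = 1" using hit_transform_0[OF assms] by (simp add: hit_transform_def)
  then have "prob (hits c) = 1" by (simp add: emeasure_eq_measure)
  then show ?thesis by (rule AE_prob_1)
qed

text \<open>The potential of 1 is \<open>1 / q\<close>; its part after passage is the same quantity
  times the transform.\<close>

lemma occupation_before_const:
  assumes "0 \<le> c" "0 < q"
  shows "occupation_before q c (\<lambda>_. 1) = ennreal ((1 - hit_transform_real q c) / q)"
proof -
  let ?i = "hit_transform_real q c"
  have "ennreal (1 / q) = occupation_before q c (\<lambda>_. 1) + ennreal (?i / q)"
    using potential_split[of c q "\<lambda>_. 1"] assms hit_transform_real[of q c]
    by (simp add: potential_const ennreal_mult[symmetric])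
  then show ?thesis
    using assms hit_transform_real[of q c]
    by (cases "occupation_before q c (\<lambda>_. 1)")
       (auto simp: ennreal_plus[symmetric] diff_divide_distrib simp del: ennreal_plus)
qed

text \<open>Splitting the potential of \<open>{- c..}\<close> at passage reproduces the potential
  \<open>v\<close> of \<open>{0..}\<close> times a factor at most 1. Since discounting makes
  \<open>v\<close> finite, it can be cancelled; what remains is
  \<open>(1 - exp (- \<theta> * c)) / \<Psi> \<theta>\<close>, at most
  \<open>c / \<gamma>\<close>.\<close>

lemma potential_interval_le_discounted:
  assumes "0 \<le> c" "0 < \<theta>"
  shows "potential (\<Psi> \<theta>) (indicator {- c..<0}) \<le> ennreal (c / \<gamma>)"
proof -
  let ?q = "\<Psi> \<theta>" and ?i = "hit_transform_real (\<Psi> \<theta>) c"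
  have q: "0 < ?q" by (rule exponent_pos[OF assms(2)])
  note i = hit_transform_real[OF less_imp_le[OF q], of c]
  have ge: "exp (- \<theta> * c) \<le> ?i" by (rule hit_transform_exponent_ge[OF assms])
  have "potential ?q (indicator {0..}) \<le> potential ?q (\<lambda>_. 1)"
    by (intro potential_mono) (auto simp: indicator_def)
  then obtain v where v: "potential ?q (indicator {0..}) = ennreal v" "0 \<le> v"
    by (cases "potential ?q (indicator {0..})") (auto simp: potential_const q top_unique)
  have "potential ?q (indicator {- c..<0}) + ennreal v = potential ?q (\<lambda>y. indicator {- c..<0} y + indicator {0..} y)"
    by (simp add: potential_add v)
  also have "\<dots> = potential ?q (indicator {- c..})"
    using assms(1) by (intro arg_cong[where f = "potential ?q"]) (auto simp: fun_eq_iff indicator_def)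
  also have "\<dots> = occupation_before ?q c (indicator {- c..}) + hit_transform ?q c * potential ?q (\<lambda>y. indicator {- c..} (y - c))"
    using assms q by (intro potential_split) auto
  also have "(\<lambda>y. indicator {- c..} (y - c)) = (indicator {0..} :: real \<Rightarrow> ennreal)"
    by (auto simp: fun_eq_iff indicator_def)
  also have "occupation_before ?q c (indicator {- c..}) = occupation_before ?q c (\<lambda>_. 1)"
    by (rule occupation_before_cong) auto
  also have "\<dots> = ennreal ((1 - ?i) / ?q)" by (rule occupation_before_const[OF assms(1) q])
  also have "\<dots> + hit_transform ?q c * potential ?q (indicator {0..}) = ennreal ((1 - ?i) / ?q + ?i * v)"
    using i v q by (simp add: ennreal_mult[symmetric] ennreal_plus[symmetric] del: ennreal_plus)
  finally obtain u where u: "potential ?q (indicator {- c..<0}) = ennreal u" "0 \<le> u" "u + v = (1 - ?i) / ?q + ?i * v"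
    using i v q by (cases "potential ?q (indicator {- c..<0})")
       (auto simp: ennreal_plus[symmetric] simp del: ennreal_plus)
  have "?i * v \<le> 1 * v" using i v by (intro mult_right_mono) auto
  then have "u \<le> (1 - ?i) / ?q" using u by linarith
  also have "\<dots> \<le> (1 - exp (- \<theta> * c)) / ?q" using ge q by (intro divide_right_mono) auto
  also have "\<dots> \<le> (\<theta> * c) / ?q"
    using exp_ge_add_one_self[of "- \<theta> * c"] q by (intro divide_right_mono) auto
  also have "\<dots> \<le> (\<theta> * c) / (\<gamma> * \<theta>)"
    using exponent_ge[of \<theta>] gamma_pos assms q by (intro divide_left_mono) auto
  also have "\<dots> = c / \<gamma>" using assms by simp
  finally show ?thesis using u by (simp add: ennreal_leI)
qed

lemma exponent_tendsto_0: "(\<lambda>n. \<Psi> (1 / Suc n)) \<longlonglongrightarrow> 0"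
proof -
  have "(\<lambda>n. (\<Psi> (1 / Suc n) * Suc n) * inverse (real (Suc n))) \<longlonglongrightarrow> \<gamma> * 0"
    by (intro tendsto_mult exponent_slope LIMSEQ_inverse_real_of_nat)
  moreover have "(\<Psi> (1 / Suc n) * Suc n) * inverse (real (Suc n)) = \<Psi> (1 / Suc n)" for n
    by (simp add: field_simps del: of_nat_Suc)
  ultimately show ?thesis by (simp del: of_nat_Suc)
qed

lemma potential_interval_le:
  assumes "0 \<le> c" shows "potential 0 (indicator {- c..<0}) \<le> ennreal (c / \<gamma>)"
proof -
  let ?f = "indicator {- c..<0} :: real \<Rightarrow> ennreal" and ?q = "\<lambda>n. \<Psi> (1 / Suc n)"
  let ?J = "\<lambda>t. \<integral>\<^sup>+\<omega>. ?f (Z t \<omega>) \<partial>M"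
  have "potential 0 ?f = (\<integral>\<^sup>+t. indicator {0..} t * (ennreal (exp (- 0 * t)) * ?J t) \<partial>lborel)"
    by (rule potential_eq_time_integral) measurable
  also have "\<dots> = (\<integral>\<^sup>+t. liminf (\<lambda>n. indicator {0..} t * (ennreal (exp (- ?q n * t)) * ?J t)) \<partial>lborel)"
  proof (rule nn_integral_cong)
    fix t :: real
    have "?J t \<le> (\<integral>\<^sup>+\<omega>. 1 \<partial>M)" by (intro nn_integral_mono) (auto simp: indicator_def)
    then have fin: "?J t < top" by (simp add: emeasure_space_1 le_less_trans[OF _ ennreal_one_less_top])
    have "(\<lambda>n. exp (- ?q n * t)) \<longlonglongrightarrow> exp (- 0 * t)"
      by (intro tendsto_intros exponent_tendsto_0)
    then have "(\<lambda>n. indicator {0..} t * (?J t * ennreal (exp (- ?q n * t)))) \<longlonglongrightarrow> indicator {0..} t * (?J t * ennreal (exp (- 0 * t)))"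
      by (intro ennreal_tendsto_cmult tendsto_ennrealI fin) (simp_all add: indicator_def)
    from lim_imp_Liminf[OF sequentially_bot this]
    show "indicator {0..} t * (ennreal (exp (- 0 * t)) * ?J t) = liminf (\<lambda>n. indicator {0..} t * (ennreal (exp (- ?q n * t)) * ?J t))"
      by (simp only: mult.commute[of "?J t"])
  qed
  also have "\<dots> \<le> liminf (\<lambda>n. \<integral>\<^sup>+t. indicator {0..} t * (ennreal (exp (- ?q n * t)) * ?J t) \<partial>lborel)"
    by (rule nn_integral_liminf) measurable
  also have "\<dots> = liminf (\<lambda>n. potential (?q n) ?f)" by (simp add: potential_eq_time_integral)
  also have "\<dots> \<le> limsup (\<lambda>n. potential (?q n) ?f)" by (rule Liminf_le_Limsup) simp
  also have "\<dots> \<le> ennreal (c / \<gamma>)"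
    using assms by (intro Limsup_bounded always_eventually allI potential_interval_le_discounted) auto
  finally show ?thesis .
qed

text \<open>The right side is the mean passage time. The discounted mean \<open>(1 - E) / q\<close>,
  with \<open>E\<close> the passage transform, bounds it from below and tends to
  \<open>c / \<gamma>\<close> as the discount vanishes.\<close>

lemma occupation_before_total_ge:
  assumes c: "0 \<le> c" shows "ennreal (c / \<gamma>) \<le> occupation_before 0 c (\<lambda>_. 1)"
proof -
  define h where "h n = inverse (real (Suc n))" for n
  \<comment> \<open>The upper bound on the transform requires a discount strictly above the
    exponent. The surplus \<open>(h n)\<^sup>2\<close> is negligible against \<open>h n\<close>, so
    \<open>q n / h n\<close> still tends to \<gamma>.\<close>
  define q where "q n = \<Psi> (1 / Suc n) + (h n)\<^sup>2" for n
  have h: "0 < h n" for n by (simp add: h_def)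
  have h0: "h \<longlonglongrightarrow> 0" unfolding h_def by (rule LIMSEQ_inverse_real_of_nat)
  have \<Psi>q: "\<Psi> (h n) < q n" for n using h[of n] by (simp add: q_def h_def inverse_eq_divide)
  have q: "0 < q n" for n using exponent_pos[OF h, of n] \<Psi>q[of n] by linarith
  have "(\<lambda>n. \<Psi> (1 / Suc n) * Suc n + h n) \<longlonglongrightarrow> \<gamma> + 0"
    by (intro tendsto_add exponent_slope h0)
  moreover have "\<Psi> (1 / Suc n) * Suc n + h n = q n / h n" for n
    using h[of n] by (simp add: q_def h_def field_simps power2_eq_square del: of_nat_Suc)
  ultimately have "(\<lambda>n. (c - c\<^sup>2 * h n) / (q n / h n)) \<longlonglongrightarrow> (c - c\<^sup>2 * 0) / \<gamma>"
    using gamma_pos by (intro tendsto_divide tendsto_diff tendsto_mult tendsto_const h0) auto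
  then have "(\<lambda>n. ennreal ((c - c\<^sup>2 * h n) / (q n / h n))) \<longlonglongrightarrow> ennreal (c / \<gamma>)"
    by (intro tendsto_ennrealI) simp
  moreover have "ennreal ((c - c\<^sup>2 * h n) / (q n / h n)) \<le> occupation_before 0 c (\<lambda>_. 1)" for n
  proof -
    have "(c - c\<^sup>2 * h n) / (q n / h n) = (h n * c - (h n * c)\<^sup>2) / q n"
      using h[of n] q[of n] by (simp add: field_simps power2_eq_square)
    also have "\<dots> \<le> (1 - exp (- h n * c)) / q n"
      using exp_minus_remainder_le[of "h n * c"] h[of n] q[of n] c by (intro divide_right_mono) auto
    also have "\<dots> \<le> (1 - hit_transform_real (q n) c) / q n"
      using hit_transform_bounds(1)[OF c h \<Psi>q, of n] q[of n] by (intro divide_right_mono) auto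
    finally have "ennreal ((c - c\<^sup>2 * h n) / (q n / h n)) \<le> occupation_before (q n) c (\<lambda>_. 1)"
      using occupation_before_const[OF c q] by (simp add: ennreal_leI)
    also have "\<dots> \<le> occupation_before 0 c (\<lambda>_. 1)"
      using q[of n] by (intro occupation_before_mono) auto
    finally show ?thesis .
  qed
  ultimately show ?thesis by (intro LIMSEQ_le_const2) auto
qed

section \<open>The undiscounted potential and its density\<close>

abbreviation U :: "(real \<Rightarrow> ennreal) \<Rightarrow> ennreal" where "U \<equiv> potential 0"

lemma U_split:
  assumes "0 \<le> c" and [measurable]: "f \<in> borel_measurable borel"
  shows "U f = occupation_before 0 c f + U (\<lambda>y. f (y - c))"
  using potential_split[of c 0 f] assms by (simp add: hit_transform_0)

text \<open>By the splitting identity the shifted function collects what the path accumulates after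
  passing \<open>- c\<close>. Moving a set upwards therefore cannot increase its potential.\<close>

lemma U_shift_le:
  assumes "0 \<le> c" and [measurable]: "f \<in> borel_measurable borel"
  shows "U (\<lambda>y. f (y - c)) \<le> U f"
  unfolding U_split[OF assms] by simp

text \<open>A function vanishing on \<open>{- c..}\<close> collects nothing before passage, so the
  potential is translation invariant below the starting point.\<close>

lemma U_shift_eq:
  assumes "0 \<le> c" "\<And>y. - c \<le> y \<Longrightarrow> f y = 0" and [measurable]: "f \<in> borel_measurable borel"
  shows "U (\<lambda>y. f (y - c)) = U f"
proof -
  have "occupation_before 0 c f = occupation_before 0 c (\<lambda>_. 0)"
    by (rule occupation_before_cong) (rule assms(2))
  also have "\<dots> = 0" by (simp add: occupation_before_def cong: if_cong)
  finally show ?thesis using U_split[OF assms(1,3)] by simp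
qed

text \<open>Shifting from below the starting point gives the bound; finiteness is what permits
  cancellation in the next balance.\<close>

lemma U_interval_finite: "U (indicator {0..<H}) < \<infinity>"
proof (cases "0 \<le> H")
  case True
  have "U (indicator {0..<H}) = U (\<lambda>y. indicator {- H..<0} (y - H))"
    by (intro arg_cong[where f = U]) (auto simp: fun_eq_iff indicator_def)
  also have "\<dots> \<le> U (indicator {- H..<0})" using True by (intro U_shift_le) auto
  also have "\<dots> \<le> ennreal (H / \<gamma>)" by (rule potential_interval_le[OF True])
  finally show ?thesis by (simp add: le_less_trans[OF _ ennreal_less_top])
next
  case False
  then have "(indicator {0..<H} :: real \<Rightarrow> ennreal) = (\<lambda>_. 0)" by (auto simp: fun_eq_iff indicator_def)
  then show ?thesis by (simp add: potential_def)
qed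

text \<open>Split the potential of \<open>{-c..<H}\<close> at the hitting time; the contribution of \<open>{0..<H}\<close> cancels.\<close>
lemma U_interval_balance:
  assumes "0 \<le> c" "0 \<le> H"
  shows "U (indicator {- c..<0}) = occupation_before 0 c (indicator {..<H}) + U (indicator {H..<H + c})"
proof -
  let ?V = "U (indicator {0..<H})"
  have "U (indicator {- c..<0}) + ?V = U (\<lambda>y. indicator {- c..<0} y + indicator {0..<H} y)"
    by (simp add: potential_add)
  also have "\<dots> = U (indicator {- c..<H})"
    using assms by (intro arg_cong[where f = U]) (auto simp: fun_eq_iff indicator_def)
  also have "\<dots> = occupation_before 0 c (indicator {- c..<H}) + U (\<lambda>y. indicator {- c..<H} (y - c))"
    using assms by (intro U_split) auto
  also have "occupation_before 0 c (indicator {- c..<H}) = occupation_before 0 c (indicator {..<H})"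
    by (rule occupation_before_cong) (auto simp: indicator_def)
  also have "U (\<lambda>y. indicator {- c..<H} (y - c)) = U (\<lambda>y. indicator {0..<H} y + indicator {H..<H + c} y)"
    using assms by (intro arg_cong[where f = U]) (auto simp: fun_eq_iff indicator_def)
  also have "\<dots> = ?V + U (indicator {H..<H + c})" by (simp add: potential_add)
  finally have "?V + U (indicator {- c..<0}) = ?V + (occupation_before 0 c (indicator {..<H}) + U (indicator {H..<H + c}))"
    by (simp add: add_ac)
  then show ?thesis using U_interval_finite[of H] by (auto simp: ennreal_add_left_cancel)
qed

lemma occupation_before_SUP: "(SUP n. occupation_before 0 c (indicator {..<real n})) = occupation_before 0 c (\<lambda>_. 1)"
proof -
  have sup: "(SUP n. indicator {..<real n} y) = (1 :: ennreal)" for y :: real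
  proof -
    obtain n where "y < real n" using reals_Archimedean2 by blast
    then show ?thesis by (intro antisym SUP_least SUP_upper2[of n]) (auto simp: indicator_def)
  qed
  have inc: "incseq (\<lambda>n. indicator {..<real n} y :: ennreal)" for y :: real
    by (auto simp: incseq_def indicator_def)
  have [measurable]: "Measurable.pred (M \<Otimes>\<^sub>M lborel) (\<lambda>x. fst x \<in> hits c \<and> hit_time c (fst x) \<le> snd x)"
    by measurable
  define F where "F n \<omega> t = indicator {0..} t * (if \<omega> \<in> hits c \<and> hit_time c \<omega> \<le> t then 0
       else ennreal (exp (- 0 * t)) * indicator {..<real n} (Z t \<omega>))" for n :: nat and \<omega> t
  have Fsup: "(SUP n. F n \<omega> t) = indicator {0..} t * (if \<omega> \<in> hits c \<and> hit_time c \<omega> \<le> t then 0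
       else ennreal (exp (- 0 * t)) * 1)" for \<omega> t
    unfolding F_def using sup[of "Z t \<omega>"] by (auto simp: SUP_mult_left_ennreal[symmetric] indicator_def[of "{0..}"])
  have Finc: "incseq (\<lambda>n. F n \<omega>)" for \<omega>
    unfolding F_def using incseqD[OF inc] by (auto simp: incseq_def le_fun_def intro!: mult_left_mono)
  have [measurable]: "(\<lambda>(\<omega>, t). F n \<omega> t) \<in> borel_measurable (M \<Otimes>\<^sub>M lborel)" for n
    unfolding F_def by measurable
  have "occupation_before 0 c (\<lambda>_. 1) = (\<integral>\<^sup>+\<omega>. \<integral>\<^sup>+t. (SUP n. F n \<omega> t) \<partial>lborel \<partial>M)"
    by (simp only: occupation_before_def Fsup)
  also have "\<dots> = (\<integral>\<^sup>+\<omega>. (SUP n. \<integral>\<^sup>+t. F n \<omega> t \<partial>lborel) \<partial>M)"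
    by (intro nn_integral_cong nn_integral_monotone_convergence_SUP Finc) simp
  also have "\<dots> = (SUP n. \<integral>\<^sup>+\<omega>. \<integral>\<^sup>+t. F n \<omega> t \<partial>lborel \<partial>M)"
    using Finc by (intro nn_integral_monotone_convergence_SUP)
      (auto simp: incseq_def le_fun_def intro!: nn_integral_mono)
  finally show ?thesis by (simp add: occupation_before_def F_def)
qed

text \<open>The balance bounds the potential from below by the occupation under any height before
  passage; letting the height grow, that occupation exhausts the mean passage time.\<close>

lemma U_interval:
  assumes "0 \<le> c" shows "U (indicator {- c..<0}) = ennreal (c / \<gamma>)"
proof (rule antisym[OF potential_interval_le[OF assms]])
  have "ennreal (c / \<gamma>) \<le> (SUP n. occupation_before 0 c (indicator {..<real n}))"
    using occupation_before_total_ge[OF assms] by (simp add: occupation_before_SUP)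
  also have "\<dots> \<le> U (indicator {- c..<0})"
  proof (rule SUP_least)
    fix n :: nat
    show "occupation_before 0 c (indicator {..<real n}) \<le> U (indicator {- c..<0})"
      unfolding U_interval_balance[OF assms of_nat_0_le_iff[of n]] by simp
  qed
  finally show "ennreal (c / \<gamma>) \<le> U (indicator {- c..<0})" .
qed

text \<open>The mass of the unit interval ending at \<open>w\<close> plays the part of a density at
  \<open>w\<close>, so no absolute continuity has to be proved.\<close>

definition U_window :: "real \<Rightarrow> ennreal" where
  "U_window w = U (indicator {w - 1..<w})"

lemma U_window_nonpos: "w \<le> 0 \<Longrightarrow> U_window w = ennreal (1 / \<gamma>)"
proof -
  assume w: "w \<le> 0"
  have "U_window w = U (\<lambda>y. indicator {w - 1..<w} (y - (- w)))"
    unfolding U_window_def using w by (intro U_shift_eq[symmetric]) (auto simp: indicator_def)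
  also have "\<dots> = U (indicator {- 1..<0})"
    by (intro arg_cong[where f = U]) (auto simp: fun_eq_iff indicator_def)
  finally show ?thesis by (simp add: U_interval)
qed

lemma U_window_shift_le: "a \<le> w \<Longrightarrow> U_window w \<le> U_window a"
proof -
  assume aw: "a \<le> w"
  have "U_window w = U (\<lambda>y. indicator {a - 1..<a} (y - (w - a)))"
    unfolding U_window_def by (intro arg_cong[where f = U]) (auto simp: fun_eq_iff indicator_def)
  also have "\<dots> \<le> U_window a" unfolding U_window_def using aw by (intro U_shift_le) auto
  finally show ?thesis .
qed

lemma U_window_le: "U_window w \<le> ennreal (1 / \<gamma>)"
  using U_window_shift_le[of "min w 0" w] by (simp add: U_window_nonpos)

text \<open>In the balance with \<open>c = 1\<close> the left side is \<open>1 / \<gamma>\<close>,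
  and the occupation below height \<open>n\<close> before passage comes within \<open>e\<close> of
  it; the window above \<open>n\<close> holds the rest. If \<open>1 / \<gamma> \<le> e\<close>, the
  uniform bound already suffices.\<close>

lemma U_window_tendsto_0:
  assumes "0 < e" shows "\<exists>N. \<forall>w\<ge>N. U_window w \<le> ennreal e"
proof -
  have "ennreal (1 / \<gamma> - e) < (SUP n. occupation_before 0 1 (indicator {..<real n})) \<or> 1 / \<gamma> \<le> e"
  proof (cases "1 / \<gamma> \<le> e")
    case False
    then have "ennreal (1 / \<gamma> - e) < ennreal (1 / \<gamma>)" using assms gamma_pos by (intro ennreal_lessI) auto
    with occupation_before_total_ge[of 1] show ?thesis
      by (simp add: occupation_before_SUP less_le_trans)
  qed simp
  then show ?thesis
  proof
    assume "ennreal (1 / \<gamma> - e) < (SUP n. occupation_before 0 1 (indicator {..<real n}))"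
    then obtain n where n: "ennreal (1 / \<gamma> - e) < occupation_before 0 1 (indicator {..<real n})"
      by (auto simp: less_SUP_iff)
    have "ennreal (1 / \<gamma>) = occupation_before 0 1 (indicator {..<real n}) + U (indicator {real n..<real n + 1})"
      using U_interval_balance[of 1 "real n"] U_interval[of 1] by simp
    also have "U (indicator {real n..<real n + 1}) = U_window (real n + 1)" by (simp add: U_window_def)
    finally have eq: "ennreal (1 / \<gamma>) = occupation_before 0 1 (indicator {..<real n}) + U_window (real n + 1)" .
    have "U_window (real n + 1) \<le> ennreal e"
    proof -
      obtain o' where o: "occupation_before 0 1 (indicator {..<real n}) = ennreal o'" "0 \<le> o'"
        using eq by (cases "occupation_before 0 1 (indicator {..<real n})") auto
      obtain u where u: "U_window (real n + 1) = ennreal u" "0 \<le> u"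
        using eq by (cases "U_window (real n + 1)") auto
      have "1 / \<gamma> = o' + u"
        using eq o u gamma_pos by (simp add: ennreal_plus[symmetric] del: ennreal_plus)
      moreover have "1 / \<gamma> - e \<le> o'" using n o by (cases "0 \<le> 1 / \<gamma> - e") (auto simp: ennreal_less_iff)
      ultimately show ?thesis using u by (simp add: ennreal_leI)
    qed
    then show ?thesis using U_window_shift_le order_trans by blast
  next
    assume "1 / \<gamma> \<le> e"
    then show ?thesis using order_trans[OF U_window_le ennreal_leI] by blast
  qed
qed

lemma U_eq: "U f = (\<integral>\<^sup>+\<omega>. \<integral>\<^sup>+t. indicator {0..} t * f (Z t \<omega>) \<partial>lborel \<partial>M)"
  by (simp add: potential_def)

lemma U_eq_time:
  "f \<in> borel_measurable borel \<Longrightarrow> U f = (\<integral>\<^sup>+t. indicator {0..} t * (\<integral>\<^sup>+\<omega>. f (Z t \<omega>) \<partial>M) \<partial>lborel)"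
  by (simp add: potential_eq_time_integral)

lemma measurable_U[measurable (raw)]:
  assumes [measurable]: "(\<lambda>(x, y). G x y) \<in> borel_measurable (N \<Otimes>\<^sub>M borel)"
  shows "(\<lambda>x. U (G x)) \<in> borel_measurable N"
  unfolding U_eq by measurable

lemma U_nn_integral_swap:
  assumes [measurable]: "(\<lambda>(x, y). G x y) \<in> borel_measurable (borel \<Otimes>\<^sub>M borel)"
  shows "U (\<lambda>y. \<integral>\<^sup>+x. G x y \<partial>lborel) = (\<integral>\<^sup>+x. U (G x) \<partial>lborel)"
proof -
  have "U (\<lambda>y. \<integral>\<^sup>+x. G x y \<partial>lborel)
      = (\<integral>\<^sup>+t. indicator {0..} t * (\<integral>\<^sup>+\<omega>. \<integral>\<^sup>+x. G x (Z t \<omega>) \<partial>lborel \<partial>M) \<partial>lborel)"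
    by (rule U_eq_time) measurable
  also have "\<dots> = (\<integral>\<^sup>+t. \<integral>\<^sup>+x. indicator {0..} t * (\<integral>\<^sup>+\<omega>. G x (Z t \<omega>) \<partial>M) \<partial>lborel \<partial>lborel)"
    by (subst time.Fubini'[symmetric]) (auto simp: nn_integral_cmult)
  also have "\<dots> = (\<integral>\<^sup>+x. \<integral>\<^sup>+t. indicator {0..} t * (\<integral>\<^sup>+\<omega>. G x (Z t \<omega>) \<partial>M) \<partial>lborel \<partial>lborel)"
    by (rule lborel_pair.Fubini') measurable
  also have "\<dots> = (\<integral>\<^sup>+x. U (G x) \<partial>lborel)"
    by (intro nn_integral_cong U_eq_time[symmetric]) measurable
  finally show ?thesis .
qed

text \<open>Averaging over the shifts \<open>c\<close> turns information on unit intervals into a density.\<close>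
lemma U_window_average:
  assumes [measurable]: "f \<in> borel_measurable borel"
  shows "(\<integral>\<^sup>+c. indicator {0<..1} c * U (\<lambda>y. f (y + c)) \<partial>lborel) = (\<integral>\<^sup>+w. f w * U_window w \<partial>lborel)"
proof -
  have [measurable]: "(\<lambda>w. indicator {w - 1..<w} y :: ennreal) \<in> borel_measurable borel"
    "(\<lambda>(w, y::real). indicator {w - 1..<w} y :: ennreal) \<in> borel_measurable (borel \<Otimes>\<^sub>M borel)" for y :: real
    unfolding indicator_def atLeastLessThan_iff by measurable
  have "(\<integral>\<^sup>+c. indicator {0<..1} c * U (\<lambda>y. f (y + c)) \<partial>lborel)
      = (\<integral>\<^sup>+c. U (\<lambda>y. indicator {0<..1} c * f (y + c)) \<partial>lborel)"
    by (simp add: potential_cmult)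
  also have "\<dots> = U (\<lambda>y. \<integral>\<^sup>+c. indicator {0<..1} c * f (y + c) \<partial>lborel)"
    by (rule U_nn_integral_swap[symmetric]) measurable
  also have "\<dots> = U (\<lambda>y. \<integral>\<^sup>+w. f w * indicator {w - 1..<w} y \<partial>lborel)"
  proof (rule arg_cong[where f = U], rule ext)
    fix y :: real
    have "(\<integral>\<^sup>+w. f w * indicator {w - 1..<w} y \<partial>lborel)
        = (\<integral>\<^sup>+c. f (y + c) * indicator {y + c - 1..<y + c} y \<partial>lborel)"
      by (subst nn_integral_real_affine[where c = 1 and t = y]) auto
    also have "\<dots> = (\<integral>\<^sup>+c. indicator {0<..1} c * f (y + c) \<partial>lborel)"
      by (intro nn_integral_cong) (auto simp: indicator_def)
    finally show "(\<integral>\<^sup>+c. indicator {0<..1} c * f (y + c) \<partial>lborel) = (\<integral>\<^sup>+w. f w * indicator {w - 1..<w} y \<partial>lborel)" ..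
  qed
  also have "\<dots> = (\<integral>\<^sup>+w. U (\<lambda>y. f w * indicator {w - 1..<w} y) \<partial>lborel)"
    by (rule U_nn_integral_swap) measurable
  also have "\<dots> = (\<integral>\<^sup>+w. f w * U_window w \<partial>lborel)"
    by (simp add: potential_cmult U_window_def)
  finally show ?thesis .
qed

text \<open>Replacing \<open>f\<close> by its translate \<open>f (y + c)\<close> with
  \<open>c\<close> in \<open>{0<..1}\<close> cannot lower the potential, and the average over
  \<open>c\<close> is the window integral.\<close>

lemma U_le_window_integral:
  assumes [measurable]: "f \<in> borel_measurable borel"
  shows "U f \<le> (\<integral>\<^sup>+w. f w * U_window w \<partial>lborel)"
proof -
  have "U f = (\<integral>\<^sup>+c. indicator {0<..1} c * U f \<partial>(lborel :: real measure))"
    by (simp add: nn_integral_multc)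
  also have "\<dots> \<le> (\<integral>\<^sup>+c. indicator {0<..1} c * U (\<lambda>y. f (y + c)) \<partial>lborel)"
  proof (intro nn_integral_mono)
    fix c :: real
    show "indicator {0<..1} c * U f \<le> indicator {0<..1} c * U (\<lambda>y. f (y + c))"
      using U_shift_le[of c "\<lambda>y. f (y + c)"] by (auto simp: indicator_def)
  qed
  finally show ?thesis by (simp add: U_window_average)
qed

lemma U_le_lborel:
  assumes [measurable]: "f \<in> borel_measurable borel"
  shows "U f \<le> ennreal (1 / \<gamma>) * (\<integral>\<^sup>+w. f w \<partial>lborel)"
proof -
  have "U f \<le> (\<integral>\<^sup>+w. f w * U_window w \<partial>lborel)" by (rule U_le_window_integral) measurable
  also have "\<dots> \<le> (\<integral>\<^sup>+w. ennreal (1 / \<gamma>) * f w \<partial>lborel)"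
    using U_window_le by (intro nn_integral_mono) (subst mult.commute, intro mult_right_mono, auto)
  finally show ?thesis by (simp add: nn_integral_cmult)
qed

text \<open>When \<open>f\<close> lives strictly below the starting point, its translate by
  \<open>c\<close> vanishes on \<open>{- c..}\<close>, so every shift preserves the potential and
  the averaging loses nothing.\<close>

lemma U_eq_lborel:
  assumes [measurable]: "f \<in> borel_measurable borel" and zero: "\<And>y. 0 \<le> y \<Longrightarrow> f y = 0"
  shows "U f = ennreal (1 / \<gamma>) * (\<integral>\<^sup>+w. f w \<partial>lborel)"
proof -
  have "U f = (\<integral>\<^sup>+c. indicator {0<..1} c * U f \<partial>(lborel :: real measure))"
    by (simp add: nn_integral_multc)
  also have "\<dots> = (\<integral>\<^sup>+c. indicator {0<..1} c * U (\<lambda>y. f (y + c)) \<partial>lborel)"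
  proof (intro nn_integral_cong)
    fix c :: real
    show "indicator {0<..1} c * U f = indicator {0<..1} c * U (\<lambda>y. f (y + c))"
      using U_shift_eq[of c "\<lambda>y. f (y + c)"] zero by (auto simp: indicator_def)
  qed
  also have "\<dots> = (\<integral>\<^sup>+w. ennreal (1 / \<gamma>) * f w \<partial>lborel)"
    unfolding U_window_average[OF assms(1)]
  proof (intro nn_integral_cong)
    fix w
    show "f w * U_window w = ennreal (1 / \<gamma>) * f w"
      using zero[of w] U_window_nonpos[of w] by (cases "0 \<le> w") (auto simp: mult.commute)
  qed
  finally show ?thesis by (simp add: nn_integral_cmult)
qed

subsection \<open>Moments of the clock\<close>

definition occupation :: "(real \<Rightarrow> ennreal) \<Rightarrow> 'a \<Rightarrow> ennreal" where
  "occupation f \<omega> = (\<integral>\<^sup>+t. indicator {0..} t * f (Z t \<omega>) \<partial>lborel)"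

text \<open>The square is a double integral over two times; the two orderings contribute equally,
  and counting the diagonal in both only enlarges the bound. The later time is then written as the
  earlier one plus a delay.\<close>

lemma occupation_square_le:
  assumes [measurable]: "f \<in> borel_measurable borel" and \<omega>: "\<omega> \<in> space M"
  shows "(occupation f \<omega>)\<^sup>2 \<le> 2 * (\<integral>\<^sup>+s. \<integral>\<^sup>+u. indicator {0..} s * (indicator {0..} u * (f (Z s \<omega>) * f (Z (s + u) \<omega>))) \<partial>lborel \<partial>lborel)"
proof -
  note measurable_Z_time[OF \<omega>, measurable]
  define a where "a t = indicator {0..} t * f (Z t \<omega>)" for t
  have [measurable]: "a \<in> borel_measurable borel" unfolding a_def by measurable
  have "(occupation f \<omega>)\<^sup>2 = (\<integral>\<^sup>+s. \<integral>\<^sup>+t. a s * a t \<partial>lborel \<partial>lborel)"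
    unfolding occupation_def a_def[symmetric] power2_eq_square
    by (simp add: nn_integral_cmult nn_integral_multc)
  also have "\<dots> \<le> (\<integral>\<^sup>+s. \<integral>\<^sup>+t. indicator {s..} t * (a s * a t) + indicator {t..} s * (a s * a t) \<partial>lborel \<partial>lborel)"
    by (intro nn_integral_mono) (auto simp: indicator_def)
  also have "\<dots> = (\<integral>\<^sup>+s. \<integral>\<^sup>+t. indicator {s..} t * (a s * a t) \<partial>lborel \<partial>lborel)
      + (\<integral>\<^sup>+s. \<integral>\<^sup>+t. indicator {t..} s * (a s * a t) \<partial>lborel \<partial>lborel)"
    unfolding indicator_def atLeast_iff by (simp add: nn_integral_add)
  also have "(\<integral>\<^sup>+s. \<integral>\<^sup>+t. indicator {t..} s * (a s * a t) \<partial>lborel \<partial>lborel)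
      = (\<integral>\<^sup>+s. \<integral>\<^sup>+t. indicator {s..} t * (a s * a t) \<partial>lborel \<partial>lborel)"
    unfolding indicator_def atLeast_iff
    by (subst lborel_pair.Fubini') (auto simp: mult.commute)
  also have "(\<integral>\<^sup>+s. \<integral>\<^sup>+t. indicator {s..} t * (a s * a t) \<partial>lborel \<partial>lborel)
      = (\<integral>\<^sup>+s. \<integral>\<^sup>+u. indicator {0..} s * (indicator {0..} u * (f (Z s \<omega>) * f (Z (s + u) \<omega>))) \<partial>lborel \<partial>lborel)"
  proof (rule nn_integral_cong)
    fix s :: real
    have "(\<integral>\<^sup>+t. indicator {s..} t * (a s * a t) \<partial>lborel) = (\<integral>\<^sup>+u. indicator {s..} (s + u) * (a s * a (s + u)) \<partial>lborel)"
      by (subst nn_integral_real_affine[where c = 1 and t = s]) auto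
    also have "\<dots> = (\<integral>\<^sup>+u. indicator {0..} s * (indicator {0..} u * (f (Z s \<omega>) * f (Z (s + u) \<omega>))) \<partial>lborel)"
      by (intro nn_integral_cong) (auto simp: indicator_def a_def)
    finally show "(\<integral>\<^sup>+t. indicator {s..} t * (a s * a t) \<partial>lborel) = \<dots>" .
  qed
  finally show ?thesis by (simp add: mult_2)
qed

text \<open>A form of Kac's moment formula: conditioning on the position at the earlier time makes
  the inner integral the potential started from that position.\<close>

lemma nn_integral_occupation_square_le:
  assumes [measurable]: "f \<in> borel_measurable borel"
  shows "(\<integral>\<^sup>+\<omega>. (occupation f \<omega>)\<^sup>2 \<partial>M) \<le> 2 * U (\<lambda>y. f y * U (\<lambda>z. f (y + z)))"
proof -
  have "(\<integral>\<^sup>+\<omega>. (occupation f \<omega>)\<^sup>2 \<partial>M)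
      \<le> (\<integral>\<^sup>+\<omega>. 2 * (\<integral>\<^sup>+s. \<integral>\<^sup>+u. indicator {0..} s * (indicator {0..} u * (f (Z s \<omega>) * f (Z (s + u) \<omega>))) \<partial>lborel \<partial>lborel) \<partial>M)"
    by (intro nn_integral_mono occupation_square_le) auto
  also have "\<dots> = 2 * (\<integral>\<^sup>+s. \<integral>\<^sup>+\<omega>. \<integral>\<^sup>+u. indicator {0..} s * (indicator {0..} u * (f (Z s \<omega>) * f (Z (s + u) \<omega>))) \<partial>lborel \<partial>M \<partial>lborel)"
    by (subst nn_integral_cmult, measurable) (intro arg_cong[where f = "(*) 2"] time.Fubini'[symmetric], measurable)
  also have "(\<integral>\<^sup>+s. \<integral>\<^sup>+\<omega>. \<integral>\<^sup>+u. indicator {0..} s * (indicator {0..} u * (f (Z s \<omega>) * f (Z (s + u) \<omega>))) \<partial>lborel \<partial>M \<partial>lborel)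
      = (\<integral>\<^sup>+s. indicator {0..} s * (\<integral>\<^sup>+\<omega>. f (Z s \<omega>) * U (\<lambda>z. f (Z s \<omega> + z)) \<partial>M) \<partial>lborel)"
  proof (intro nn_integral_cong)
    fix s :: real
    show "(\<integral>\<^sup>+\<omega>. \<integral>\<^sup>+u. indicator {0..} s * (indicator {0..} u * (f (Z s \<omega>) * f (Z (s + u) \<omega>))) \<partial>lborel \<partial>M)
      = indicator {0..} s * (\<integral>\<^sup>+\<omega>. f (Z s \<omega>) * U (\<lambda>z. f (Z s \<omega> + z)) \<partial>M)"
    proof (cases "0 \<le> s")
      case True
      have "(\<integral>\<^sup>+\<omega>. \<integral>\<^sup>+u. indicator {0..} u * (f (Z s \<omega>) * f (Z (s + u) \<omega>)) \<partial>lborel \<partial>M)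
          = (\<integral>\<^sup>+u. \<integral>\<^sup>+\<omega>. indicator {0..} u * (f (Z s \<omega>) * f (Z (s + u) \<omega>)) \<partial>M \<partial>lborel)"
        by (rule time.Fubini'[symmetric]) measurable
      also have "\<dots> = (\<integral>\<^sup>+u. \<integral>\<^sup>+\<omega>. indicator {0..} u * (f (Z s \<omega>) * (\<integral>\<^sup>+\<omega>'. f (Z s \<omega> + Z u \<omega>') \<partial>M)) \<partial>M \<partial>lborel)"
      proof (rule nn_integral_cong)
        fix u :: real
        have "(\<integral>\<^sup>+\<omega>. f (Z s \<omega>) * f (Z (s + u) \<omega>) \<partial>M) = (\<integral>\<^sup>+\<omega>. f (Z s \<omega>) * (\<integral>\<^sup>+\<omega>'. f (Z s \<omega> + Z u \<omega>') \<partial>M) \<partial>M)"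
          if "0 \<le> u"
          using nn_integral_Markov[OF True that, of "\<lambda>(x, d). f x * f (x + d)"]
          by (simp add: nn_integral_cmult)
        then show "(\<integral>\<^sup>+\<omega>. indicator {0..} u * (f (Z s \<omega>) * f (Z (s + u) \<omega>)) \<partial>M)
            = (\<integral>\<^sup>+\<omega>. indicator {0..} u * (f (Z s \<omega>) * (\<integral>\<^sup>+\<omega>'. f (Z s \<omega> + Z u \<omega>') \<partial>M)) \<partial>M)"
          by (cases "0 \<le> u") simp_all
      qed
      also have "\<dots> = (\<integral>\<^sup>+\<omega>. \<integral>\<^sup>+u. f (Z s \<omega>) * (indicator {0..} u * (\<integral>\<^sup>+\<omega>'. f (Z s \<omega> + Z u \<omega>') \<partial>M)) \<partial>lborel \<partial>M)"
        by (subst time.Fubini') (auto simp: mult_ac)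
      also have "\<dots> = (\<integral>\<^sup>+\<omega>. f (Z s \<omega>) * U (\<lambda>z. f (Z s \<omega> + z)) \<partial>M)"
        by (intro nn_integral_cong) (simp add: U_eq_time nn_integral_cmult)
      finally show ?thesis using True by simp
    qed simp
  qed
  also have "\<dots> = U (\<lambda>y. f y * U (\<lambda>z. f (y + z)))"
    by (rule U_eq_time[symmetric]) measurable
  finally show ?thesis .
qed

text \<open>Up to distance \<open>N\<close> above the start the density is bounded by
  \<open>1 / \<gamma>\<close>, beyond it by \<open>e\<close>. The distance depends neither on
  \<open>g\<close> nor on the starting level.\<close>

lemma U_nonneg_part_le:
  assumes "0 < e"
  shows "\<exists>N\<ge>0. \<forall>g v. g \<in> borel_measurable borel \<longrightarrow>
    U (\<lambda>z. indicator {0..} z * g (v + z)) \<le> ennreal (1 / \<gamma>) * (\<integral>\<^sup>+w. indicator {v..<v + N} w * g w \<partial>lborel)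
       + ennreal e * (\<integral>\<^sup>+w. indicator {v..} w * g w \<partial>lborel)"
proof -
  obtain N0 where N0: "\<And>w. N0 \<le> w \<Longrightarrow> U_window w \<le> ennreal e" using U_window_tendsto_0[OF assms] by blast
  define N where "N = max 0 N0"
  have "U (\<lambda>z. indicator {0..} z * g (v + z)) \<le> ennreal (1 / \<gamma>) * (\<integral>\<^sup>+w. indicator {v..<v + N} w * g w \<partial>lborel)
       + ennreal e * (\<integral>\<^sup>+w. indicator {v..} w * g w \<partial>lborel)" if [measurable]: "g \<in> borel_measurable borel" for g v
  proof -
    have "U (\<lambda>z. indicator {0..} z * g (v + z)) \<le> (\<integral>\<^sup>+z. indicator {0..} z * g (v + z) * U_window z \<partial>lborel)"
      by (rule U_le_window_integral) measurable
    also have "\<dots> \<le> (\<integral>\<^sup>+z. ennreal (1 / \<gamma>) * (indicator {v..<v + N} (v + z) * g (v + z))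
        + ennreal e * (indicator {v..} (v + z) * g (v + z)) \<partial>lborel)"
    proof (rule nn_integral_mono)
      fix z :: real
      consider "z < 0" | "0 \<le> z" "z < N" | "0 \<le> z" "N \<le> z" by linarith
      then show "indicator {0..} z * g (v + z) * U_window z \<le> ennreal (1 / \<gamma>) * (indicator {v..<v + N} (v + z) * g (v + z))
        + ennreal e * (indicator {v..} (v + z) * g (v + z))"
      proof cases
        case 2
        have "g (v + z) * U_window z \<le> g (v + z) * ennreal (1 / \<gamma>)" by (intro mult_left_mono U_window_le) auto
        then show ?thesis using 2 by (simp add: mult.commute add_increasing2)
      next
        case 3
        have "g (v + z) * U_window z \<le> g (v + z) * ennreal e" using 3 by (intro mult_left_mono N0) (auto simp: N_def)
        then show ?thesis using 3 by (simp add: mult.commute)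
      qed simp
    qed
    also have "\<dots> = (\<integral>\<^sup>+w. ennreal (1 / \<gamma>) * (indicator {v..<v + N} w * g w) + ennreal e * (indicator {v..} w * g w) \<partial>lborel)"
      by (rule nn_integral_lborel_shift) measurable
    also have "\<dots> = ennreal (1 / \<gamma>) * (\<integral>\<^sup>+w. indicator {v..<v + N} w * g w \<partial>lborel)
       + ennreal e * (\<integral>\<^sup>+w. indicator {v..} w * g w \<partial>lborel)"
      by (simp add: nn_integral_add nn_integral_cmult)
    finally show ?thesis .
  qed
  then show ?thesis by (intro exI[of _ N]) (auto simp: N_def)
qed

text \<open>With \<open>f y = g (x + y)\<close> and \<open>g\<close> the reciprocal rate, this is
  the time that the time-changed process started at \<open>x\<close> needs to descend by
  \<open>c\<close>.\<close>

definition clock :: "(real \<Rightarrow> ennreal) \<Rightarrow> real \<Rightarrow> 'a \<Rightarrow> ennreal" where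
  "clock f c \<omega> = (\<integral>\<^sup>+t. indicator {0..} t * (if \<omega> \<in> hits c \<and> hit_time c \<omega> \<le> t then 0 else f (Z t \<omega>)) \<partial>lborel)"

lemma measurable_clock[measurable]:
  assumes [measurable]: "f \<in> borel_measurable borel"
  shows "clock f c \<in> borel_measurable M"
  unfolding clock_def by measurable

lemma clock_le_occupation: "clock f c \<omega> \<le> occupation f \<omega>"
  unfolding clock_def occupation_def by (intro nn_integral_mono) (auto intro!: mult_left_mono)

lemma nn_integral_clock: "(\<integral>\<^sup>+\<omega>. clock f c \<omega> \<partial>M) = occupation_before 0 c f"
  by (simp add: clock_def occupation_before_def cong: if_cong)

text \<open>Here \<open>F\<close> stands for the mean of the clock when the start tends to infinity.\<close>
lemma clock_second_moment_le:
  fixes g :: "real \<Rightarrow> ennreal"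
  assumes [measurable]: "g \<in> borel_measurable borel" and g0: "\<And>y. y < b \<Longrightarrow> g y = 0"
    and F: "ennreal (1 / \<gamma>) * (\<integral>\<^sup>+w. g w \<partial>lborel) = ennreal F" "0 \<le> F"
    and \<epsilon>: "0 \<le> \<epsilon>" "\<And>v. b \<le> v \<Longrightarrow> U (\<lambda>z. indicator {0..} z * g (v + z)) \<le> ennreal (\<epsilon> * F)"
  shows "(\<integral>\<^sup>+\<omega>. (clock (\<lambda>y. g (x + y)) c \<omega>)\<^sup>2 \<partial>M) \<le> ennreal ((1 + 2 * \<epsilon>) * F\<^sup>2)"
proof -
  let ?k = "ennreal (1 / \<gamma>)"
  let ?T = "\<lambda>v. \<integral>\<^sup>+w. indicator {..<v} w * g w \<partial>lborel"
  have meas[measurable]: "?T \<in> borel_measurable borel"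
    unfolding indicator_def lessThan_iff by measurable
  \<comment> \<open>Below \<open>v\<close> the potential started at \<open>v\<close> has density
    exactly \<open>1 / \<gamma>\<close>; the part above \<open>v\<close> is the hypothesis with
    \<epsilon>.\<close>
  have g_U: "g v * U (\<lambda>z. g (v + z)) \<le> g v * (?k * ?T v + ennreal (\<epsilon> * F))" for v
  proof (cases "v < b")
    case False
    have "U (\<lambda>z. g (v + z)) = U (\<lambda>z. indicator {..<0} z * g (v + z) + indicator {0..} z * g (v + z))"
      by (intro arg_cong[where f = U]) (auto simp: fun_eq_iff indicator_def)
    also have "\<dots> = U (\<lambda>z. indicator {..<0} z * g (v + z)) + U (\<lambda>z. indicator {0..} z * g (v + z))"
      by (rule potential_add) measurable
    also have "U (\<lambda>z. indicator {..<0} z * g (v + z)) = ?k * (\<integral>\<^sup>+z. indicator {..<v} (v + z) * g (v + z) \<partial>lborel)"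
      by (subst U_eq_lborel) (auto simp: indicator_def)
    also have "(\<integral>\<^sup>+z. indicator {..<v} (v + z) * g (v + z) \<partial>lborel) = ?T v"
      by (rule nn_integral_lborel_shift) measurable
    finally show ?thesis using \<epsilon>(2)[of v] False by (auto intro!: mult_left_mono add_left_mono)
  qed (simp add: g0)
  \<comment> \<open>Continuing the clock beyond passage is harmless: the added occupation comes from
    excursions back above \<open>b\<close>, already covered by the \<epsilon> term.\<close>
  have "(\<integral>\<^sup>+\<omega>. (clock (\<lambda>y. g (x + y)) c \<omega>)\<^sup>2 \<partial>M) \<le> (\<integral>\<^sup>+\<omega>. (occupation (\<lambda>y. g (x + y)) \<omega>)\<^sup>2 \<partial>M)"
    by (intro nn_integral_mono power_mono clock_le_occupation) auto
  also have "\<dots> \<le> 2 * U (\<lambda>y. g (x + y) * U (\<lambda>z. g (x + (y + z))))"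
    by (rule nn_integral_occupation_square_le) measurable
  also have "\<dots> \<le> 2 * (?k * (\<integral>\<^sup>+y. g (x + y) * U (\<lambda>z. g (x + (y + z))) \<partial>lborel))"
    by (intro mult_left_mono U_le_lborel) measurable
  also have "(\<integral>\<^sup>+y. g (x + y) * U (\<lambda>z. g (x + (y + z))) \<partial>lborel)
      = (\<integral>\<^sup>+y. (\<lambda>v. g v * U (\<lambda>z. g (v + z))) (x + y) \<partial>lborel)" by (simp add: add.assoc)
  also have "\<dots> = (\<integral>\<^sup>+v. g v * U (\<lambda>z. g (v + z)) \<partial>lborel)"
    by (rule nn_integral_lborel_shift) measurable
  also have "2 * (?k * (\<integral>\<^sup>+v. g v * U (\<lambda>z. g (v + z)) \<partial>lborel))
      \<le> 2 * (?k * (\<integral>\<^sup>+v. g v * (?k * ?T v + ennreal (\<epsilon> * F)) \<partial>lborel))"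
    by (intro mult_left_mono nn_integral_mono g_U) auto
  also have "(\<integral>\<^sup>+v. g v * (?k * ?T v + ennreal (\<epsilon> * F)) \<partial>lborel)
      = (\<integral>\<^sup>+v. ?k * (g v * ?T v) + ennreal (\<epsilon> * F) * g v \<partial>lborel)"
    by (simp add: distrib_left mult_ac)
  also have "\<dots> = ?k * (\<integral>\<^sup>+v. g v * ?T v \<partial>lborel) + ennreal (\<epsilon> * F) * (\<integral>\<^sup>+v. g v \<partial>lborel)"
    by (simp add: nn_integral_add nn_integral_cmult)
  also have "2 * (?k * (?k * (\<integral>\<^sup>+v. g v * ?T v \<partial>lborel) + ennreal (\<epsilon> * F) * (\<integral>\<^sup>+v. g v \<partial>lborel)))
      = ?k * ?k * (2 * (\<integral>\<^sup>+v. g v * ?T v \<partial>lborel)) + 2 * ennreal (\<epsilon> * F) * (?k * (\<integral>\<^sup>+v. g v \<partial>lborel))"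
    by (simp add: distrib_left mult_ac)
  also have "\<dots> \<le> ?k * ?k * (\<integral>\<^sup>+v. g v \<partial>lborel)\<^sup>2 + 2 * ennreal (\<epsilon> * F) * ennreal F"
    unfolding F by (intro add_right_mono mult_left_mono nn_integral_triangle_le) auto
  also have "?k * ?k * (\<integral>\<^sup>+v. g v \<partial>lborel)\<^sup>2 = (?k * (\<integral>\<^sup>+v. g v \<partial>lborel))\<^sup>2"
    by (simp only: power2_eq_square mult_ac)
  also have "\<dots> + 2 * ennreal (\<epsilon> * F) * ennreal F = ennreal ((1 + 2 * \<epsilon>) * F\<^sup>2)"
  proof -
    have "(2 :: ennreal) = ennreal 2" by simp
    then show ?thesis unfolding F(1) using F(2) \<epsilon>(1)
      by (simp only: ennreal_power ennreal_mult[symmetric] ennreal_plus[symmetric] mult_nonneg_nonneg zero_le_numeral zero_le_power)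
         (simp add: algebra_simps power2_eq_square)
  qed
  finally show ?thesis .
qed

text \<open>The full occupation from \<open>x\<close> contains at least the mass of the levels below
  \<open>x\<close>, so \<delta> pays for the tail above \<open>x\<close>. After passage the process
  restarts at \<open>b\<close>, and what it still collects is at most
  \<open>\<epsilon> * F\<close>.\<close>

lemma clock_first_moment_ge:
  fixes g :: "real \<Rightarrow> ennreal"
  assumes [measurable]: "g \<in> borel_measurable borel" and g0: "\<And>y. y < b \<Longrightarrow> g y = 0" and bx: "b \<le> x"
    and F: "ennreal (1 / \<gamma>) * (\<integral>\<^sup>+w. g w \<partial>lborel) = ennreal F" "0 \<le> F"
    and \<epsilon>: "0 \<le> \<epsilon>" "\<And>v. b \<le> v \<Longrightarrow> U (\<lambda>z. indicator {0..} z * g (v + z)) \<le> ennreal (\<epsilon> * F)"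
    and \<delta>: "0 \<le> \<delta>" "ennreal (1 / \<gamma>) * (\<integral>\<^sup>+w. indicator {x..} w * g w \<partial>lborel) \<le> ennreal \<delta>"
  shows "ennreal F \<le> (\<integral>\<^sup>+\<omega>. clock (\<lambda>y. g (x + y)) (x - b) \<omega> \<partial>M) + ennreal (\<epsilon> * F + \<delta>)"
proof -
  let ?k = "ennreal (1 / \<gamma>)"
  let ?T = "\<integral>\<^sup>+w. indicator {..<x} w * g w \<partial>lborel"
  have "?k * ?T = U (\<lambda>y. indicator {..<x} (x + y) * g (x + y))"
    by (subst U_eq_lborel) (auto simp: nn_integral_lborel_shift[of "\<lambda>w. indicator {..<x} w * g w"])
  also have "\<dots> \<le> U (\<lambda>y. g (x + y))"
    by (rule potential_mono) (auto simp: indicator_def)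
  also have "\<dots> = occupation_before 0 (x - b) (\<lambda>y. g (x + y)) + U (\<lambda>y. g (x + (y - (x - b))))"
    using bx by (intro U_split) auto
  \<comment> \<open>Since \<open>g\<close> vanishes below \<open>b\<close>, a path restarted at
    \<open>b\<close> collects only at nonnegative displacements; this is the hypothesis at
    \<open>v = b\<close>.\<close>
  also have "(\<lambda>y. g (x + (y - (x - b)))) = (\<lambda>z. indicator {0..} z * g (b + z))"
    using g0 by (auto simp: fun_eq_iff indicator_def add.commute)
  also have "occupation_before 0 (x - b) (\<lambda>y. g (x + y)) + U (\<lambda>z. indicator {0..} z * g (b + z))
      \<le> occupation_before 0 (x - b) (\<lambda>y. g (x + y)) + ennreal (\<epsilon> * F)"
    using \<epsilon>(2)[of b] by (intro add_left_mono) auto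
  finally have le: "?k * ?T \<le> (\<integral>\<^sup>+\<omega>. clock (\<lambda>y. g (x + y)) (x - b) \<omega> \<partial>M) + ennreal (\<epsilon> * F)"
    by (simp add: nn_integral_clock)
  have "ennreal F = ?k * (\<integral>\<^sup>+w. indicator {..<x} w * g w + indicator {x..} w * g w \<partial>lborel)"
    unfolding F(1)[symmetric] by (intro arg_cong[where f = "\<lambda>a. ?k * a"] nn_integral_cong) (auto simp: indicator_def)
  also have "\<dots> = ?k * ?T + ?k * (\<integral>\<^sup>+w. indicator {x..} w * g w \<partial>lborel)"
    by (simp add: nn_integral_add distrib_left)
  also have "\<dots> \<le> ((\<integral>\<^sup>+\<omega>. clock (\<lambda>y. g (x + y)) (x - b) \<omega> \<partial>M) + ennreal (\<epsilon> * F)) + ennreal \<delta>"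
    using le \<delta>(2) by (rule add_mono)
  finally show ?thesis using F \<epsilon> \<delta> by (simp add: add.assoc)
qed

text \<open>Expanding the square gives \<open>(1 + 2 * \<epsilon>) * F\<^sup>2 + F\<^sup>2 - 2 * F *
  (F - \<epsilon> * F - \<delta>)\<close>: the leading terms cancel, leaving
  \<open>4 * \<epsilon> * F\<^sup>2 + 2 * F * \<delta>\<close>.\<close>

lemma clock_deviation_le:
  fixes g :: "real \<Rightarrow> ennreal"
  assumes g[measurable]: "g \<in> borel_measurable borel" and g0: "\<And>y. y < b \<Longrightarrow> g y = 0" and bx: "b \<le> x"
    and F: "ennreal (1 / \<gamma>) * (\<integral>\<^sup>+w. g w \<partial>lborel) = ennreal F" "0 \<le> F"
    and \<epsilon>: "0 \<le> \<epsilon>" "\<And>v. b \<le> v \<Longrightarrow> U (\<lambda>z. indicator {0..} z * g (v + z)) \<le> ennreal (\<epsilon> * F)"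
    and \<delta>: "0 \<le> \<delta>" "ennreal (1 / \<gamma>) * (\<integral>\<^sup>+w. indicator {x..} w * g w \<partial>lborel) \<le> ennreal \<delta>"
  shows "AE \<omega> in M. clock (\<lambda>y. g (x + y)) (x - b) \<omega> < \<infinity>"
    and "(\<integral>\<^sup>+\<omega>. ennreal ((enn2real (clock (\<lambda>y. g (x + y)) (x - b) \<omega>) - F)\<^sup>2) \<partial>M) \<le> ennreal (4 * \<epsilon> * F\<^sup>2 + 2 * F * \<delta>)"
proof -
  let ?A = "clock (\<lambda>y. g (x + y)) (x - b)" and ?a = "\<lambda>\<omega>. enn2real (clock (\<lambda>y. g (x + y)) (x - b) \<omega>)"
  have second: "(\<integral>\<^sup>+\<omega>. (?A \<omega>)\<^sup>2 \<partial>M) \<le> ennreal ((1 + 2 * \<epsilon>) * F\<^sup>2)"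
    by (rule clock_second_moment_le[OF g g0 F \<epsilon>])
  have "AE \<omega> in M. (?A \<omega>)\<^sup>2 \<noteq> \<infinity>"
    using le_less_trans[OF second ennreal_less_top] by (intro nn_integral_noteq_infinite) auto
  then show fin: "AE \<omega> in M. ?A \<omega> < \<infinity>"
    by eventually_elim (auto simp: less_top power2_eq_square ennreal_mult_eq_top_iff)
  have A_eq: "AE \<omega> in M. ?A \<omega> = ennreal (?a \<omega>)" using fin by eventually_elim simp
  have "(\<integral>\<^sup>+\<omega>. ennreal ((?a \<omega>)\<^sup>2) \<partial>M) = (\<integral>\<^sup>+\<omega>. (?A \<omega>)\<^sup>2 \<partial>M)"
    using A_eq by (intro nn_integral_cong_AE, eventually_elim) (metis ennreal_power enn2real_nonneg)
  then have a2: "(\<integral>\<^sup>+\<omega>. ennreal ((?a \<omega>)\<^sup>2) \<partial>M) \<le> ennreal ((1 + 2 * \<epsilon>) * F\<^sup>2)" using second by simp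
  have int2: "integrable M (\<lambda>\<omega>. (?a \<omega>)\<^sup>2)"
    using le_less_trans[OF a2 ennreal_less_top] by (intro integrableI_nonneg) auto
  then have int1: "integrable M ?a" by (rule square_integrable_imp_integrable[rotated]) measurable
  have E2: "expectation (\<lambda>\<omega>. (?a \<omega>)\<^sup>2) \<le> (1 + 2 * \<epsilon>) * F\<^sup>2"
    using a2 \<epsilon>(1) F(2) by (subst (asm) nn_integral_eq_integral[OF int2]) (auto simp: ennreal_le_iff)
  have "(\<integral>\<^sup>+\<omega>. ?A \<omega> \<partial>M) = (\<integral>\<^sup>+\<omega>. ennreal (?a \<omega>) \<partial>M)" by (rule nn_integral_cong_AE[OF A_eq])
  also have "\<dots> = ennreal (expectation ?a)" by (rule nn_integral_eq_integral[OF int1]) simp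
  finally have "ennreal F \<le> ennreal (expectation ?a) + ennreal (\<epsilon> * F + \<delta>)"
    using clock_first_moment_ge[OF g g0 bx F \<epsilon> \<delta>] by simp
  then have "ennreal F \<le> ennreal (expectation ?a + (\<epsilon> * F + \<delta>))"
    using \<epsilon>(1) F(2) \<delta>(1) by (subst ennreal_plus) (auto intro!: Bochner_Integration.integral_nonneg)
  moreover have "0 \<le> expectation ?a + (\<epsilon> * F + \<delta>)"
    using \<epsilon>(1) F(2) \<delta>(1) by (auto intro!: add_nonneg_nonneg Bochner_Integration.integral_nonneg)
  ultimately have E1: "F \<le> expectation ?a + (\<epsilon> * F + \<delta>)" by (simp add: ennreal_le_iff)
  have "(\<integral>\<^sup>+\<omega>. ennreal ((?a \<omega> - F)\<^sup>2) \<partial>M) = ennreal (expectation (\<lambda>\<omega>. (?a \<omega> - F)\<^sup>2))"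
  proof (rule nn_integral_eq_integral)
    show "integrable M (\<lambda>\<omega>. (?a \<omega> - F)\<^sup>2)" unfolding power2_diff using int1 int2 by simp
  qed simp
  also have "expectation (\<lambda>\<omega>. (?a \<omega> - F)\<^sup>2) = expectation (\<lambda>\<omega>. (?a \<omega>)\<^sup>2) + F\<^sup>2 - 2 * F * expectation ?a"
    using int1 int2 by (simp add: power2_diff prob_space mult_ac)
  also have "\<dots> \<le> (1 + 2 * \<epsilon>) * F\<^sup>2 + F\<^sup>2 - 2 * F * (F - (\<epsilon> * F + \<delta>))"
  proof -
    have "F * (F - (\<epsilon> * F + \<delta>)) \<le> F * expectation ?a" using E1 F(2) by (intro mult_left_mono) auto
    then show ?thesis using E2 by linarith
  qed
  also have "\<dots> = 4 * \<epsilon> * F\<^sup>2 + 2 * F * \<delta>" by (simp add: algebra_simps power2_eq_square)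
  finally show "(\<integral>\<^sup>+\<omega>. ennreal ((?a \<omega> - F)\<^sup>2) \<partial>M) \<le> ennreal (4 * \<epsilon> * F\<^sup>2 + 2 * F * \<delta>)"
    by (simp add: ennreal_leI)
qed

end

subsection \<open>The time change\<close>

text \<open>The rate is continuous on the half-line only; clamping its argument gives a function
  that is continuous everywhere.\<close>

lemma borel_measurable_continuous_max:
  fixes R :: "real \<Rightarrow> real"
  assumes "continuous_on {0..} R" shows "(\<lambda>x. R (max 0 x)) \<in> borel_measurable borel"
  by (intro borel_measurable_continuous_onI continuous_on_compose2[OF assms])
     (auto intro!: continuous_intros)

lemma tau0_cong: "(\<And>s. 0 \<le> s \<Longrightarrow> z s = z' s) \<Longrightarrow> tau0 z = tau0 z'"
  unfolding tau0_def by (intro arg_cong[where f = Inf]) auto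

lemma eta_cong: "(\<And>s. 0 \<le> s \<Longrightarrow> z s = z' s) \<Longrightarrow> eta R z s = eta R z' s"
proof -
  assume eq: "\<And>s. 0 \<le> s \<Longrightarrow> z s = z' s"
  have tau: "tau0 z = tau0 z'" by (rule tau0_cong) (rule eq)
  show ?thesis
    unfolding eta_def tau
  proof (rule nn_integral_cong)
    fix r :: real
    show "indicator {0..s} r * indicator {r. ereal r < tau0 z'} r * inverse (ennreal (R (z r)))
        = indicator {0..s} r * indicator {r. ereal r < tau0 z'} r * inverse (ennreal (R (z' r)))"
      using eq[of r] by (cases "0 \<le> r") simp_all
  qed
qed

lemma tau0_nonneg: "0 \<le> tau0 z"
  unfolding tau0_def by (auto intro!: Inf_greatest)

lemma eta_inv_nonneg: "0 \<le> eta_inv R z t"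
  unfolding eta_inv_def by (auto intro!: Inf_greatest)

lemma Xpath_cong:
  assumes "\<And>s. 0 \<le> s \<Longrightarrow> z s = z' s" shows "Xpath R z t = Xpath R z' t"
proof -
  have "eta R z s = eta R z' s" for s by (rule eta_cong) (rule assms)
  then have "eta_inv R z t = eta_inv R z' t" by (simp only: eta_inv_def)
  moreover have "tau0 z = tau0 z'" by (rule tau0_cong) (rule assms)
  moreover have "0 \<le> real_of_ereal (min (eta_inv R z' t) (tau0 z'))"
    using tau0_nonneg eta_inv_nonneg by (intro real_of_ereal_pos) simp
  ultimately show ?thesis by (simp only: Xpath_def assms)
qed

lemma eta_mono: "s \<le> s' \<Longrightarrow> eta R z s \<le> eta R z s'"
  unfolding eta_def by (intro nn_integral_mono mult_right_mono) (auto simp: indicator_def)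

text \<open>An infimum over countably many times, so that it can be reached from finite-dimensional
  laws; the empty infimum is infinite.\<close>

definition first_below :: "(real \<Rightarrow> real) \<Rightarrow> real \<Rightarrow> ennreal" where
  "first_below p b = (INF q\<in>{q::rat. 0 \<le> q \<and> p (of_rat q) < b}. ennreal (of_rat q))"

text \<open>Before clock time \<open>A\<close> the inverse clock stays before \<open>T\<close>,
  where the path is at least \<open>b\<close>. Just after \<open>T\<close> the rate is bounded
  between positive constants, so the clock advances strictly yet by little while the path is below
  \<open>b\<close>; a rational clock time falls into that advance.\<close>

lemma first_below_Xpath:
  fixes z R :: "real \<Rightarrow> real"
  assumes rc: "\<And>t. 0 \<le> t \<Longrightarrow> (z \<longlongrightarrow> z t) (at_right t)"
    and z_meas[measurable]: "z \<in> borel_measurable borel"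
    and R_cont: "continuous_on {0..} R" and R_pos: "\<And>x. 0 < x \<Longrightarrow> 0 < R x"
    and b: "0 < b" and T: "0 \<le> T" "z T = b"
    and before: "\<And>t. 0 \<le> t \<Longrightarrow> t < T \<Longrightarrow> b \<le> z t"
    and after: "\<And>d. 0 < d \<Longrightarrow> \<exists>t. T \<le> t \<and> t < T + d \<and> z t < b"
    and A: "A = (\<integral>\<^sup>+r. indicator {0..<T} r * inverse (ennreal (R (z r))) \<partial>lborel)" "A < \<infinity>"
  shows "first_below (Xpath R z) b = A"
proof -
  \<comment> \<open>On this interval the path stays away from 0 and bounded, so the stopping at
    \<open>tau0\<close> does not interfere and the rate is comparable to a constant.\<close>
  obtain e where e: "0 < e" "\<And>r. T \<le> r \<Longrightarrow> r < T + e \<Longrightarrow> b / 2 < z r \<and> z r < b + 1"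
  proof -
    have "\<forall>\<^sub>F r in at_right T. b / 2 < z r \<and> z r < b + 1"
    proof (rule eventually_conj)
      show "\<forall>\<^sub>F r in at_right T. b / 2 < z r"
        using b T by (intro order_tendstoD(1)[OF rc[OF T(1)]]) simp
      show "\<forall>\<^sub>F r in at_right T. z r < b + 1"
        using b T by (intro order_tendstoD(2)[OF rc[OF T(1)]]) simp
    qed
    then obtain c where c: "T < c" "\<And>r. T < r \<Longrightarrow> r < c \<Longrightarrow> b / 2 < z r \<and> z r < b + 1"
      unfolding eventually_at_right_field by blast
    show ?thesis by (rule that[of "c - T"]) (use c T b in \<open>auto simp: le_less\<close>)
  qed
  have tau: "ereal (T + e) \<le> tau0 z"
    unfolding tau0_def
  proof (rule Inf_greatest)
    fix a assume "a \<in> {ereal s |s. 0 \<le> s \<and> z s < 0}"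
    then obtain s where s: "a = ereal s" "0 \<le> s" "z s < 0" by blast
    have "T + e \<le> s"
    proof (rule ccontr)
      assume "\<not> T + e \<le> s"
      then show False using s before[of s] e(2)[of s] b by (cases "s < T") auto
    qed
    then show "ereal (T + e) \<le> a" using s by simp
  qed
  define k where "k r = inverse (ennreal (R (max 0 (z r))))" for r
  have k_meas[measurable]: "k \<in> borel_measurable borel"
  proof -
    note borel_measurable_continuous_max[OF R_cont, measurable]
    show ?thesis unfolding k_def by measurable
  qed
  have k_eq: "inverse (ennreal (R (z r))) = k r" if "0 \<le> r" "r < T + e" for r
    using that before[of r] e(2)[of r] b by (cases "r < T") (auto simp: k_def max_def)
  have eta_eq: "eta R z s = (\<integral>\<^sup>+r. indicator {0..s} r * k r \<partial>lborel)" if "s < T + e" for s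
    unfolding eta_def
  proof (intro nn_integral_cong)
    fix r :: real
    have "ereal r < tau0 z" if "r \<le> s" using that \<open>s < T + e\<close> tau by (intro less_le_trans[OF _ tau]) simp
    then show "indicator {0..s} r * indicator {r. ereal r < tau0 z} r * inverse (ennreal (R (z r))) = indicator {0..s} r * k r"
      using that by (auto simp: indicator_def k_eq)
  qed
  have A_eq: "A = (\<integral>\<^sup>+r. indicator {0..<T} r * k r \<partial>lborel)"
    unfolding A using e(1) by (intro nn_integral_cong) (auto simp: indicator_def k_eq)
  have X_eq: "Xpath R z q = z r" if "eta_inv R z q = ereal r" "r < T + e" for q r
  proof -
    have "ereal r \<le> tau0 z" using that(2) by (intro order_trans[OF _ tau]) simp
    then show ?thesis using that(1) by (simp add: Xpath_def min_def)
  qed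
  have above: "b \<le> Xpath R z q" if q: "ennreal q < A" for q
  proof -
    \<comment> \<open>Clock values at times strictly before \<open>T\<close> increase to
      \<open>A\<close>, so one of them already exceeds \<open>q\<close>; the inverse clock is then
      strictly before \<open>T\<close>.\<close>
    define s where "s n = T - 1 / Suc n" for n
    have "A = (\<integral>\<^sup>+r. (SUP n. indicator {0..s n} r * k r) \<partial>lborel)"
      unfolding A_eq
    proof (intro nn_integral_cong)
      fix r :: real
      show "indicator {0..<T} r * k r = (SUP n. indicator {0..s n} r * k r)"
      proof (cases "0 \<le> r \<and> r < T")
        case True
        then obtain n where "1 / Suc n < T - r" using nat_approx_posE[of "T - r"] by auto
        then have "r \<le> s n" by (simp add: s_def)
        then show ?thesis using True
          by (intro antisym SUP_least SUP_upper2[of n]) (auto simp: indicator_def)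
      next
        case False
        have "s n < T" for n by (simp add: s_def)
        then have "indicator {0..s n} r = (0 :: ennreal)" for n
          using False by (auto simp: indicator_def dest: le_less_trans)
        moreover have "indicator {0..<T} r = (0 :: ennreal)" using False by (auto simp: indicator_def)
        ultimately show ?thesis by simp
      qed
    qed
    also have "\<dots> = (SUP n. \<integral>\<^sup>+r. indicator {0..s n} r * k r \<partial>lborel)"
    proof (rule nn_integral_monotone_convergence_SUP)
      have "s n \<le> s m" if "n \<le> m" for n m using that by (auto simp: s_def frac_le)
      then show "incseq (\<lambda>n r. indicator {0..s n} r * k r)"
        by (auto simp: incseq_def le_fun_def indicator_def intro: order_trans)
    qed measurable
    finally obtain n where n: "ennreal q < (\<integral>\<^sup>+r. indicator {0..s n} r * k r \<partial>lborel)"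
      using q by (auto simp: less_SUP_iff)
    have sT: "s n < T" by (simp add: s_def)
    have "0 \<le> s n" using n by (rule_tac ccontr) (auto simp: indicator_def)
    moreover have "ennreal q < eta R z (s n)" using n eta_eq[of "s n"] sT e(1) by simp
    ultimately have "eta_inv R z q \<le> ereal (s n)" unfolding eta_inv_def by (auto intro!: Inf_lower)
    then obtain r where r: "eta_inv R z q = ereal r" "r \<le> s n"
      using eta_inv_nonneg[of R z q] by (cases "eta_inv R z q") auto
    have "0 \<le> r" using eta_inv_nonneg[of R z q] r by simp
    then show ?thesis using X_eq[OF r(1)] before[of r] r sT e(1) by simp
  qed
  have below: "\<exists>q::rat. 0 \<le> q \<and> Xpath R z (of_rat q) < b \<and> ennreal (of_rat q) \<le> A + ennreal d" if d: "0 < d" for d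
  proof -
    have comp: "compact {b / 2..b + 1}" "{b / 2..b + 1} \<noteq> {}" "continuous_on {b / 2..b + 1} R"
      using b by (auto intro: continuous_on_subset[OF R_cont])
    obtain x1 where x1: "x1 \<in> {b / 2..b + 1}" "\<And>x. x \<in> {b / 2..b + 1} \<Longrightarrow> R x1 \<le> R x"
      using continuous_attains_inf[OF comp] by blast
    obtain x2 where x2: "x2 \<in> {b / 2..b + 1}" "\<And>x. x \<in> {b / 2..b + 1} \<Longrightarrow> R x \<le> R x2"
      using continuous_attains_sup[OF comp] by blast
    have pos: "0 < R x1" "0 < R x2" using x1(1) x2(1) b R_pos by auto
    have k_bounds: "ennreal (1 / R x2) \<le> k r" "k r \<le> ennreal (1 / R x1)" if "T \<le> r" "r < T + e" for r
    proof -
      have zr: "z r \<in> {b / 2..b + 1}" "0 < z r" using e(2)[OF that] b by auto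
      then have "k r = ennreal (1 / R (z r))" using R_pos by (simp add: k_def inverse_ennreal inverse_eq_divide)
      then show "ennreal (1 / R x2) \<le> k r" "k r \<le> ennreal (1 / R x1)"
        using x1(2)[OF zr(1)] x2(2)[OF zr(1)] pos R_pos[OF zr(2)] by (auto intro!: ennreal_leI divide_left_mono)
    qed
    \<comment> \<open>Within time \<open>d * R x1\<close> after \<open>T\<close> the clock advances
      by at most \<open>d\<close>, because \<open>R x1\<close> is the minimal rate.\<close>
    define e' where "e' = min e (d * R x1)"
    have e': "0 < e'" using e(1) d pos by (simp add: e'_def)
    obtain s1 where s1: "T \<le> s1" "s1 < T + e'" "z s1 < b" using after[OF e'] by blast
    have "0 \<le> s1" using s1 T by simp
    obtain c where c: "s1 < c" "\<And>r. s1 < r \<Longrightarrow> r < c \<Longrightarrow> z r < b"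
      using order_tendstoD(2)[OF rc[OF \<open>0 \<le> s1\<close>] s1(3)] unfolding eventually_at_right_field by blast
    \<comment> \<open>A midpoint that stays inside both the interval where the path is below
      \<open>b\<close> and the time allowance \<open>e'\<close>.\<close>
    define s2 where "s2 = (s1 + min c (T + e')) / 2"
    have s2: "s1 < s2" "s2 < c" "s2 < T + e'" using c(1) s1 by (auto simp: s2_def min_def field_simps)
    have s2e: "s2 < T + e" and s1e: "s1 < T + e" using s2 by (auto simp: e'_def)
    have "eta R z s2 \<le> (\<integral>\<^sup>+r. indicator {0..<T} r * k r + ennreal (1 / R x1) * indicator {T..s2} r \<partial>lborel)"
      unfolding eta_eq[OF s2e]
    proof (intro nn_integral_mono)
      fix r :: real
      show "indicator {0..s2} r * k r \<le> indicator {0..<T} r * k r + ennreal (1 / R x1) * indicator {T..s2} r"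
        using k_bounds(2)[of r] s2e by (auto simp: indicator_def)
    qed
    also have "\<dots> = A + ennreal (1 / R x1) * ennreal (s2 - T)"
      using s1 s2 by (simp add: nn_integral_add nn_integral_cmult A_eq)
    also have "ennreal (1 / R x1) * ennreal (s2 - T) \<le> ennreal d"
    proof -
      have "s2 - T \<le> d * R x1" using s2 by (simp add: e'_def)
      then show ?thesis using pos s1 s2 by (simp add: ennreal_mult[symmetric] ennreal_leI field_simps)
    qed
    finally have up: "eta R z s2 \<le> A + ennreal d" by (simp add: add_left_mono)
    have "eta R z s1 + ennreal (1 / R x2) * ennreal (s2 - s1)
        = (\<integral>\<^sup>+r. indicator {0..s1} r * k r + ennreal (1 / R x2) * indicator {s1<..s2} r \<partial>lborel)"
      using s2 by (simp add: nn_integral_add nn_integral_cmult eta_eq[OF s1e])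
    also have "\<dots> \<le> eta R z s2"
      unfolding eta_eq[OF s2e]
    proof (intro nn_integral_mono)
      fix r :: real
      show "indicator {0..s1} r * k r + ennreal (1 / R x2) * indicator {s1<..s2} r \<le> indicator {0..s2} r * k r"
        using k_bounds(1)[of r] s2 s2e s1 T by (auto simp: indicator_def)
    qed
    finally have step: "eta R z s1 + ennreal (1 / R x2) * ennreal (s2 - s1) \<le> eta R z s2" .
    have fin2: "eta R z s2 < \<infinity>" using up A(2) by (auto simp: less_top[symmetric] top_unique)
    then have fin1: "eta R z s1 < \<infinity>" using eta_mono[of s1 s2 R z] s2 by (auto intro: le_less_trans)
    obtain u1 u2 where u: "eta R z s1 = ennreal u1" "0 \<le> u1" "eta R z s2 = ennreal u2" "0 \<le> u2"
      using fin1 fin2 by (cases "eta R z s1"; cases "eta R z s2") auto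
    have "u1 + (1 / R x2) * (s2 - s1) \<le> u2"
      using step u pos s2 by (simp add: ennreal_mult[symmetric] ennreal_plus[symmetric] del: ennreal_plus)
    moreover have "0 < (1 / R x2) * (s2 - s1)" using pos s2 by simp
    ultimately have "u1 < u2" by linarith
    \<comment> \<open>A rational strictly between the clock values at \<open>s1\<close> and
      \<open>s2\<close> has its inverse time in \<open>{s1..s2}\<close>, where the path is below
      \<open>b\<close>.\<close>
    then obtain q where q: "u1 < of_rat q" "of_rat q < u2" using of_rat_dense by blast
    have "0 \<le> (of_rat q :: real)" using q u by linarith
    then have q0: "0 \<le> q" by (simp add: zero_le_of_rat_iff)
    have lo: "ereal s1 \<le> eta_inv R z (of_rat q)"
      unfolding eta_inv_def
    proof (rule Inf_greatest)
      fix a assume "a \<in> {ereal s |s. 0 \<le> s \<and> ennreal (of_rat q) < eta R z s}"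
      then obtain s where s: "a = ereal s" "ennreal (of_rat q) < eta R z s" by blast
      have "s1 \<le> s"
      proof (rule ccontr)
        assume "\<not> s1 \<le> s"
        then have "eta R z s \<le> ennreal u1" using eta_mono[of s s1 R z] u by simp
        with s(2) q show False by (meson ennreal_leI leD less_imp_le order_trans)
      qed
      then show "ereal s1 \<le> a" using s by simp
    qed
    have "ennreal (of_rat q) < eta R z s2" using q u \<open>0 \<le> of_rat q\<close> by (simp add: ennreal_less_iff)
    then have hi: "eta_inv R z (of_rat q) \<le> ereal s2"
      unfolding eta_inv_def using \<open>0 \<le> s1\<close> s2 by (auto intro!: Inf_lower)
    obtain r where r: "eta_inv R z (of_rat q) = ereal r" "s1 \<le> r" "r \<le> s2"
      using lo hi by (cases "eta_inv R z (of_rat q)") auto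
    have "z r < b" using c(2)[of r] r s1(3) s2 by (cases "r = s1") auto
    then have "Xpath R z (of_rat q) < b" using X_eq[OF r(1)] r s2e by simp
    moreover have "ennreal (of_rat q) \<le> A + ennreal d"
      using q u up by (auto intro: order_trans[OF ennreal_leI[OF less_imp_le[OF q(2)]]])
    ultimately show ?thesis using q0 by blast
  qed
  show ?thesis
  proof (rule antisym)
    show "first_below (Xpath R z) b \<le> A"
    proof (rule ennreal_le_epsilon)
      fix d :: real assume "0 < d"
      then show "first_below (Xpath R z) b \<le> A + ennreal d"
        using below[of d] unfolding first_below_def by (auto intro: INF_lower2)
    qed
    show "A \<le> first_below (Xpath R z) b"
      unfolding first_below_def
      by (rule INF_greatest) (use above in \<open>force simp: not_less[symmetric]\<close>)
  qed
qed

text \<open>Both random times are infima decided at rational times: for \<open>tau0\<close> by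
  right-continuity of the path, for the inverse clock by monotonicity of the clock. Up to
  \<open>tau0\<close> the path is nonnegative, so the clamped rate may be used.\<close>

lemma measurable_Xpath:
  fixes W :: "real \<Rightarrow> 'n \<Rightarrow> real"
  assumes W[measurable]: "(\<lambda>(t, p). W t p) \<in> borel_measurable (borel \<Otimes>\<^sub>M N)"
    and rc: "\<And>p t. p \<in> space N \<Longrightarrow> ((\<lambda>s. W s p) \<longlongrightarrow> W t p) (at_right t)"
    and R_cont: "continuous_on {0..} R"
  shows "(\<lambda>p. Xpath R (\<lambda>s. W s p) t) \<in> borel_measurable N"
proof -
  have W'[measurable (raw)]: "(\<lambda>x. W (f x) (g x)) \<in> borel_measurable K"
    if "f \<in> borel_measurable K" "g \<in> measurable K N" for f g and K :: "'k measure"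
    using measurable_compose[OF measurable_Pair[OF that] W] by simp
  note borel_measurable_continuous_max[OF R_cont, measurable]
  have rat_between: "\<exists>q::rat. s < of_rat q \<and> ereal (of_rat q) < a" if "ereal s < a" for s a
  proof -
    obtain s' where s': "ereal s < ereal s'" "ereal s' < a" using ereal_dense2[OF \<open>ereal s < a\<close>] by blast
    then obtain q where "s < of_rat q" "of_rat q < s'" using of_rat_dense[of s s'] by auto
    moreover from this have "ereal (of_rat q) < ereal s'" by simp
    ultimately show ?thesis using less_trans[OF _ s'(2)] by blast
  qed
  have tau[measurable]: "(\<lambda>p. tau0 (\<lambda>s. W s p)) \<in> borel_measurable N"
  proof (rule borel_measurableI_less)
    fix a :: ereal
    have "tau0 (\<lambda>s. W s p) < a \<longleftrightarrow> (\<exists>q::rat. 0 \<le> q \<and> ereal (of_rat q) < a \<and> W (of_rat q) p < 0)"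
      if p: "p \<in> space N" for p
    proof
      assume "tau0 (\<lambda>s. W s p) < a"
      then obtain s where s: "0 \<le> s" "W s p < 0" "ereal s < a" by (auto simp: tau0_def Inf_less_iff)
      obtain c where c: "s < c" "\<And>r. s < r \<Longrightarrow> r < c \<Longrightarrow> W r p < 0"
        using order_tendstoD(2)[OF rc[OF p] s(2)] unfolding eventually_at_right_field by blast
      have "ereal s < min a (ereal c)" using s c by simp
      from rat_between[OF this] obtain q :: rat where q: "s < of_rat q" "ereal (of_rat q) < min a (ereal c)" by blast
      have "0 \<le> (of_rat q :: real)" using q s by linarith
      then show "\<exists>q::rat. 0 \<le> q \<and> ereal (of_rat q) < a \<and> W (of_rat q) p < 0"
        using q c by (intro exI[of _ q]) (auto simp: zero_le_of_rat_iff)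
    next
      assume "\<exists>q::rat. 0 \<le> q \<and> ereal (of_rat q) < a \<and> W (of_rat q) p < 0"
      then obtain q :: rat where "0 \<le> (of_rat q :: real)" "ereal (of_rat q) < a" "W (of_rat q) p < 0"
        by (auto simp: zero_le_of_rat_iff)
      then show "tau0 (\<lambda>s. W s p) < a" unfolding tau0_def Inf_less_iff by blast
    qed
    then have "{p \<in> space N. tau0 (\<lambda>s. W s p) < a} = {p \<in> space N. \<exists>q::rat. 0 \<le> q \<and> ereal (of_rat q) < a \<and> W (of_rat q) p < 0}"
      by blast
    also have "\<dots> \<in> sets N" by measurable
    finally show "{p \<in> space N. tau0 (\<lambda>s. W s p) < a} \<in> sets N" .
  qed
  have eta[measurable]: "(\<lambda>p. eta R (\<lambda>s. W s p) s) \<in> borel_measurable N" for s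
  proof -
    have "eta R (\<lambda>s. W s p) s = (\<integral>\<^sup>+r. (if 0 \<le> r \<and> r \<le> s \<and> ereal r < tau0 (\<lambda>s. W s p) then inverse (ennreal (R (max 0 (W r p)))) else 0) \<partial>lborel)" for p
      unfolding eta_def
    proof (intro nn_integral_cong)
      fix r :: real
      have "0 \<le> W r p" if "0 \<le> r" "ereal r < tau0 (\<lambda>s. W s p)"
      proof (rule ccontr)
        assume "\<not> 0 \<le> W r p"
        then have "tau0 (\<lambda>s. W s p) \<le> ereal r" unfolding tau0_def using that(1) by (auto intro!: Inf_lower)
        with that(2) show False by simp
      qed
      then show "indicator {0..s} r * indicator {r. ereal r < tau0 (\<lambda>s. W s p)} r * inverse (ennreal (R (W r p)))
          = (if 0 \<le> r \<and> r \<le> s \<and> ereal r < tau0 (\<lambda>s. W s p) then inverse (ennreal (R (max 0 (W r p)))) else 0)"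
        by (auto simp: indicator_def max_def)
    qed
    moreover have "(\<lambda>p. \<integral>\<^sup>+r. (if 0 \<le> r \<and> r \<le> s \<and> ereal r < tau0 (\<lambda>s. W s p) then inverse (ennreal (R (max 0 (W r p)))) else 0) \<partial>lborel) \<in> borel_measurable N"
      by measurable
    ultimately show ?thesis by simp
  qed
  have inv[measurable]: "(\<lambda>p. eta_inv R (\<lambda>s. W s p) t) \<in> borel_measurable N"
  proof (rule borel_measurableI_less)
    fix a :: ereal
    have "eta_inv R (\<lambda>s. W s p) t < a \<longleftrightarrow> (\<exists>q::rat. 0 \<le> q \<and> ereal (of_rat q) < a \<and> ennreal t < eta R (\<lambda>s. W s p) (of_rat q))" for p
    proof
      assume "eta_inv R (\<lambda>s. W s p) t < a"
      then obtain s where s: "0 \<le> s" "ennreal t < eta R (\<lambda>s. W s p) s" "ereal s < a"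
        by (auto simp: eta_inv_def Inf_less_iff)
      obtain q :: rat where q: "s < of_rat q" "ereal (of_rat q) < a" using rat_between[OF s(3)] by blast
      have "0 \<le> (of_rat q :: real)" using q s by linarith
      moreover have "ennreal t < eta R (\<lambda>s. W s p) (of_rat q)"
        using s(2) eta_mono[of s "of_rat q"] q by (meson less_imp_le less_le_trans)
      ultimately show "\<exists>q::rat. 0 \<le> q \<and> ereal (of_rat q) < a \<and> ennreal t < eta R (\<lambda>s. W s p) (of_rat q)"
        using q by (intro exI[of _ q]) (auto simp: zero_le_of_rat_iff)
    next
      assume "\<exists>q::rat. 0 \<le> q \<and> ereal (of_rat q) < a \<and> ennreal t < eta R (\<lambda>s. W s p) (of_rat q)"
      then obtain q :: rat where "0 \<le> (of_rat q :: real)" "ereal (of_rat q) < a" "ennreal t < eta R (\<lambda>s. W s p) (of_rat q)"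
        by (auto simp: zero_le_of_rat_iff)
      then show "eta_inv R (\<lambda>s. W s p) t < a" unfolding eta_inv_def Inf_less_iff by blast
    qed
    then have "{p \<in> space N. eta_inv R (\<lambda>s. W s p) t < a} = {p \<in> space N. \<exists>q::rat. 0 \<le> q \<and> ereal (of_rat q) < a \<and> ennreal t < eta R (\<lambda>s. W s p) (of_rat q)}"
      by blast
    also have "\<dots> \<in> sets N" by measurable
    finally show "{p \<in> space N. eta_inv R (\<lambda>s. W s p) t < a} \<in> sets N" .
  qed
  show ?thesis unfolding Xpath_def by measurable
qed

text \<open>Cutting the reciprocal rate off below \<open>b\<close> makes its integral over the line
  equal to \<open>\<gamma> * phi \<gamma> R b\<close> for large \<open>b\<close>, without changing
  the clock before passage.\<close>

definition level_rate :: "(real \<Rightarrow> real) \<Rightarrow> real \<Rightarrow> real \<Rightarrow> ennreal" where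
  "level_rate R b w = indicator {b..} w * inverse (ennreal (R w))"

lemma measurable_level_rate:
  assumes "continuous_on {0..} R" "0 < b"
  shows "level_rate R b \<in> borel_measurable borel"
proof -
  note borel_measurable_continuous_max[OF assms(1), measurable]
  have "level_rate R b = (\<lambda>w. indicator {b..} w * inverse (ennreal (R (max 0 w))))"
    using assms(2) by (auto simp: fun_eq_iff level_rate_def indicator_def max_def)
  then show ?thesis by simp
qed

text \<open>Finiteness is a separate clause because \<open>enn2real\<close> would turn an infinite
  clock into 0.\<close>

definition (in levy_negative_drift) clock_concentrated ::
    "(real \<Rightarrow> real) \<Rightarrow> real \<Rightarrow> real \<Rightarrow> real \<Rightarrow> real \<Rightarrow> bool" where
  "clock_concentrated R b F \<eta> x \<longleftrightarrow>
     (AE \<omega> in M. clock (\<lambda>y. level_rate R b (x + y)) (x - b) \<omega> < \<infinity>) \<and>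
     (\<integral>\<^sup>+\<omega>. ennreal ((enn2real (clock (\<lambda>y. level_rate R b (x + y)) (x - b) \<omega>) - F)\<^sup>2) \<partial>M) \<le> ennreal \<eta>"

lemma (in levy_negative_drift) AE_first_below_Xpath:
  assumes R_cont: "continuous_on {0..} R" and R_pos: "\<And>x. 0 < x \<Longrightarrow> 0 < R x"
    and b: "0 < b" "b \<le> x"
    and fin: "AE \<omega> in M. clock (\<lambda>y. level_rate R b (x + y)) (x - b) \<omega> < \<infinity>"
  shows "AE \<omega> in M. first_below (Xpath R (\<lambda>s. x + L s \<omega>)) b = clock (\<lambda>y. level_rate R b (x + y)) (x - b) \<omega>"
proof -
  have c: "0 \<le> x - b" using b by simp
  show ?thesis
    using fin AE_hits[OF c] AE_Z_hit_time[OF c] AE_space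
  proof eventually_elim
    case (elim \<omega>)
    let ?T = "hit_time (x - b) \<omega>" and ?z = "\<lambda>s. x + Z s \<omega>"
    have "Xpath R (\<lambda>s. x + L s \<omega>) = Xpath R ?z"
      by (rule ext, rule Xpath_cong) (simp add: Z_eq_L)
    moreover have "first_below (Xpath R ?z) b = clock (\<lambda>y. level_rate R b (x + y)) (x - b) \<omega>"
    proof (rule first_below_Xpath[where T = ?T])
      show "(?z \<longlongrightarrow> ?z t) (at_right t)" for t
        using Z_right_continuous[OF elim(4), of t] by (intro tendsto_intros)
      show "?z \<in> borel_measurable borel" using measurable_Z_time[OF elim(4)] by measurable
      show "?z ?T = b" using elim by simp
      show before: "b \<le> ?z t" if "0 \<le> t" "t < ?T" for t
        using Z_before_hit_time[OF elim(4) that] by simp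
      show "\<exists>t\<ge>?T. t < ?T + d \<and> ?z t < b" if "0 < d" for d
        using Z_after_hit_time[OF elim(2) that] by (metis add.commute less_diff_eq minus_diff_eq)
      show "clock (\<lambda>y. level_rate R b (x + y)) (x - b) \<omega>
          = (\<integral>\<^sup>+r. indicator {0..<?T} r * inverse (ennreal (R (?z r))) \<partial>lborel)"
        unfolding clock_def
      proof (rule nn_integral_cong)
        fix r :: real
        show "indicator {0..} r * (if \<omega> \<in> hits (x - b) \<and> ?T \<le> r then 0 else level_rate R b (x + Z r \<omega>))
            = indicator {0..<?T} r * inverse (ennreal (R (?z r)))"
          using elim(2) before[of r] by (cases "0 \<le> r"; cases "r < ?T") (auto simp: level_rate_def)
      qed
    qed (use elim R_cont R_pos b hit_time_nonneg in auto)
    ultimately show ?case by simp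
  qed
qed

subsection \<open>The tail integral of the reciprocal rate\<close>

text \<open>If the lower limit were at most \<open>1 - e\<close> for all \<open>h\<close> close to
  1, so would be the upper limit over \<open>h\<close>; hence some \<open>h > 1\<close> does
  better.\<close>

lemma H1_phi_ratio:
  assumes H1: "Limsup (at_right 1) (\<lambda>h. Liminf at_top (\<lambda>x. ereal (phi \<gamma> R (h * x) / phi \<gamma> R x))) = 1"
    and e: "0 < e"
  shows "\<exists>h>1. \<forall>\<^sub>F x in at_top. 1 - e < phi \<gamma> R (h * x) / phi \<gamma> R x"
proof -
  let ?f = "\<lambda>h. Liminf at_top (\<lambda>x. ereal (phi \<gamma> R (h * x) / phi \<gamma> R x))"
  have "\<not> (\<forall>\<^sub>F h in at_right 1. ?f h \<le> ereal (1 - e))"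
  proof
    assume "\<forall>\<^sub>F h in at_right 1. ?f h \<le> ereal (1 - e)"
    then have "Limsup (at_right 1) ?f \<le> ereal (1 - e)" by (rule Limsup_bounded)
    with H1 e show False by (simp add: one_ereal_def)
  qed
  then obtain h where h: "1 < h" "ereal (1 - e) < ?f h"
    using eventually_mono[OF eventually_at_right_less[of 1], of "\<lambda>h. ?f h \<le> ereal (1 - e)"] not_le by blast
  from less_LiminfD[OF h(2)] show ?thesis using h(1) by auto
qed

locale phi_integrable =
  fixes \<gamma> :: real and R :: "real \<Rightarrow> real" and x0 :: real
  assumes gamma: "0 < \<gamma>" and R_cont: "continuous_on {0..} R" and R_pos: "\<And>x. 0 < x \<Longrightarrow> 0 < R x"
    and x0: "0 < x0" and integrable: "set_integrable lborel {x0..} (\<lambda>x. 1 / R x)"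
begin

lemma integrable_from: "x0 \<le> v \<Longrightarrow> set_integrable lborel {v..} (\<lambda>x. 1 / R x)"
  by (rule set_integrable_subset[OF integrable]) auto

lemma phi_nonneg: "x0 \<le> v \<Longrightarrow> 0 \<le> phi \<gamma> R v"
  unfolding phi_def set_lebesgue_integral_def using gamma R_pos x0
  by (auto intro!: mult_nonneg_nonneg Bochner_Integration.integral_nonneg simp: indicator_def less_imp_le)

lemma nn_integral_tail:
  assumes "x0 \<le> v"
  shows "(\<integral>\<^sup>+w. indicator {v..} w * inverse (ennreal (R w)) \<partial>lborel) = ennreal (\<gamma> * phi \<gamma> R v)"
proof -
  have pos: "0 < R w" if "v \<le> w" for w using that assms x0 R_pos by simp
  have "(\<integral>\<^sup>+w. indicator {v..} w * inverse (ennreal (R w)) \<partial>lborel) = (\<integral>\<^sup>+w. ennreal (indicator {v..} w *\<^sub>R (1 / R w)) \<partial>lborel)"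
    using pos by (intro nn_integral_cong) (auto simp: indicator_def inverse_ennreal inverse_eq_divide)
  also have "\<dots> = ennreal (\<integral>w. indicator {v..} w *\<^sub>R (1 / R w) \<partial>lborel)"
    using integrable_from[OF assms] pos unfolding set_integrable_def
    by (intro nn_integral_eq_integral) (auto simp: indicator_def less_imp_le)
  finally show ?thesis using gamma by (simp add: phi_def set_lebesgue_integral_def)
qed

lemma phi_antimono:
  assumes "x0 \<le> v" "v \<le> v'" shows "phi \<gamma> R v' \<le> phi \<gamma> R v"
proof -
  have "ennreal (\<gamma> * phi \<gamma> R v') \<le> ennreal (\<gamma> * phi \<gamma> R v)"
    using assms by (simp add: nn_integral_tail[symmetric]) (intro nn_integral_mono, auto simp: indicator_def)
  then show ?thesis using gamma assms phi_nonneg[of v] by (simp add: ennreal_le_iff)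
qed

lemma nn_integral_interval:
  assumes "x0 \<le> v" "0 \<le> n"
  shows "(\<integral>\<^sup>+w. indicator {v..<v + n} w * inverse (ennreal (R w)) \<partial>lborel) = ennreal (\<gamma> * (phi \<gamma> R v - phi \<gamma> R (v + n)))"
proof -
  have v: "0 < v" using assms x0 by simp
  let ?k = "\<lambda>w. level_rate R v w"
  note measurable_level_rate[OF R_cont v, measurable]
  let ?I = "\<integral>\<^sup>+w. indicator {v..<v + n} w * ?k w \<partial>lborel"
  have "ennreal (\<gamma> * phi \<gamma> R v) = (\<integral>\<^sup>+w. indicator {v..<v + n} w * ?k w + indicator {v + n..} w * ?k w \<partial>lborel)"
    unfolding nn_integral_tail[OF assms(1), symmetric] using assms(2)
    by (intro nn_integral_cong) (auto simp: indicator_def level_rate_def)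
  also have "\<dots> = ?I + (\<integral>\<^sup>+w. indicator {v + n..} w * ?k w \<partial>lborel)"
    by (simp add: nn_integral_add)
  also have "(\<integral>\<^sup>+w. indicator {v + n..} w * ?k w \<partial>lborel) = ennreal (\<gamma> * phi \<gamma> R (v + n))"
    using assms by (subst nn_integral_tail[symmetric]) (auto intro!: nn_integral_cong simp: indicator_def level_rate_def)
  finally have eq: "ennreal (\<gamma> * phi \<gamma> R v) = ?I + ennreal (\<gamma> * phi \<gamma> R (v + n))" .
  then obtain i where i: "?I = ennreal i" "0 \<le> i" by (cases ?I) auto
  have "\<gamma> * phi \<gamma> R v = i + \<gamma> * phi \<gamma> R (v + n)"
    using eq i gamma phi_nonneg[of v] phi_nonneg[of "v + n"] assms
    by (simp add: ennreal_plus[symmetric] del: ennreal_plus)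
  moreover have "?I = (\<integral>\<^sup>+w. indicator {v..<v + n} w * inverse (ennreal (R w)) \<partial>lborel)"
    by (intro nn_integral_cong) (auto simp: indicator_def level_rate_def)
  ultimately show ?thesis using i by (simp add: algebra_simps)
qed

lemma phi_eventually_small:
  assumes "0 < \<delta>" shows "\<exists>y\<ge>x0. phi \<gamma> R y \<le> \<delta>"
proof -
  have "(\<lambda>n. \<integral>w. indicator {x0 + real n..} w *\<^sub>R (1 / R w) \<partial>lborel) \<longlonglongrightarrow> (\<integral>w. 0 \<partial>(lborel :: real measure))"
  proof (rule integral_dominated_convergence[where w = "\<lambda>w. indicator {x0..} w *\<^sub>R (1 / R w)"])
    show "integrable lborel (\<lambda>w. indicator {x0..} w *\<^sub>R (1 / R w))" using integrable by (simp add: set_integrable_def)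
    show "(\<lambda>w. indicator {x0 + real n..} w *\<^sub>R (1 / R w)) \<in> borel_measurable lborel" for n
      using integrable_from[of "x0 + real n"] by (auto simp: set_integrable_def)
    show "AE w in lborel. (\<lambda>n. indicator {x0 + real n..} w *\<^sub>R (1 / R w)) \<longlonglongrightarrow> 0"
    proof (intro always_eventually allI)
      fix w :: real
      obtain m :: nat where m: "w - x0 < real m" using reals_Archimedean2 by blast
      have "\<forall>\<^sub>F n in sequentially. 0 = indicator {x0 + real n..} w *\<^sub>R (1 / R w)"
        using eventually_ge_at_top[of m] by eventually_elim (use m in \<open>auto simp: indicator_def\<close>)
      then show "(\<lambda>n. indicator {x0 + real n..} w *\<^sub>R (1 / R w)) \<longlonglongrightarrow> 0"
        by (rule Lim_transform_eventually[OF tendsto_const])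
    qed
    show "AE w in lborel. norm (indicator {x0 + real n..} w *\<^sub>R (1 / R w)) \<le> indicator {x0..} w *\<^sub>R (1 / R w)" for n
      using R_pos x0 by (intro always_eventually allI) (auto simp: indicator_def abs_of_pos less_imp_le)
  qed auto
  from tendsto_mult[OF tendsto_const[of "1 / \<gamma>"] this]
  have "(\<lambda>n. phi \<gamma> R (x0 + real n)) \<longlonglongrightarrow> 0" by (simp add: phi_def set_lebesgue_integral_def)
  from order_tendstoD(2)[OF this assms] obtain n where "phi \<gamma> R (x0 + real n) < \<delta>"
    by (auto simp: eventually_sequentially)
  then show ?thesis by (intro exI[of _ "x0 + real n"]) auto
qed

end

text \<open>The potential above a level has a near part, a window of fixed length \<open>n\<close>,
  and a far part of density at most \<open>\<epsilon> / \<gamma>\<close>. The window eventually fits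
  between \<open>v\<close> and \<open>h * v\<close>, where H1 leaves only an \<epsilon> fraction of
  the tail integral.\<close>

lemma (in levy_negative_drift) eventually_clock_concentrated:
  assumes R_cont: "continuous_on {0..} R" and pos: "\<forall>x>0. 0 < R x"
    and H1: "Limsup (at_right 1) (\<lambda>h. Liminf at_top (\<lambda>x. ereal (phi \<gamma> R (h * x) / phi \<gamma> R x))) = 1"
    and \<kappa>: "0 < \<kappa>"
  shows "\<forall>\<^sub>F b in at_top. 0 < b \<and> 0 < phi \<gamma> R b \<and> 
    (\<exists>y0\<ge>b. \<forall>x\<ge>y0. clock_concentrated R b (phi \<gamma> R b) (\<kappa> * (phi \<gamma> R b)\<^sup>2) x)"
proof -
  have R_pos: "0 < R x" if "0 < x" for x using pos that by blast
  \<comment> \<open>The deviation bound is used with \<open>2 * \<epsilon>\<close> for the potential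
    and \<open>\<epsilon> * F\<close> for the tail, so the total is
    \<open>(4 * 2 + 2) * \<epsilon> = 10 * \<epsilon>\<close> times
    \<open>F\<^sup>2\<close>.\<close>
  define \<epsilon> where "\<epsilon> = min (1 / 2) (\<kappa> / 10)"
  have \<epsilon>: "0 < \<epsilon>" "\<epsilon> < 1" "10 * \<epsilon> \<le> \<kappa>" using \<kappa> by (auto simp: \<epsilon>_def)
  obtain h where h: "1 < h" "\<forall>\<^sub>F x in at_top. 1 - \<epsilon> < phi \<gamma> R (h * x) / phi \<gamma> R x"
    using H1_phi_ratio[OF H1 \<epsilon>(1)] by blast
  then obtain x1 where x1: "\<And>x. x1 \<le> x \<Longrightarrow> 1 - \<epsilon> < phi \<gamma> R (h * x) / phi \<gamma> R x"
    by (auto simp: eventually_at_top_linorder)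
  define x0 where "x0 = max 1 x1"
  \<comment> \<open>A zero denominator would make the ratio 0, against the bound
    \<open>1 - \<epsilon> > 0\<close>. A non-integrable function has Bochner integral 0, so a
    nonzero value shows that \<open>1 / R\<close> is integrable on this tail.\<close>
  have "phi \<gamma> R x0 \<noteq> 0" using x1[of x0] \<epsilon> by (auto simp: x0_def)
  then have "set_integrable lborel {x0..} (\<lambda>x. 1 / R x)"
    unfolding phi_def set_integrable_def set_lebesgue_integral_def using not_integrable_integral_eq by fastforce
  then interpret phi_integrable \<gamma> R x0
    using gamma_pos R_cont R_pos by unfold_locales (auto simp: x0_def)
  have phi_pos: "0 < phi \<gamma> R v" if "x0 \<le> v" for v
    using phi_nonneg[OF that] x1[of v] \<epsilon> that by (cases "phi \<gamma> R v = 0") (auto simp: x0_def)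
  obtain n where n: "0 \<le> n" and U_le: "\<And>g v. g \<in> borel_measurable borel \<Longrightarrow>
    U (\<lambda>z. indicator {0..} z * g (v + z)) \<le> ennreal (1 / \<gamma>) * (\<integral>\<^sup>+w. indicator {v..<v + n} w * g w \<partial>lborel)
       + ennreal (\<epsilon> / \<gamma>) * (\<integral>\<^sup>+w. indicator {v..} w * g w \<partial>lborel)"
    using U_nonneg_part_le[of "\<epsilon> / \<gamma>"] \<epsilon> gamma_pos by auto
  \<comment> \<open>From \<open>n / (h - 1) \<le> v\<close> follows
    \<open>v + n \<le> h * v\<close>.\<close>
  define b0 where "b0 = max x0 (n / (h - 1))"
  have drop: "phi \<gamma> R v - phi \<gamma> R (v + n) \<le> \<epsilon> * phi \<gamma> R v" if "b0 \<le> v" for v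
  proof -
    have v: "x0 \<le> v" "n / (h - 1) \<le> v" using that by (auto simp: b0_def)
    then have "n \<le> v * (h - 1)" using h(1) by (simp add: pos_divide_le_eq)
    then have "phi \<gamma> R (h * v) \<le> phi \<gamma> R (v + n)" using v n by (intro phi_antimono) (auto simp: algebra_simps)
    moreover have "(1 - \<epsilon>) * phi \<gamma> R v \<le> phi \<gamma> R (h * v)"
      using x1[of v] phi_pos[OF v(1)] v(1) by (simp add: pos_less_divide_eq x0_def)
    ultimately show ?thesis by (simp add: algebra_simps)
  qed
  show ?thesis
    using eventually_ge_at_top[of b0]
  proof eventually_elim
    case (elim b)
    let ?F = "phi \<gamma> R b" and ?g = "level_rate R b"
    have b: "x0 \<le> b" "0 < b" using elim x0 by (auto simp: b0_def)
    note g = measurable_level_rate[OF R_cont b(2)]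
    have F: "0 < ?F" by (rule phi_pos[OF b(1)])
    have g_tail: "(\<integral>\<^sup>+w. indicator {v..} w * ?g w \<partial>lborel) = ennreal (\<gamma> * phi \<gamma> R v)" if "b \<le> v" for v
      using that b(1) by (subst nn_integral_tail[symmetric]) (auto intro!: nn_integral_cong simp: indicator_def level_rate_def)
    have total: "ennreal (1 / \<gamma>) * (\<integral>\<^sup>+w. ?g w \<partial>lborel) = ennreal ?F"
    proof -
      have "(\<integral>\<^sup>+w. ?g w \<partial>lborel) = (\<integral>\<^sup>+w. indicator {b..} w * ?g w \<partial>lborel)"
        by (intro nn_integral_cong) (auto simp: indicator_def level_rate_def)
      then show ?thesis using g_tail[of b] gamma_pos F by (simp add: ennreal_mult[symmetric])
    qed
    have G: "U (\<lambda>z. indicator {0..} z * ?g (v + z)) \<le> ennreal (2 * \<epsilon> * ?F)" if v: "b \<le> v" for v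
    proof -
      have "(\<integral>\<^sup>+w. indicator {v..<v + n} w * ?g w \<partial>lborel) = ennreal (\<gamma> * (phi \<gamma> R v - phi \<gamma> R (v + n)))"
        using v b n by (subst nn_integral_interval[symmetric]) (auto intro!: nn_integral_cong simp: indicator_def level_rate_def)
      then have "U (\<lambda>z. indicator {0..} z * ?g (v + z))
          \<le> ennreal (1 / \<gamma>) * ennreal (\<gamma> * (phi \<gamma> R v - phi \<gamma> R (v + n))) + ennreal (\<epsilon> / \<gamma>) * ennreal (\<gamma> * phi \<gamma> R v)"
        using U_le[OF g, of v] g_tail[OF v] by simp
      also have "\<dots> = ennreal ((phi \<gamma> R v - phi \<gamma> R (v + n)) + \<epsilon> * phi \<gamma> R v)"
        using gamma_pos \<epsilon> v b n phi_antimono[of v "v + n"] phi_nonneg[of v]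
        by (simp add: ennreal_mult[symmetric] ennreal_plus[symmetric] del: ennreal_plus)
      also have "\<dots> \<le> ennreal (2 * \<epsilon> * ?F)"
      proof (rule ennreal_leI)
        have "\<epsilon> * phi \<gamma> R v \<le> \<epsilon> * ?F" using v b \<epsilon> by (intro mult_left_mono phi_antimono) auto
        then show "(phi \<gamma> R v - phi \<gamma> R (v + n)) + \<epsilon> * phi \<gamma> R v \<le> 2 * \<epsilon> * ?F"
          using drop[of v] v elim by simp
      qed
      finally show ?thesis .
    qed
    \<comment> \<open>Starting points beyond \<open>y\<close> lose at most an \<epsilon> fraction of
      the tail integral.\<close>
    obtain y where y: "x0 \<le> y" "phi \<gamma> R y \<le> \<epsilon> * ?F" using phi_eventually_small[of "\<epsilon> * ?F"] \<epsilon> F by auto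
    have "clock_concentrated R b ?F (\<kappa> * ?F\<^sup>2) x" if x: "max b y \<le> x" for x
    proof -
      have bx: "b \<le> x" and yx: "y \<le> x" using x by auto
      have tail: "ennreal (1 / \<gamma>) * (\<integral>\<^sup>+w. indicator {x..} w * ?g w \<partial>lborel) \<le> ennreal (\<epsilon> * ?F)"
        using g_tail[OF bx] phi_antimono[OF y(1) yx] y(2) gamma_pos phi_nonneg[of x] bx b
        by (simp add: ennreal_mult[symmetric] ennreal_leI)
      have g0: "?g w = 0" if "w < b" for w using that by (simp add: level_rate_def)
      have \<epsilon>2: "0 \<le> 2 * \<epsilon>" "0 \<le> \<epsilon> * ?F" using \<epsilon> F by auto
      note dev = clock_deviation_le[OF g g0 bx total less_imp_le[OF F] \<epsilon>2(1) G \<epsilon>2(2) tail]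
      have "4 * (2 * \<epsilon>) * ?F\<^sup>2 + 2 * ?F * (\<epsilon> * ?F) = 10 * \<epsilon> * ?F\<^sup>2"
        by (simp add: power2_eq_square)
      also have "\<dots> \<le> \<kappa> * ?F\<^sup>2" using \<epsilon> by (intro mult_right_mono) auto
      finally show ?thesis
        unfolding clock_concentrated_def using dev(1) order_trans[OF dev(2) ennreal_leI] by blast
    qed
    then show ?case using b F by (intro conjI exI[of _ "max b y"]) auto
  qed
qed

subsection \<open>Descent from infinity\<close>

lemma INF_Collect_eq_if: "(INF q\<in>{q. P q}. f q) = (INF q. if P q then f q else (top :: ennreal))"
proof (rule antisym)
  show "(INF q\<in>{q. P q}. f q) \<le> (INF q. if P q then f q else top)"
    by (rule INF_greatest) (auto intro: INF_lower)
  show "(INF q. if P q then f q else top) \<le> (INF q\<in>{q. P q}. f q)"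
  proof (rule INF_greatest)
    fix q assume "q \<in> {q. P q}"
    then show "(INF q. if P q then f q else top) \<le> f q" by (intro INF_lower2[of q]) auto
  qed
qed

lemma min_ennreal: "min (ennreal x) (ennreal y) = ennreal (min x y)"
  by (metis ennreal_leI linorder_linear min.absorb1 min.absorb2)

text \<open>Absolute values turn the enumeration of all rationals into one of the nonnegative
  rationals; repetitions do no harm to an infimum.\<close>

definition rat_seq :: "nat \<Rightarrow> real" where
  "rat_seq i = \<bar>of_rat (nat_to_rat_surj i)\<bar>"

lemma rat_seq_nonneg: "0 \<le> rat_seq i"
  by (simp add: rat_seq_def)

lemma first_below_eq_INF_nat:
  "first_below p b = (INF i. if p (rat_seq i) < b then ennreal (rat_seq i) else top)"
proof (rule antisym)
  show "first_below p b \<le> (INF i. if p (rat_seq i) < b then ennreal (rat_seq i) else top)"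
  proof (rule INF_greatest)
    fix i
    have "rat_seq i = of_rat \<bar>nat_to_rat_surj i\<bar>"
      by (auto simp: rat_seq_def abs_if of_rat_minus)
    then show "first_below p b \<le> (if p (rat_seq i) < b then ennreal (rat_seq i) else top)"
      unfolding first_below_def by (auto intro!: INF_lower2[of "\<bar>nat_to_rat_surj i\<bar>"])
  qed
  show "(INF i. if p (rat_seq i) < b then ennreal (rat_seq i) else top) \<le> first_below p b"
    unfolding first_below_def
  proof (rule INF_greatest)
    fix q :: rat assume q: "q \<in> {q. 0 \<le> q \<and> p (of_rat q) < b}"
    obtain i where "q = nat_to_rat_surj i" using surj_nat_to_rat_surj by (metis surjD)
    then have "rat_seq i = of_rat q" using q by (simp add: rat_seq_def)
    then show "(INF i. if p (rat_seq i) < b then ennreal (rat_seq i) else top) \<le> ennreal (of_rat q)"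
      using q by (intro INF_lower2[of i]) auto
  qed
qed

text \<open>A bounded measurable function of \<open>n\<close> coordinates, the kind of test function
  to which the Markov property applies; the bound \<open>K\<close> also handles the infinite value
  when no coordinate is below \<open>b\<close>.\<close>

definition truncated_first_below :: "real \<Rightarrow> real \<Rightarrow> nat \<Rightarrow> (nat \<Rightarrow> real) \<Rightarrow> real" where
  "truncated_first_below K b n p =
     enn2real (min (ennreal K) (INF i\<in>{..<n}. if p i < b then ennreal (rat_seq i) else top))"

lemma truncated_first_below_bounds: "0 \<le> K \<Longrightarrow> 0 \<le> truncated_first_below K b n p \<and> truncated_first_below K b n p \<le> K"
  unfolding truncated_first_below_def
  by (auto intro: order_trans[OF enn2real_mono[of _ "ennreal K"]])

lemma truncated_first_below_tendsto:
  assumes "0 \<le> K"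
  shows "(\<lambda>n. truncated_first_below K b n (\<lambda>i\<in>{..<n}. p (rat_seq i))) \<longlonglongrightarrow> enn2real (min (ennreal K) (first_below p b))"
proof -
  let ?a = "\<lambda>i. if p (rat_seq i) < b then ennreal (rat_seq i) else top"
  have "(\<lambda>n. INF i\<in>{..<n}. ?a i) \<longlonglongrightarrow> (INF n. INF i\<in>{..<n}. ?a i)"
    by (intro LIMSEQ_INF decseq_SucI INF_superset_mono) auto
  also have "(INF n. INF i\<in>{..<n}. ?a i) = (INF i. ?a i)"
  proof (rule antisym)
    show "(INF n. INF i\<in>{..<n}. ?a i) \<le> (INF i. ?a i)"
    proof (rule INF_greatest)
      fix i
      have "(INF n. INF i\<in>{..<n}. ?a i) \<le> (INF i\<in>{..<Suc i}. ?a i)" by (rule INF_lower) simp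
      also have "\<dots> \<le> ?a i" by (rule INF_lower) simp
      finally show "(INF n. INF i\<in>{..<n}. ?a i) \<le> ?a i" .
    qed
    show "(INF i. ?a i) \<le> (INF n. INF i\<in>{..<n}. ?a i)"
      by (intro INF_greatest INF_superset_mono) auto
  qed
  finally have "(\<lambda>n. min (ennreal K) (INF i\<in>{..<n}. ?a i)) \<longlonglongrightarrow> min (ennreal K) (first_below p b)"
    unfolding first_below_eq_INF_nat by (intro tendsto_min tendsto_const)
  moreover have "min (ennreal K) (first_below p b) = ennreal (enn2real (min (ennreal K) (first_below p b)))"
    by (simp add: min_less_iff_disj)
  ultimately have "(\<lambda>n. enn2real (min (ennreal K) (INF i\<in>{..<n}. ?a i))) \<longlonglongrightarrow> enn2real (min (ennreal K) (first_below p b))"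
    by (intro tendsto_enn2real) auto
  moreover have "truncated_first_below K b n (\<lambda>i\<in>{..<n}. p (rat_seq i)) = enn2real (min (ennreal K) (INF i\<in>{..<n}. ?a i))" for n
    unfolding truncated_first_below_def by (intro arg_cong[where f = "\<lambda>x. enn2real (min (ennreal K) x)"] INF_cong) auto
  ultimately show ?thesis by simp
qed

text \<open>Truncation at a level \<open>K \<ge> F\<close> moves values only towards
  \<open>F\<close>.\<close>

lemma truncated_deviation_le:
  assumes "F \<le> K" "0 \<le> F" "a < \<infinity>"
  shows "(enn2real (min (ennreal K) a) - F)\<^sup>2 \<le> (enn2real a - F)\<^sup>2"
proof -
  obtain r where r: "a = ennreal r" "0 \<le> r" using assms(3) by (cases a) auto
  have "\<bar>min K r - F\<bar> \<le> \<bar>r - F\<bar>" using assms(1) by (auto simp: min_def abs_if)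
  then show ?thesis using r assms by (simp add: min_ennreal abs_le_square_iff)
qed

section \<open>The Markov property of the process from infinity at a fixed time\<close>

locale entrance_process = levy_negative_drift M L \<Psi> \<gamma> C
  for M :: "'a measure" and L \<Psi> \<gamma> C +
  fixes R :: "real \<Rightarrow> real" and N :: "'b measure" and Y :: "real \<Rightarrow> 'b \<Rightarrow> real"
  assumes R_cont: "continuous_on {0..} R" and R_pos: "\<And>x. 0 < x \<Longrightarrow> 0 < R x"
    and entrance: "entrance_from_infinity M L R N Y"
begin

sublocale N: prob_space N
  using entrance by (simp add: entrance_from_infinity_def)

lemma measurable_Y: "0 < t \<Longrightarrow> Y t \<in> borel_measurable N"
  using entrance by (simp add: entrance_from_infinity_def)

lemma Y_right_continuous: "\<omega> \<in> space N \<Longrightarrow> 0 < t \<Longrightarrow> ((\<lambda>s. Y s \<omega>) \<longlongrightarrow> Y t \<omega>) (at_right t)"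
  using entrance by (simp add: entrance_from_infinity_def)

lemma Y_at_0: "\<omega> \<in> space N \<Longrightarrow> filterlim (\<lambda>s. Y s \<omega>) at_top (at_right 0)"
  using entrance by (simp add: entrance_from_infinity_def)

text \<open>The strong Markov property at a constant positive stopping time, with the conditioning
  event restricted to one described by the position at that time.\<close>

lemma Markov_fixed_time:
  fixes f :: "(nat \<Rightarrow> real) \<Rightarrow> real" and ts :: "nat \<Rightarrow> real"
  assumes t: "0 < t" and B: "B \<in> sets borel" and ts: "\<And>i. 0 \<le> ts i"
    and f: "f \<in> borel_measurable (PiM {..<n} (\<lambda>_. borel))" "bounded (range f)"
  shows "(\<integral>\<omega>. indicator (Y t -` B \<inter> space N) \<omega> * f (\<lambda>i\<in>{..<n}. Y (t + ts i) \<omega>) \<partial>N)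
       = (\<integral>\<omega>. indicator (Y t -` B \<inter> space N) \<omega> *
            (\<integral>\<omega>'. f (\<lambda>i\<in>{..<n}. Xpath R (\<lambda>s. Y t \<omega> + L s \<omega>') (ts i)) \<partial>M) \<partial>N)"
proof -
  let ?A = "Y t -` B \<inter> space N"
  have space: "space (nat_filtration N Y s) = space N" for s
    by (simp add: nat_filtration_def space_measure_of_conv)
  have A: "?A \<in> sets (nat_filtration N Y s)" if "t \<le> s" for s
    unfolding nat_filtration_def using that t B by (subst sets_measure_of) (auto intro!: sigma_sets.Basic)
  have stop: "stopping_time (nat_filtration N Y) (\<lambda>_. t)"
    by (simp add: stopping_time_def)
  have adapted: "\<forall>s. {\<omega> \<in> ?A. t \<le> s} \<in> sets (nat_filtration N Y s)"
  proof
    fix s show "{\<omega> \<in> ?A. t \<le> s} \<in> sets (nat_filtration N Y s)"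
    proof (cases "t \<le> s")
      case True
      then have "{\<omega> \<in> ?A. t \<le> s} = ?A" by blast
      then show ?thesis using A[OF True] by simp
    next
      case False
      then have "{\<omega> \<in> ?A. t \<le> s} = {}" by simp
      then show ?thesis by (simp only: sets.empty_sets)
    qed
  qed
  have stop': "stopping_time (nat_filtration N Y) (\<lambda>_. t) \<and> (\<forall>\<omega>\<in>space N. 0 < t)"
    using stop t by simp
  note at_t = entrance[unfolded entrance_from_infinity_def, THEN conjunct2, THEN conjunct2, THEN conjunct2,
      THEN spec[of _ "\<lambda>_. t"], THEN mp, OF stop', THEN spec[of _ ?A], THEN mp, OF conjI[OF Int_lower2 adapted],
      THEN spec[of _ n], THEN spec[of _ ts], THEN spec[of _ f], THEN mp]
  show ?thesis by (rule at_t) (intro conjI allI impI ts f)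
qed

lemma measurable_Xpath_start[measurable (raw)]:
  assumes [measurable]: "f \<in> borel_measurable K" "g \<in> measurable K M"
  shows "(\<lambda>p. Xpath R (\<lambda>s. f p + L s (g p)) q) \<in> borel_measurable K"
proof -
  have "(\<lambda>p. Xpath R (\<lambda>s. (\<lambda>s (x, \<omega>). x + Z s \<omega>) s p) q) \<in> borel_measurable (borel \<Otimes>\<^sub>M M)"
  proof (rule measurable_Xpath[OF _ _ R_cont])
    show "((\<lambda>s. case p of (x, \<omega>) \<Rightarrow> x + Z s \<omega>) \<longlongrightarrow> (case p of (x, \<omega>) \<Rightarrow> x + Z t \<omega>)) (at_right t)"
      if "p \<in> space (borel \<Otimes>\<^sub>M M)" for p t
      using that Z_right_continuous[of "snd p" t]
      by (auto simp: space_pair_measure split_beta' intro!: tendsto_intros)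
  qed measurable
  from measurable_compose[OF measurable_Pair[OF assms] this]
  have "(\<lambda>p. Xpath R (\<lambda>s. f p + Z s (g p)) q) \<in> borel_measurable K" by simp
  moreover have "Xpath R (\<lambda>s. f p + Z s (g p)) q = Xpath R (\<lambda>s. f p + L s (g p)) q" for p
    by (rule Xpath_cong) (simp add: Z_eq_L)
  ultimately show ?thesis by simp
qed

lemma measurable_first_below_Y:
  assumes "0 < t" shows "(\<lambda>\<omega>. first_below (\<lambda>s. Y (t + s) \<omega>) b) \<in> borel_measurable N"
proof -
  have [measurable]: "Y (t + rat_seq i) \<in> borel_measurable N" for i
    using assms rat_seq_nonneg[of i] by (intro measurable_Y) simp
  show ?thesis unfolding first_below_eq_INF_nat by measurable
qed

text \<open>On both sides of the Markov identity the number of coordinates goes to infinity under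
  the uniform bound \<open>(K + F)\<^sup>2\<close>. The inner expectation is then the truncated
  deviation of a clock started at a level at least \<open>y0\<close>, which is bounded by
  \<eta>.\<close>

lemma shifted_deviation_le:
  assumes t: "0 < t" and b: "0 < b" "b \<le> y0" and K: "F \<le> K" "0 \<le> F" and \<eta>: "0 \<le> \<eta>"
    and dev: "\<And>x. y0 \<le> x \<Longrightarrow> clock_concentrated R b F \<eta> x"
  shows "(\<integral>\<^sup>+\<omega>. ennreal (indicator (Y t -` {y0..} \<inter> space N) \<omega> *
            (enn2real (min (ennreal K) (first_below (\<lambda>s. Y (t + s) \<omega>) b)) - F)\<^sup>2) \<partial>N) \<le> ennreal \<eta>"
proof -
  let ?A = "Y t -` {y0..} \<inter> space N"
  note [measurable] = measurable_Y[OF t]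
  have [measurable]: "?A \<in> sets N" by (rule measurable_sets) measurable
  have K0: "0 \<le> K" using K by simp
  define D where "D r = (r - F)\<^sup>2" for r
  have [measurable]: "D \<in> borel_measurable borel" unfolding D_def by measurable
  have D_bound: "0 \<le> D r \<and> D r \<le> (K + F)\<^sup>2" if "0 \<le> r" "r \<le> K" for r
  proof -
    have "\<bar>r - F\<bar> \<le> \<bar>K + F\<bar>" using that K by linarith
    then show ?thesis unfolding D_def abs_le_square_iff by simp
  qed
  have D_tendsto: "(\<lambda>n. D (x n)) \<longlonglongrightarrow> D y" if "x \<longlonglongrightarrow> y" for x y
    unfolding D_def using that by (intro tendsto_intros)
  define f where "f n p = D (truncated_first_below K b n p)" for n p
  have f_bound: "0 \<le> f n p \<and> f n p \<le> (K + F)\<^sup>2" for n p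
    unfolding f_def using truncated_first_below_bounds[OF K0] by (intro D_bound) auto
  have f_meas[measurable]: "f n \<in> borel_measurable (PiM {..<n} (\<lambda>_. borel))" for n
    unfolding f_def truncated_first_below_def by measurable
  define lim where "lim p = D (enn2real (min (ennreal K) (first_below p b)))" for p
  have f_lim: "(\<lambda>n. f n (\<lambda>i\<in>{..<n}. p (rat_seq i))) \<longlonglongrightarrow> lim p" for p
    unfolding f_def lim_def by (intro D_tendsto truncated_first_below_tendsto K0)
  have lim_bound: "0 \<le> lim p \<and> lim p \<le> (K + F)\<^sup>2" for p
    unfolding lim_def by (intro D_bound) (auto intro: order_trans[OF enn2real_mono[of _ "ennreal K"]] simp: K0)
  have [measurable]: "Y (t + rat_seq i) \<in> borel_measurable N" for i
    using t rat_seq_nonneg[of i] by (intro measurable_Y) simp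
  have lim_meas[measurable]: "(\<lambda>\<omega>. lim (\<lambda>s. Y (t + s) \<omega>)) \<in> borel_measurable N"
    unfolding lim_def using measurable_first_below_Y[OF t] by measurable
  have lim_X[measurable]: "(\<lambda>(x, \<omega>). lim (Xpath R (\<lambda>s. x + L s \<omega>))) \<in> borel_measurable (borel \<Otimes>\<^sub>M M)"
    unfolding lim_def first_below_eq_INF_nat by measurable
  have left: "(\<lambda>n. \<integral>\<omega>. indicator ?A \<omega> * f n (\<lambda>i\<in>{..<n}. Y (t + rat_seq i) \<omega>) \<partial>N)
      \<longlonglongrightarrow> (\<integral>\<omega>. indicator ?A \<omega> * lim (\<lambda>s. Y (t + s) \<omega>) \<partial>N)"
  proof (rule integral_dominated_convergence[where w = "\<lambda>_. (K + F)\<^sup>2"])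
    show "AE \<omega> in N. (\<lambda>n. indicator ?A \<omega> * f n (\<lambda>i\<in>{..<n}. Y (t + rat_seq i) \<omega>)) \<longlonglongrightarrow> indicator ?A \<omega> * lim (\<lambda>s. Y (t + s) \<omega>)"
      using f_lim[of "\<lambda>s. Y (t + s) _"] by (intro always_eventually allI tendsto_mult tendsto_const)
    show "AE \<omega> in N. norm (indicator ?A \<omega> * f n (\<lambda>i\<in>{..<n}. Y (t + rat_seq i) \<omega>)) \<le> (K + F)\<^sup>2" for n
      using f_bound by (auto simp: indicator_def)
  qed auto
  define J where "J n x = (\<integral>\<omega>'. f n (\<lambda>i\<in>{..<n}. Xpath R (\<lambda>s. x + L s \<omega>') (rat_seq i)) \<partial>M)" for n x
  define J' where "J' x = (\<integral>\<omega>'. lim (Xpath R (\<lambda>s. x + L s \<omega>')) \<partial>M)" for x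
  have int_f: "integrable M (\<lambda>\<omega>'. f n (\<lambda>i\<in>{..<n}. Xpath R (\<lambda>s. x + L s \<omega>') (rat_seq i)))" for n x
    by (rule integrable_const_bound[where B = "(K + F)\<^sup>2"]) (use f_bound in auto)
  have [measurable]: "J n \<in> borel_measurable borel" for n
    unfolding J_def by measurable
  have [measurable]: "J' \<in> borel_measurable borel" unfolding J'_def by measurable
  have J_lim: "(\<lambda>n. J n x) \<longlonglongrightarrow> J' x" for x
    unfolding J_def J'_def
    by (rule integral_dominated_convergence[where w = "\<lambda>_. (K + F)\<^sup>2"]) (use f_bound f_lim in auto)
  have J_bound: "\<bar>J n x\<bar> \<le> (K + F)\<^sup>2" for n x
  proof -
    have "0 \<le> J n x" unfolding J_def using f_bound by (intro Bochner_Integration.integral_nonneg) auto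
    moreover have "J n x \<le> (K + F)\<^sup>2" unfolding J_def using f_bound int_f by (intro integral_le_const) auto
    ultimately show ?thesis by simp
  qed
  have right: "(\<lambda>n. \<integral>\<omega>. indicator ?A \<omega> * J n (Y t \<omega>) \<partial>N) \<longlonglongrightarrow> (\<integral>\<omega>. indicator ?A \<omega> * J' (Y t \<omega>) \<partial>N)"
  proof (rule integral_dominated_convergence[where w = "\<lambda>_. (K + F)\<^sup>2"])
    show "AE \<omega> in N. (\<lambda>n. indicator ?A \<omega> * J n (Y t \<omega>)) \<longlonglongrightarrow> indicator ?A \<omega> * J' (Y t \<omega>)"
      by (intro always_eventually allI tendsto_mult tendsto_const J_lim)
    show "AE \<omega> in N. norm (indicator ?A \<omega> * J n (Y t \<omega>)) \<le> (K + F)\<^sup>2" for n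
      using J_bound by (auto simp: indicator_def)
  qed auto
  have "(\<integral>\<omega>. indicator ?A \<omega> * f n (\<lambda>i\<in>{..<n}. Y (t + rat_seq i) \<omega>) \<partial>N) = (\<integral>\<omega>. indicator ?A \<omega> * J n (Y t \<omega>) \<partial>N)" for n
    unfolding J_def using f_bound
    by (intro Markov_fixed_time t rat_seq_nonneg f_meas) (auto simp: bounded_iff intro!: exI[of _ "(K + F)\<^sup>2"])
  with left right have eq: "(\<integral>\<omega>. indicator ?A \<omega> * lim (\<lambda>s. Y (t + s) \<omega>) \<partial>N) = (\<integral>\<omega>. indicator ?A \<omega> * J' (Y t \<omega>) \<partial>N)"
    by (simp add: LIMSEQ_unique)
  have J'_le: "0 \<le> J' x \<and> J' x \<le> \<eta>" if x: "y0 \<le> x" for x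
  proof
    show "0 \<le> J' x" unfolding J'_def using lim_bound by (intro Bochner_Integration.integral_nonneg) auto
    have int: "integrable M (\<lambda>\<omega>. lim (Xpath R (\<lambda>s. x + L s \<omega>)))"
      by (rule integrable_const_bound[where B = "(K + F)\<^sup>2"]) (use lim_bound in auto)
    have "ennreal (J' x) = (\<integral>\<^sup>+\<omega>. ennreal (lim (Xpath R (\<lambda>s. x + L s \<omega>))) \<partial>M)"
      unfolding J'_def by (rule nn_integral_eq_integral[symmetric, OF int]) (use lim_bound in auto)
    also have "\<dots> \<le> (\<integral>\<^sup>+\<omega>. ennreal ((enn2real (clock (\<lambda>y. level_rate R b (x + y)) (x - b) \<omega>) - F)\<^sup>2) \<partial>M)"
    proof (rule nn_integral_mono_AE)
      have fin: "AE \<omega> in M. clock (\<lambda>y. level_rate R b (x + y)) (x - b) \<omega> < \<infinity>"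
        using dev[OF x] by (simp add: clock_concentrated_def)
      have "AE \<omega> in M. first_below (Xpath R (\<lambda>s. x + L s \<omega>)) b = clock (\<lambda>y. level_rate R b (x + y)) (x - b) \<omega>"
        using b x by (intro AE_first_below_Xpath R_cont R_pos fin) auto
      with fin show "AE \<omega> in M. ennreal (lim (Xpath R (\<lambda>s. x + L s \<omega>)))
          \<le> ennreal ((enn2real (clock (\<lambda>y. level_rate R b (x + y)) (x - b) \<omega>) - F)\<^sup>2)"
        by eventually_elim (auto simp: lim_def D_def intro!: ennreal_leI truncated_deviation_le K)
    qed
    also have "\<dots> \<le> ennreal \<eta>" using dev[OF x] by (simp add: clock_concentrated_def)
    finally show "J' x \<le> \<eta>" using \<eta> by (simp add: ennreal_le_iff)
  qed
  have int_J': "integrable N (\<lambda>\<omega>. indicator ?A \<omega> * J' (Y t \<omega>))"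
    by (rule N.integrable_const_bound[where B = \<eta>]) (use J'_le \<eta> in \<open>auto simp: indicator_def\<close>)
  have "(\<integral>\<^sup>+\<omega>. ennreal (indicator ?A \<omega> * lim (\<lambda>s. Y (t + s) \<omega>)) \<partial>N)
      = ennreal (\<integral>\<omega>. indicator ?A \<omega> * lim (\<lambda>s. Y (t + s) \<omega>) \<partial>N)"
  proof (rule nn_integral_eq_integral)
    show "integrable N (\<lambda>\<omega>. indicator ?A \<omega> * lim (\<lambda>s. Y (t + s) \<omega>))"
      by (rule N.integrable_const_bound[where B = "(K + F)\<^sup>2"]) (use lim_bound in \<open>auto simp: indicator_def\<close>)
  qed (use lim_bound in auto)
  also have "\<dots> \<le> ennreal \<eta>"
    unfolding eq by (intro ennreal_leI N.integral_le_const int_J') (use J'_le \<eta> in \<open>auto simp: indicator_def\<close>)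
  finally show ?thesis by (simp add: lim_def D_def)
qed

section \<open>The passage time from infinity\<close>

definition passage :: "real \<Rightarrow> 'b \<Rightarrow> ennreal" where
  "passage b \<omega> = (INF q\<in>{q::rat. 0 < q \<and> Y (of_rat q) \<omega> < b}. ennreal (of_rat q))"

lemma measurable_passage[measurable]: "passage b \<in> borel_measurable N"
proof -
  have [measurable]: "(\<lambda>\<omega>. if 0 < q \<and> Y (of_rat q) \<omega> < b then ennreal (of_rat q) else top) \<in> borel_measurable N" for q :: rat
    using measurable_Y[of "of_rat q"] by (cases "0 < q") (auto simp: zero_less_of_rat_iff)
  show ?thesis unfolding passage_def INF_Collect_eq_if by measurable
qed

text \<open>The shift is rational so that translation maps the rational times after \<open>r\<close>
  onto the rational delays.\<close>

lemma passage_shift: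
  assumes r: "0 < (r :: rat)" and above: "\<And>u. 0 < u \<Longrightarrow> u \<le> of_rat r \<Longrightarrow> b \<le> Y u \<omega>"
  shows "passage b \<omega> = ennreal (of_rat r) + first_below (\<lambda>s. Y (of_rat r + s) \<omega>) b"
proof (rule antisym)
  have r': "0 < (of_rat r :: real)" using r by (simp add: zero_less_of_rat_iff)
  have "passage b \<omega> - ennreal (of_rat r) \<le> first_below (\<lambda>s. Y (of_rat r + s) \<omega>) b"
    unfolding first_below_def
  proof (rule INF_greatest)
    fix q :: rat assume q: "q \<in> {q. 0 \<le> q \<and> Y (of_rat r + of_rat q) \<omega> < b}"
    then have "passage b \<omega> \<le> ennreal (of_rat (r + q))"
      unfolding passage_def using r by (intro INF_lower) (auto simp: of_rat_add)
    also have "\<dots> = ennreal (of_rat r) + ennreal (of_rat q)"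
      using q r by (subst ennreal_plus[symmetric]) (auto simp: of_rat_add zero_le_of_rat_iff)
    finally show "passage b \<omega> - ennreal (of_rat r) \<le> ennreal (of_rat q)"
      by (simp add: ennreal_minus_le_iff)
  qed
  then show "passage b \<omega> \<le> ennreal (of_rat r) + first_below (\<lambda>s. Y (of_rat r + s) \<omega>) b"
    by (simp add: ennreal_minus_le_iff)
  show "ennreal (of_rat r) + first_below (\<lambda>s. Y (of_rat r + s) \<omega>) b \<le> passage b \<omega>"
    unfolding passage_def
  proof (rule INF_greatest)
    fix q :: rat assume q: "q \<in> {q. 0 < q \<and> Y (of_rat q) \<omega> < b}"
    have "r < q"
    proof (rule ccontr)
      assume "\<not> r < q"
      then show False using above[of "of_rat q"] q by (auto simp: zero_less_of_rat_iff of_rat_less_eq)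
    qed
    then have "first_below (\<lambda>s. Y (of_rat r + s) \<omega>) b \<le> ennreal (of_rat (q - r))"
      unfolding first_below_def using q by (intro INF_lower) (auto simp: of_rat_diff)
    then have "ennreal (of_rat r) + first_below (\<lambda>s. Y (of_rat r + s) \<omega>) b \<le> ennreal (of_rat r) + ennreal (of_rat (q - r))"
      by (rule add_left_mono)
    also have "\<dots> = ennreal (of_rat q)"
      using \<open>r < q\<close> r by (subst ennreal_plus[symmetric]) (auto simp: of_rat_diff zero_le_of_rat_iff of_rat_less_eq)
    finally show "ennreal (of_rat r) + first_below (\<lambda>s. Y (of_rat r + s) \<omega>) b \<le> ennreal (of_rat q)" .
  qed
qed

text \<open>Right-continuity makes the infima over real and rational times agree. If the level is
  never passed, the real infimum of the empty set is carried along as a constant, which keeps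
  measurability on the whole space.\<close>

lemma hit_below_eq_passage:
  assumes \<omega>: "\<omega> \<in> space N"
  shows "hit_below (\<lambda>t. Y t \<omega>) b = (if passage b \<omega> = top then Inf {} else enn2real (passage b \<omega>))"
proof -
  let ?S = "{t. 0 < t \<and> Y t \<omega> < b}"
  have near: "passage b \<omega> \<le> ennreal (t + d)" if t: "t \<in> ?S" and d: "0 < d" for t d
  proof -
    have "0 < t" "Y t \<omega> < b" using t by auto
    obtain c where c: "t < c" "\<And>r. t < r \<Longrightarrow> r < c \<Longrightarrow> Y r \<omega> < b"
      using order_tendstoD(2)[OF Y_right_continuous[OF \<omega> \<open>0 < t\<close>] \<open>Y t \<omega> < b\<close>] unfolding eventually_at_right_field by blast
    obtain q where q: "t < of_rat q" "of_rat q < min c (t + d)" using of_rat_dense[of t "min c (t + d)"] c(1) d by auto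
    have "0 < (of_rat q :: real)" using q \<open>0 < t\<close> by linarith
    then have "passage b \<omega> \<le> ennreal (of_rat q)"
      unfolding passage_def using q c by (intro INF_lower) (auto simp: zero_less_of_rat_iff)
    also have "\<dots> \<le> ennreal (t + d)" using q by (intro ennreal_leI) simp
    finally show ?thesis .
  qed
  show ?thesis
  proof (cases "passage b \<omega> = top")
    case True
    have "?S = {}"
    proof (rule ccontr)
      assume "?S \<noteq> {}"
      then obtain t where "t \<in> ?S" by blast
      with near[OF this, of 1] True show False by (simp add: top_unique)
    qed
    then show ?thesis using True by (simp only: hit_below_def if_True simp_thms)
  next
    case False
    then obtain x where x: "passage b \<omega> = ennreal x" "0 \<le> x" by (cases "passage b \<omega>") auto
    have "\<exists>q::rat. 0 < q \<and> Y (of_rat q) \<omega> < b"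
    proof (rule ccontr)
      assume "\<not> (\<exists>q::rat. 0 < q \<and> Y (of_rat q) \<omega> < b)"
      then have "{q::rat. 0 < q \<and> Y (of_rat q) \<omega> < b} = {}" by blast
      then show False using False by (simp only: passage_def) simp
    qed
    then obtain q :: rat where "0 < (of_rat q :: real)" "Y (of_rat q) \<omega> < b" by (auto simp: zero_less_of_rat_iff)
    then have ne: "?S \<noteq> {}" by blast
    have bdd: "bdd_below ?S" by (rule bdd_belowI[of _ 0]) auto
    have "Inf ?S = x"
    proof (rule antisym)
      have "ennreal (Inf ?S) \<le> passage b \<omega>"
        unfolding passage_def
        by (intro INF_greatest ennreal_leI cInf_lower bdd) (auto simp: zero_less_of_rat_iff)
      then show "Inf ?S \<le> x" using x by (simp add: ennreal_le_iff)
      show "x \<le> Inf ?S"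
      proof (rule cInf_greatest[OF ne])
        fix t assume t: "t \<in> ?S"
        show "x \<le> t"
        proof (rule field_le_epsilon)
          fix d :: real assume "0 < d"
          then show "x \<le> t + d" using near[OF t, of d] t x by (simp add: ennreal_le_iff del: ennreal_plus)
        qed
      qed
    qed
    then show ?thesis using False x by (simp add: hit_below_def)
  qed
qed

lemma measurable_hit_below[measurable]: "(\<lambda>\<omega>. hit_below (\<lambda>t. Y t \<omega>) b) \<in> borel_measurable N"
proof -
  have "(\<lambda>\<omega>. if passage b \<omega> = top then Inf {} else enn2real (passage b \<omega>)) \<in> borel_measurable N" by measurable
  then show ?thesis by (subst measurable_cong[OF hit_below_eq_passage]) auto
qed

text \<open>Along times \<open>1 / Suc n\<close> the path from infinity is eventually above
  \<open>y0\<close>, so the restriction to that event disappears and the shifted passage time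
  differs from the true one by \<open>t n\<close>. Fatou's lemma transfers the bound, which is
  uniform in \<open>n\<close>.\<close>

lemma truncated_passage_deviation_le:
  assumes b: "0 < b" "b \<le> y0" and K: "F \<le> K" "0 \<le> F" and \<eta>: "0 \<le> \<eta>"
    and dev: "\<And>x. y0 \<le> x \<Longrightarrow> clock_concentrated R b F \<eta> x"
  shows "(\<integral>\<^sup>+\<omega>. ennreal ((enn2real (min (ennreal K) (passage b \<omega>)) - F)\<^sup>2) \<partial>N) \<le> ennreal \<eta>"
proof -
  define r :: "nat \<Rightarrow> rat" where "r n = 1 / of_nat (Suc n)" for n
  define t :: "nat \<Rightarrow> real" where "t n = of_rat (r n)" for n
  have r: "0 < r n" for n by (simp add: r_def)
  have t: "0 < t n" for n using r[of n] by (simp add: t_def zero_less_of_rat_iff)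
  have t_eq: "t n = inverse (real (Suc n))" for n
    by (simp add: t_def r_def of_rat_divide inverse_eq_divide del: of_nat_Suc)
  have t_lim: "t \<longlonglongrightarrow> 0" using LIMSEQ_inverse_real_of_nat by (simp add: t_eq[abs_def] del: of_nat_Suc)
  let ?S = "\<lambda>n \<omega>. first_below (\<lambda>s. Y (t n + s) \<omega>) b"
  let ?u = "\<lambda>n \<omega>. ennreal (indicator (Y (t n) -` {y0..} \<inter> space N) \<omega> * (enn2real (min (ennreal K) (?S n \<omega>)) - F)\<^sup>2)"
  have lim: "(\<lambda>n. ?u n \<omega>) \<longlonglongrightarrow> ennreal ((enn2real (min (ennreal K) (passage b \<omega>)) - F)\<^sup>2)" if \<omega>: "\<omega> \<in> space N" for \<omega>
  proof -
    have "\<forall>\<^sub>F s in at_right 0. y0 \<le> Y s \<omega>"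
      using Y_at_0[OF \<omega>] by (auto simp: filterlim_at_top)
    then obtain c where c: "0 < c" "\<And>s. 0 < s \<Longrightarrow> s < c \<Longrightarrow> y0 \<le> Y s \<omega>"
      unfolding eventually_at_right_field by blast
    have ev: "\<forall>\<^sub>F n in sequentially. t n < c" by (rule order_tendstoD(2)[OF t_lim c(1)])
    have shift: "passage b \<omega> = ennreal (t n) + ?S n \<omega>" if "t n < c" for n
      unfolding t_def
    proof (rule passage_shift[OF r])
      fix u :: real assume "0 < u" "u \<le> of_rat (r n)"
      then show "b \<le> Y u \<omega>" using c(2)[of u] that b by (simp add: t_def)
    qed
    have "(\<lambda>n. enn2real (min (ennreal K) (?S n \<omega>))) \<longlonglongrightarrow> enn2real (min (ennreal K) (passage b \<omega>))"
    proof (cases "passage b \<omega>")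
      case (real p)
      have "(\<lambda>n. min K (p - t n)) \<longlonglongrightarrow> min K (p - 0)" by (intro tendsto_intros t_lim)
      then have "(\<lambda>n. min K (p - t n)) \<longlonglongrightarrow> enn2real (min (ennreal K) (passage b \<omega>))"
        using real K by (simp add: min_ennreal)
      moreover have "\<forall>\<^sub>F n in sequentially. min K (p - t n) = enn2real (min (ennreal K) (?S n \<omega>))"
        using ev
      proof eventually_elim
        case (elim n)
        obtain s where s: "?S n \<omega> = ennreal s" "0 \<le> s" using shift[OF elim] real by (cases "?S n \<omega>") auto
        have "p = t n + s" using shift[OF elim] real s t[of n] by (simp add: ennreal_plus[symmetric] del: ennreal_plus)
        then show ?case using s K by (simp add: min_ennreal)
      qed
      ultimately show ?thesis by (rule Lim_transform_eventually)
    next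
      case top
      have "\<forall>\<^sub>F n in sequentially. enn2real (min (ennreal K) (passage b \<omega>)) = enn2real (min (ennreal K) (?S n \<omega>))"
        using ev
      proof eventually_elim
        case (elim n)
        then have "?S n \<omega> = top" using shift[OF elim] top by (metis ennreal_add_eq_top ennreal_neq_top)
        then show ?case using top by simp
      qed
      then show ?thesis by (rule Lim_transform_eventually[OF tendsto_const])
    qed
    then have "(\<lambda>n. ennreal ((enn2real (min (ennreal K) (?S n \<omega>)) - F)\<^sup>2)) \<longlonglongrightarrow> ennreal ((enn2real (min (ennreal K) (passage b \<omega>)) - F)\<^sup>2)"
      by (rule tendsto_ennrealI[OF tendsto_power[OF tendsto_diff[OF _ tendsto_const]]])
    then show ?thesis
    proof (rule Lim_transform_eventually)
      show "\<forall>\<^sub>F n in sequentially. ennreal ((enn2real (min (ennreal K) (?S n \<omega>)) - F)\<^sup>2) = ?u n \<omega>"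
        using ev by eventually_elim (use c(2) t \<omega> in auto)
    qed
  qed
  have [measurable]: "(\<lambda>\<omega>. ?S n \<omega>) \<in> borel_measurable N" "Y (t n) \<in> borel_measurable N" for n
    using measurable_first_below_Y[OF t] measurable_Y[OF t] by auto
  have "(\<integral>\<^sup>+\<omega>. ennreal ((enn2real (min (ennreal K) (passage b \<omega>)) - F)\<^sup>2) \<partial>N) = (\<integral>\<^sup>+\<omega>. liminf (\<lambda>n. ?u n \<omega>) \<partial>N)"
    by (intro nn_integral_cong lim_imp_Liminf[symmetric] lim) auto
  also have "\<dots> \<le> liminf (\<lambda>n. \<integral>\<^sup>+\<omega>. ?u n \<omega> \<partial>N)" by (rule nn_integral_liminf) measurable
  also have "\<dots> \<le> limsup (\<lambda>n. \<integral>\<^sup>+\<omega>. ?u n \<omega> \<partial>N)" by (rule Liminf_le_Limsup) simp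
  also have "\<dots> \<le> ennreal \<eta>"
    by (intro Limsup_bounded always_eventually allI shifted_deviation_le[OF t b K \<eta> dev])
  finally show ?thesis .
qed

text \<open>The truncation level \<open>F + real n\<close> goes to infinity, again with Fatou's
  lemma. This also proves that the passage time is almost surely finite, so the convention for the
  empty infimum concerns a null set.\<close>

lemma hit_below_deviation_le:
  assumes b: "0 < b" "b \<le> y0" and F: "0 \<le> F" and \<eta>: "0 \<le> \<eta>"
    and dev: "\<And>x. y0 \<le> x \<Longrightarrow> clock_concentrated R b F \<eta> x"
  shows "(\<integral>\<^sup>+\<omega>. ennreal ((hit_below (\<lambda>t. Y t \<omega>) b - F)\<^sup>2) \<partial>N) \<le> ennreal \<eta>"
proof -
  let ?u = "\<lambda>n \<omega>. ennreal ((enn2real (min (ennreal (F + real n)) (passage b \<omega>)) - F)\<^sup>2)"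
  \<comment> \<open>The value \<open>top\<close> on paths without passage is the limit of the
    truncated deviations \<open>(real n)\<^sup>2\<close>; its finite integral then makes such paths
    negligible.\<close>
  define G where "G \<omega> = (if passage b \<omega> = top then top else ennreal ((enn2real (passage b \<omega>) - F)\<^sup>2))" for \<omega>
  have [measurable]: "G \<in> borel_measurable N" unfolding G_def by measurable
  have lim: "(\<lambda>n. ?u n \<omega>) \<longlonglongrightarrow> G \<omega>" for \<omega>
  proof (cases "passage b \<omega>")
    case (real p)
    obtain m :: nat where m: "p < real m" using reals_Archimedean2 by blast
    have "\<forall>\<^sub>F n in sequentially. G \<omega> = ?u n \<omega>"
      using eventually_ge_at_top[of m]
    proof eventually_elim
      case (elim n)
      have "ennreal p \<le> ennreal (F + real n)" using elim m F by (intro ennreal_leI) simp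
      then have "min (ennreal (F + real n)) (passage b \<omega>) = passage b \<omega>" using real by (simp add: min_absorb2)
      then show ?case using real by (simp add: G_def)
    qed
    then show ?thesis by (rule Lim_transform_eventually[OF tendsto_const])
  next
    case top
    have "?u n \<omega> = ennreal ((real n)\<^sup>2)" for n using top F by (simp del: ennreal_plus)
    moreover have "(\<lambda>n. ennreal ((real n)\<^sup>2)) \<longlonglongrightarrow> top"
      unfolding ennreal_tendsto_top_eq_at_top
      by (intro filterlim_pow_at_top filterlim_real_sequentially) simp
    ultimately show ?thesis using top by (simp add: G_def)
  qed
  have "(\<integral>\<^sup>+\<omega>. G \<omega> \<partial>N) = (\<integral>\<^sup>+\<omega>. liminf (\<lambda>n. ?u n \<omega>) \<partial>N)"
    by (intro nn_integral_cong lim_imp_Liminf[symmetric] lim) auto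
  also have "\<dots> \<le> liminf (\<lambda>n. \<integral>\<^sup>+\<omega>. ?u n \<omega> \<partial>N)" by (rule nn_integral_liminf) measurable
  also have "\<dots> \<le> limsup (\<lambda>n. \<integral>\<^sup>+\<omega>. ?u n \<omega> \<partial>N)" by (rule Liminf_le_Limsup) simp
  also have "\<dots> \<le> ennreal \<eta>"
    using F by (intro Limsup_bounded always_eventually allI truncated_passage_deviation_le[OF b _ F \<eta> dev]) auto
  finally have G: "(\<integral>\<^sup>+\<omega>. G \<omega> \<partial>N) \<le> ennreal \<eta>" .
  have fin: "AE \<omega> in N. G \<omega> \<noteq> \<infinity>"
    using le_less_trans[OF G ennreal_less_top] by (intro nn_integral_noteq_infinite) auto
  have "(\<integral>\<^sup>+\<omega>. ennreal ((hit_below (\<lambda>t. Y t \<omega>) b - F)\<^sup>2) \<partial>N) = (\<integral>\<^sup>+\<omega>. G \<omega> \<partial>N)"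
  proof (rule nn_integral_cong_AE)
    show "AE \<omega> in N. ennreal ((hit_below (\<lambda>t. Y t \<omega>) b - F)\<^sup>2) = G \<omega>"
      using fin AE_space
    proof eventually_elim
      case (elim \<omega>)
      then have "passage b \<omega> \<noteq> top" by (auto simp: G_def)
      with elim show ?case by (simp add: G_def hit_below_eq_passage)
    qed
  qed
  with G show ?thesis by simp
qed

end

text \<open>The mean square deviation from \<open>F\<close> is the variance plus the squared bias.
  The bias is thus at most \<open>F / 2\<close>, so \<open>F\<close> can be exchanged for the mean
  at the price of a factor 4 in Chebyshev's inequality.\<close>

lemma (in prob_space) ratio_deviation_prob_le:
  fixes X :: "'a \<Rightarrow> real"
  assumes [measurable]: "X \<in> borel_measurable M" and F: "0 < F" and \<kappa>: "0 \<le> \<kappa>" "\<kappa> \<le> 1 / 4"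
    and dev: "(\<integral>\<^sup>+\<omega>. ennreal ((X \<omega> - F)\<^sup>2) \<partial>M) \<le> ennreal (\<kappa> * F\<^sup>2)" and e: "0 < e"
  shows "prob {\<omega> \<in> space M. e < \<bar>X \<omega> / expectation X - 1\<bar>} \<le> 4 * \<kappa> / e\<^sup>2"
proof -
  have int2: "integrable M (\<lambda>\<omega>. (X \<omega> - F)\<^sup>2)"
    using le_less_trans[OF dev ennreal_less_top] by (intro integrableI_nonneg) auto
  then have "integrable M (\<lambda>\<omega>. X \<omega> - F)" by (rule square_integrable_imp_integrable[rotated]) measurable
  then have "integrable M (\<lambda>\<omega>. (X \<omega> - F) + F)" by (rule Bochner_Integration.integrable_add) simp
  then have int1: "integrable M X" by simp
  have "integrable M (\<lambda>\<omega>. (X \<omega> - F)\<^sup>2 + 2 * F * X \<omega> - F\<^sup>2)" using int1 int2 by simp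
  then have intX2: "integrable M (\<lambda>\<omega>. (X \<omega>)\<^sup>2)" by (simp add: power2_diff algebra_simps)
  let ?m = "expectation X"
  have "expectation (\<lambda>\<omega>. (X \<omega> - F)\<^sup>2) \<le> \<kappa> * F\<^sup>2"
    using dev \<kappa>(1) by (subst (asm) nn_integral_eq_integral[OF int2]) (auto simp: ennreal_le_iff)
  moreover have "expectation (\<lambda>\<omega>. (X \<omega> - F)\<^sup>2) = variance X + (?m - F)\<^sup>2"
    using int1 intX2
    by (simp add: variance_eq power2_diff prob_space algebra_simps) (simp add: power2_eq_square)
  ultimately have sum: "variance X + (?m - F)\<^sup>2 \<le> \<kappa> * F\<^sup>2" by simp
  have "(?m - F)\<^sup>2 \<le> (F / 2)\<^sup>2"
  proof -
    have "(?m - F)\<^sup>2 \<le> \<kappa> * F\<^sup>2" using sum variance_positive[of X] by linarith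
    also have "\<dots> \<le> 1 / 4 * F\<^sup>2" using \<kappa> by (intro mult_right_mono) auto
    finally show ?thesis by (simp add: power_divide)
  qed
  then have "\<bar>?m - F\<bar> \<le> F / 2" using F by (simp add: abs_le_square_iff[symmetric])
  then have m: "F / 2 \<le> ?m" "0 < ?m" using F by linarith+
  have "prob {\<omega> \<in> space M. e < \<bar>X \<omega> / ?m - 1\<bar>} \<le> prob {\<omega> \<in> space M. e * ?m \<le> \<bar>X \<omega> - ?m\<bar>}"
  proof (rule finite_measure_mono)
    show "{\<omega> \<in> space M. e < \<bar>X \<omega> / ?m - 1\<bar>} \<subseteq> {\<omega> \<in> space M. e * ?m \<le> \<bar>X \<omega> - ?m\<bar>}"
    proof safe
      fix \<omega> assume "e < \<bar>X \<omega> / ?m - 1\<bar>"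
      then have "e * ?m \<le> \<bar>X \<omega> / ?m - 1\<bar> * \<bar>?m\<bar>" using m by (intro mult_mono) auto
      also have "\<dots> = \<bar>(X \<omega> / ?m - 1) * ?m\<bar>" by (rule abs_mult[symmetric])
      also have "(X \<omega> / ?m - 1) * ?m = X \<omega> - ?m" using m by (simp add: left_diff_distrib)
      finally show "e * ?m \<le> \<bar>X \<omega> - ?m\<bar>" .
    qed
  qed measurable
  also have "\<dots> \<le> variance X / (e * ?m)\<^sup>2"
    using e m by (intro Chebyshev_inequality intX2) auto
  also have "\<dots> \<le> \<kappa> * F\<^sup>2 / (e * (F / 2))\<^sup>2"
  proof (rule frac_le)
    show "variance X \<le> \<kappa> * F\<^sup>2" using sum zero_le_power2[of "?m - F"] by linarith
    show "(e * (F / 2))\<^sup>2 \<le> (e * ?m)\<^sup>2" using e m F by (intro power_mono mult_left_mono) auto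
  qed (use e F \<kappa> in auto)
  also have "\<dots> = 4 * \<kappa> / e\<^sup>2" using F e by (simp add: power_mult_distrib power_divide)
  finally show ?thesis .
qed

theorem theorem5p5:
  fixes \<gamma> \<sigma> :: real and \<pi> :: "real measure" and R :: "real \<Rightarrow> real"
    and M :: "'a measure" and L :: "real \<Rightarrow> 'a \<Rightarrow> real"
    and N :: "'b measure" and Y :: "real \<Rightarrow> 'b \<Rightarrow> real"
  assumes gamma_pos: "\<gamma> > 0"
    and sigma_nonneg: "\<sigma> \<ge> 0"
    and pi_ok: "levy_measure_ok \<pi>"
    and R_cont: "continuous_on {0..} R"
    and R_pos: "\<forall>x>0. R x > 0"
    and Levy: "levy_process_with_exponent M L (Psi \<gamma> \<sigma> \<pi>)"
    and integral_cond: "\<exists>a>0. (\<integral>\<^sup>+ x. indicator {a..} x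
                 * ennreal (1 / (x * Psi \<gamma> \<sigma> \<pi> (1 / x) * R x)) \<partial>lborel) < \<infinity>"
    and P_infty: "entrance_from_infinity M L R N Y"
    and H1: "Limsup (at_right 1)
               (\<lambda>h. Liminf at_top (\<lambda>x. ereal (phi \<gamma> R (h * x) / phi \<gamma> R x))) = 1"
    and H3: "\<exists>Vlim :: real \<Rightarrow> ereal.
               (\<forall>\<^sub>F \<rho> in at_right 0. ((\<lambda>z. Vfun R z \<rho>) \<longlongrightarrow> Vlim \<rho>) at_top)
             \<and> Limsup (at_right 0) Vlim = 0"
  shows "\<forall>\<epsilon>>0. ((\<lambda>b. measure N {\<omega> \<in> space N.
            \<bar>hit_below (\<lambda>t. Y t \<omega>) b / (\<integral>\<omega>'. hit_below (\<lambda>t. Y t \<omega>') b \<partial>N) - 1\<bar> > \<epsilon>})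
          \<longlongrightarrow> 0) at_top"
proof (intro allI impI)
  fix \<epsilon> :: real assume \<epsilon>: "0 < \<epsilon>"
  obtain C where C: "\<And>lam. 0 \<le> lam \<Longrightarrow> Psi \<gamma> \<sigma> \<pi> lam \<le> C * (lam + lam\<^sup>2)"
    using Psi_le_quadratic[OF pi_ok] by blast
  interpret M: prob_space M using Levy by (simp add: levy_process_with_exponent_def)
  interpret entrance_process M L "Psi \<gamma> \<sigma> \<pi>" \<gamma> C R N Y
    using gamma_pos Levy R_cont assms(5) P_infty Psi_ge_linear C Psi_slope_at_0[OF pi_ok]
    by unfold_locales auto
  show "((\<lambda>b. measure N {\<omega> \<in> space N.
            \<bar>hit_below (\<lambda>t. Y t \<omega>) b / (\<integral>\<omega>'. hit_below (\<lambda>t. Y t \<omega>') b \<partial>N) - 1\<bar> > \<epsilon>})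
          \<longlongrightarrow> 0) at_top"
  proof (rule tendstoI)
    fix e :: real assume e: "0 < e"
    \<comment> \<open>The cap \<open>1 / 4\<close> controls the bias of the mean, and
      \<open>e * \<epsilon>\<^sup>2 / 8\<close> makes the Chebyshev bound
      \<open>4 * \<kappa> / \<epsilon>\<^sup>2\<close> at most \<open>e / 2\<close>.\<close>
    define \<kappa> where "\<kappa> = min (1 / 4) (e * \<epsilon>\<^sup>2 / 8)"
    have \<kappa>: "0 < \<kappa>" "\<kappa> \<le> 1 / 4" "8 * \<kappa> \<le> e * \<epsilon>\<^sup>2" using e \<epsilon> by (auto simp: \<kappa>_def)
    show "\<forall>\<^sub>F b in at_top. dist (measure N {\<omega> \<in> space N.
            \<bar>hit_below (\<lambda>t. Y t \<omega>) b / (\<integral>\<omega>'. hit_below (\<lambda>t. Y t \<omega>') b \<partial>N) - 1\<bar> > \<epsilon>}) 0 < e"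
      using eventually_clock_concentrated[OF R_cont assms(5) H1 \<kappa>(1)]
    proof eventually_elim
      case (elim b)
      let ?F = "phi \<gamma> R b"
      from elim obtain y0 where b: "0 < b" "b \<le> y0" and F: "0 < ?F" and
        dev: "\<And>x. y0 \<le> x \<Longrightarrow> clock_concentrated R b ?F (\<kappa> * ?F\<^sup>2) x"
        by blast
      have "(\<integral>\<^sup>+\<omega>. ennreal ((hit_below (\<lambda>t. Y t \<omega>) b - ?F)\<^sup>2) \<partial>N) \<le> ennreal (\<kappa> * ?F\<^sup>2)"
        using \<kappa> F by (intro hit_below_deviation_le[OF b _ _ dev]) auto
      from N.ratio_deviation_prob_le[OF measurable_hit_below F _ \<kappa>(2) this \<epsilon>] \<kappa>(1)
      have "measure N {\<omega> \<in> space N. \<epsilon> < \<bar>hit_below (\<lambda>t. Y t \<omega>) b / (\<integral>\<omega>'. hit_below (\<lambda>t. Y t \<omega>') b \<partial>N) - 1\<bar>}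
          \<le> 4 * \<kappa> / \<epsilon>\<^sup>2" by simp
      also have "\<dots> \<le> e / 2" using \<kappa>(3) \<epsilon> by (simp add: pos_divide_le_eq)
      also have "\<dots> < e" using e by simp
      finally show ?case by simp
    qed
  qed
qed

end
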